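(* Let $G$ be a ($1$-finitely generated) $1$-formal group, i.e. $G$ is a finitely generated group which is $1$-formal. Then $\mathcal{R}^1_1(G,\mathbb{R})$ is a finite union of linear subspaces of $H^1(G,\mathbb{R})$ defined over $\mathbb{Q}$, and the Bieri–Neumann–Strebel invariant of $G$ is contained in its complement: $$\Sigma^1(G)\subseteq\mathcal{R}^1_1(G,\mathbb{R})^{c}=H^1(G,\mathbb{R})\setminus\mathcal{R}^1_1(G,\mathbb{R}).$$
   Context: A finitely generated group $G$ is $1$-formal if its Malcev Lie algebra (Malcev completion in the sense of Quillen: the complete filtered $\mathbb{Q}$-Lie algebra of primitive elements in the completion of $\mathbb{Q}G$ with respect to powers of the augmentation ideal) is quadratically presented, i.e. isomorphic, as a complete filtered Lie algebra, to the degree completion of a graded Lie algebra generated in degree $1$ with relations in degree $2$. $\mathcal{R}^1_1(G,\mathbb{R})$: let $A=H^*(G,\mathbb{R})$; for $a\in A^1$ let $(A,\cdot a)$ be the cochain complex with differential multiplication by $a$. Then $\mathcal{R}^1_1(G,\mathbb{R})=\{a\in A^1\mid H^1(A,\cdot a)\neq0\}$. $\Sigma^1(G)$: fix a finite generating set of $G$, with Cayley graph $\mathcal{C}(G)$ (edges joining $g$ to $gs$, $s$ a generator). $\Sigma^1(G)\subseteq\mathrm{Hom}(G,\mathbb{R})\setminus\{0\}=H^1(G,\mathbb{R})\setminus\{0\}$ consists of those non-zero homomorphisms $\chi\colon G\to\mathbb{R}$ for which the full subgraph of $\mathcal{C}(G)$ on the vertex set $\{g\in G\mid\chi(g)\ge0\}$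 is connected (this is independent of the generating set). *)

theory Defs
  imports
    Complex_Main
    "HOL-Library.Poly_Mapping"
    "HOL-Library.Function_Algebras"
    "HOL-Library.Set_Algebras"
    "HOL-Algebra.Generated_Groups"
    "Graph_Theory.Graph_Theory"
begin

section \<open>Vector spaces with a basis, and multilinear extension\<close>

interpretation qvs: vector_space "\<lambda>(c::rat) f. Poly_Mapping.map ((*) c) f"
  by standard
     (auto intro!: poly_mapping_eqI
       simp: Poly_Mapping.map.rep_eq lookup_add distrib_right when_def simp flip: distrib_left)

definition qspace :: "'b set \<Rightarrow> ('b \<Rightarrow>\<^sub>0 rat) set" where
  "qspace B = {f. Poly_Mapping.keys f \<subseteq> B}"

definition lin_ext :: "('b \<Rightarrow> 'c) \<Rightarrow> ('b \<Rightarrow>\<^sub>0 rat) \<Rightarrow> ('c \<Rightarrow>\<^sub>0 rat)" where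
  "lin_ext t f =
    (\<Sum>s\<in>Poly_Mapping.keys f. Poly_Mapping.single (t s) (Poly_Mapping.lookup f s))"

definition bilin_ext ::
  "('b \<Rightarrow> 'c \<Rightarrow> 'd) \<Rightarrow> ('b \<Rightarrow>\<^sub>0 rat) \<Rightarrow> ('c \<Rightarrow>\<^sub>0 rat) \<Rightarrow> ('d \<Rightarrow>\<^sub>0 rat)" where
  "bilin_ext t f g =
    (\<Sum>s\<in>Poly_Mapping.keys f. \<Sum>u\<in>Poly_Mapping.keys g.
      Poly_Mapping.single (t s u) (Poly_Mapping.lookup f s * Poly_Mapping.lookup g u))"


section \<open>Completions and complete filtered Lie algebras\<close>

text \<open>
  For a descending filtration F of a space A, the completion is the inverse limit of the
  quotients A / F n. Its elements are the compatible sequences of cosets.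
\<close>

definition completion :: "'v::ab_group_add set \<Rightarrow> (nat \<Rightarrow> 'v set) \<Rightarrow> (nat \<Rightarrow> 'v set) set" where
  "completion A F = {x. \<forall>n. (\<exists>f\<in>A. x n = f +o F n) \<and> x (Suc n) \<subseteq> x n}"

text \<open>Continuous extensions of filtration preserving maps; F is the filtration of the target.\<close>

definition completed1 ::
  "(nat \<Rightarrow> 'w::ab_group_add set) \<Rightarrow> ('v \<Rightarrow> 'w) \<Rightarrow> (nat \<Rightarrow> 'v set) \<Rightarrow> (nat \<Rightarrow> 'w set)" where
  "completed1 F t x = (\<lambda>n. \<Union>f\<in>x n. t f +o F n)"

definition completed2 ::
  "(nat \<Rightarrow> 'w::ab_group_add set) \<Rightarrow> ('u \<Rightarrow> 'v \<Rightarrow> 'w) \<Rightarrow> (nat \<Rightarrow> 'u set) \<Rightarrow> (nat \<Rightarrow> 'v set)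
    \<Rightarrow> (nat \<Rightarrow> 'w set)" where
  "completed2 F t x y = (\<lambda>n. \<Union>f\<in>x n. \<Union>g\<in>y n. t f g +o F n)"

record 'x filtered_lie =
  lie_carrier :: "'x set"
  lie_add :: "'x \<Rightarrow> 'x \<Rightarrow> 'x"
  lie_scale :: "rat \<Rightarrow> 'x \<Rightarrow> 'x"
  lie_bracket :: "'x \<Rightarrow> 'x \<Rightarrow> 'x"
  lie_filt :: "nat \<Rightarrow> 'x set"

definition filtered_lie_iso ::
  "('x, 'm) filtered_lie_scheme \<Rightarrow> ('y, 'n) filtered_lie_scheme \<Rightarrow> ('x \<Rightarrow> 'y) \<Rightarrow> bool" where
  "filtered_lie_iso L M \<phi> \<longleftrightarrow>
    bij_betw \<phi> (lie_carrier L) (lie_carrier M) \<and>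
    (\<forall>x\<in>lie_carrier L. \<forall>y\<in>lie_carrier L. \<phi> (lie_add L x y) = lie_add M (\<phi> x) (\<phi> y)) \<and>
    (\<forall>c. \<forall>x\<in>lie_carrier L. \<phi> (lie_scale L c x) = lie_scale M c (\<phi> x)) \<and>
    (\<forall>x\<in>lie_carrier L. \<forall>y\<in>lie_carrier L.
        \<phi> (lie_bracket L x y) = lie_bracket M (\<phi> x) (\<phi> y)) \<and>
    (\<forall>n. \<phi> ` lie_filt L n = lie_filt M n)"

text \<open>
  The n-th filtration step of the completion is the kernel of the projection to A / F n,
  that is, the closure of the image of F n.
\<close>

definition completed_lie ::
  "('b \<Rightarrow>\<^sub>0 rat) set \<Rightarrow> (nat \<Rightarrow> ('b \<Rightarrow>\<^sub>0 rat) set)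
    \<Rightarrow> (('b \<Rightarrow>\<^sub>0 rat) \<Rightarrow> ('b \<Rightarrow>\<^sub>0 rat) \<Rightarrow> ('b \<Rightarrow>\<^sub>0 rat))
    \<Rightarrow> (nat \<Rightarrow> ('b \<Rightarrow>\<^sub>0 rat) set) filtered_lie" where
  "completed_lie A F br =
    \<lparr>lie_carrier = completion A F,
     lie_add = completed2 F (+),
     lie_scale = (\<lambda>c. completed1 F (Poly_Mapping.map ((*) c))),
     lie_bracket = completed2 F br,
     lie_filt = (\<lambda>n. {x \<in> completion A F. x n = F n})\<rparr>"


section \<open>The Malcev Lie algebra of a group\<close>

abbreviation group_algebra :: "('a, 'm) monoid_scheme \<Rightarrow> ('a \<Rightarrow>\<^sub>0 rat) set" where
  "group_algebra G \<equiv> qspace (carrier G)"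

abbreviation conv ::
  "('a, 'm) monoid_scheme \<Rightarrow> ('a \<Rightarrow>\<^sub>0 rat) \<Rightarrow> ('a \<Rightarrow>\<^sub>0 rat) \<Rightarrow> ('a \<Rightarrow>\<^sub>0 rat)" where
  "conv G \<equiv> bilin_ext (monoid.mult G)"

definition augmentation_ideal :: "('a, 'm) monoid_scheme \<Rightarrow> ('a \<Rightarrow>\<^sub>0 rat) set" where
  "augmentation_ideal G =
    {f \<in> group_algebra G. (\<Sum>g\<in>Poly_Mapping.keys f. Poly_Mapping.lookup f g) = 0}"

fun augmentation_power :: "('a, 'm) monoid_scheme \<Rightarrow> nat \<Rightarrow> ('a \<Rightarrow>\<^sub>0 rat) set" where
  "augmentation_power G 0 = group_algebra G"
| "augmentation_power G (Suc n) =
    qvs.span {conv G f h | f h. f \<in> augmentation_ideal G \<and> h \<in> augmentation_power G n}"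

text \<open>
  The tensor square of the group algebra is the space with basis the pairs of group elements,
  with its tensor product filtration. Completing it gives the target of the comultiplication
  of the completed group algebra, which extends the map sending g to (g, g).
\<close>

abbreviation tensor :: "('a \<Rightarrow>\<^sub>0 rat) \<Rightarrow> ('a \<Rightarrow>\<^sub>0 rat) \<Rightarrow> ('a \<times> 'a \<Rightarrow>\<^sub>0 rat)" where
  "tensor \<equiv> bilin_ext Pair"

definition tensor_filt :: "('a, 'm) monoid_scheme \<Rightarrow> nat \<Rightarrow> ('a \<times> 'a \<Rightarrow>\<^sub>0 rat) set" where
  "tensor_filt G n = qvs.span
    {tensor f h | f h p q.
      f \<in> augmentation_power G p \<and> h \<in> augmentation_power G q \<and> p + q = n}"

abbreviation group_algebra_one :: "('a, 'm) monoid_scheme \<Rightarrow> ('a \<Rightarrow>\<^sub>0 rat)" where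
  "group_algebra_one G \<equiv> Poly_Mapping.single (monoid.one G) 1"

definition primitives :: "('a, 'm) monoid_scheme \<Rightarrow> (nat \<Rightarrow> ('a \<Rightarrow>\<^sub>0 rat) set) set" where
  "primitives G =
    {x \<in> completion (group_algebra G) (augmentation_power G).
      completed1 (tensor_filt G) (lin_ext (\<lambda>g. (g, g))) x =
      completed2 (tensor_filt G) (+)
        (completed1 (tensor_filt G) (\<lambda>f. tensor f (group_algebra_one G)) x)
        (completed1 (tensor_filt G) (\<lambda>f. tensor (group_algebra_one G) f) x)}"

definition malcev_lie ::
  "('a, 'm) monoid_scheme \<Rightarrow> (nat \<Rightarrow> ('a \<Rightarrow>\<^sub>0 rat) set) filtered_lie" where
  "malcev_lie G =
    (let U = completed_lie (group_algebra G) (augmentation_power G)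
               (\<lambda>f h. conv G f h - conv G h f)
     in U\<lparr>lie_carrier := primitives G, lie_filt := (\<lambda>n. primitives G \<inter> lie_filt U n)\<rparr>)"


section \<open>Quadratically presented Lie algebras and 1-formality\<close>

text \<open>
  The Lie algebra presented by generators X and relators R is the free nonassociative algebra
  on X (with basis the binary trees with leaves in X, graded by the number of leaves) modulo the
  ideal generated by the Lie identities and R.
\<close>

datatype 'x magma = Gen 'x | Node "'x magma" "'x magma"

primrec leaves :: "'x magma \<Rightarrow> nat" where
  "leaves (Gen x) = 1"
| "leaves (Node s t) = leaves s + leaves t"

definition free_nonassoc :: "'x set \<Rightarrow> ('x magma \<Rightarrow>\<^sub>0 rat) set" where
  "free_nonassoc X = qspace {t. set_magma t \<subseteq> X}"

abbreviation nprod ::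
  "('x magma \<Rightarrow>\<^sub>0 rat) \<Rightarrow> ('x magma \<Rightarrow>\<^sub>0 rat) \<Rightarrow> ('x magma \<Rightarrow>\<^sub>0 rat)" where
  "nprod \<equiv> bilin_ext Node"

definition lie_identities :: "'x set \<Rightarrow> ('x magma \<Rightarrow>\<^sub>0 rat) set" where
  "lie_identities X =
    {nprod f f | f. f \<in> free_nonassoc X} \<union>
    {nprod f (nprod g h) + nprod g (nprod h f) + nprod h (nprod f g) | f g h.
      f \<in> free_nonassoc X \<and> g \<in> free_nonassoc X \<and> h \<in> free_nonassoc X}"

definition nonassoc_ideal :: "'x set \<Rightarrow> ('x magma \<Rightarrow>\<^sub>0 rat) set \<Rightarrow> bool" where
  "nonassoc_ideal X J \<longleftrightarrow> qvs.subspace J \<and> J \<subseteq> free_nonassoc X \<and>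
    (\<forall>f\<in>free_nonassoc X. \<forall>j\<in>J. nprod f j \<in> J \<and> nprod j f \<in> J)"

definition relation_ideal ::
  "'x set \<Rightarrow> ('x magma \<Rightarrow>\<^sub>0 rat) set \<Rightarrow> ('x magma \<Rightarrow>\<^sub>0 rat) set" where
  "relation_ideal X R = nonassoc_ideal X hull (lie_identities X \<union> R)"

text \<open>
  For homogeneous R the presented Lie algebra h is graded, and its degree completion is the inverse
  limit of its quotients by the parts of degree at least n. These quotients are written here
  as quotients of the free nonassociative algebra.
\<close>

definition presented_filt ::
  "'x set \<Rightarrow> ('x magma \<Rightarrow>\<^sub>0 rat) set \<Rightarrow> nat \<Rightarrow> ('x magma \<Rightarrow>\<^sub>0 rat) set" where
  "presented_filt X R n =
    relation_ideal X R + qspace {t. set_magma t \<subseteq> X \<and> n \<le> leaves t}"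

definition completed_presented_lie ::
  "'x set \<Rightarrow> ('x magma \<Rightarrow>\<^sub>0 rat) set \<Rightarrow> (nat \<Rightarrow> ('x magma \<Rightarrow>\<^sub>0 rat) set) filtered_lie" where
  "completed_presented_lie X R = completed_lie (free_nonassoc X) (presented_filt X R) nprod"

text \<open>
  Taking the generators from the natural numbers is no restriction for a finitely generated G:
  an isomorphism as below identifies the degree one part of the graded Lie algebra, which has
  basis X, with the finite-dimensional space of the rational first homology of G.
\<close>

definition one_formal :: "('a, 'm) monoid_scheme \<Rightarrow> bool" where
  "one_formal G \<longleftrightarrow>
    (\<exists>(X :: nat set) R \<phi>. R \<subseteq> qspace {t. set_magma t \<subseteq> X \<and> leaves t = 2} \<and>
      filtered_lie_iso (malcev_lie G) (completed_presented_lie X R) \<phi>)"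


section \<open>Real group cohomology with cup product\<close>

text \<open>Inhomogeneous cochains with trivial coefficients; n-tuples are lists of length n.\<close>

definition tuples :: "('a, 'm) monoid_scheme \<Rightarrow> nat \<Rightarrow> 'a list set" where
  "tuples G n = {w. length w = n \<and> set w \<subseteq> carrier G}"

definition cochains :: "('a, 'm) monoid_scheme \<Rightarrow> nat \<Rightarrow> ('a list \<Rightarrow> real) set" where
  "cochains G n = {f. \<forall>w. w \<notin> tuples G n \<longrightarrow> f w = 0}"

definition merge_at :: "('a, 'm) monoid_scheme \<Rightarrow> nat \<Rightarrow> 'a list \<Rightarrow> 'a list" where
  "merge_at G i w = take i w @ [w ! i \<otimes>\<^bsub>G\<^esub> w ! Suc i] @ drop (i + 2) w"

definition cobd ::
  "('a, 'm) monoid_scheme \<Rightarrow> nat \<Rightarrow> ('a list \<Rightarrow> real) \<Rightarrow> ('a list \<Rightarrow> real)" where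
  "cobd G n f = (\<lambda>w. if w \<in> tuples G (Suc n)
     then f (tl w) + (\<Sum>i<n. (-1) ^ Suc i * f (merge_at G i w)) + (-1) ^ Suc n * f (butlast w)
     else 0)"

definition cocycles :: "('a, 'm) monoid_scheme \<Rightarrow> nat \<Rightarrow> ('a list \<Rightarrow> real) set" where
  "cocycles G n = {f \<in> cochains G n. cobd G n f = 0}"

fun coboundaries :: "('a, 'm) monoid_scheme \<Rightarrow> nat \<Rightarrow> ('a list \<Rightarrow> real) set" where
  "coboundaries G 0 = {0}"
| "coboundaries G (Suc n) = cobd G n ` cochains G n"

definition cohomology :: "('a, 'm) monoid_scheme \<Rightarrow> nat \<Rightarrow> ('a list \<Rightarrow> real) set set" where
  "cohomology G n = {f +o coboundaries G n | f. f \<in> cocycles G n}"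

definition cup_cochain ::
  "('a, 'm) monoid_scheme \<Rightarrow> nat \<Rightarrow> nat \<Rightarrow> ('a list \<Rightarrow> real) \<Rightarrow> ('a list \<Rightarrow> real)
    \<Rightarrow> ('a list \<Rightarrow> real)" where
  "cup_cochain G p q f h =
    (\<lambda>w. if w \<in> tuples G (p + q) then f (take p w) * h (drop p w) else 0)"

definition cup ::
  "('a, 'm) monoid_scheme \<Rightarrow> nat \<Rightarrow> nat \<Rightarrow> ('a list \<Rightarrow> real) set \<Rightarrow> ('a list \<Rightarrow> real) set
    \<Rightarrow> ('a list \<Rightarrow> real) set" where
  "cup G p q a b = (\<Union>f\<in>a. \<Union>h\<in>b. cup_cochain G p q f h +o coboundaries G (p + q))"


section \<open>First cohomology as a space of homomorphisms; the resonance variety\<close>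

interpretation rfun: vector_space "\<lambda>(c::real) (f :: 'a \<Rightarrow> real) x. c * f x"
  by standard (auto simp: fun_eq_iff algebra_simps)

definition real_add_group :: "real monoid" where
  "real_add_group = \<lparr>carrier = UNIV, monoid.mult = (+), one = 0\<rparr>"

text \<open>Homomorphisms are extended by 0 outside the carrier, to have unique representatives.\<close>

definition H1 :: "('a, 'm) monoid_scheme \<Rightarrow> ('a \<Rightarrow> real) set" where
  "H1 G = {\<chi> \<in> hom G real_add_group. \<forall>g. g \<notin> carrier G \<longrightarrow> \<chi> g = 0}"

definition H1_class :: "('a, 'm) monoid_scheme \<Rightarrow> ('a \<Rightarrow> real) \<Rightarrow> ('a list \<Rightarrow> real) set" where
  "H1_class G \<chi> = (\<lambda>w. if w \<in> tuples G 1 then \<chi> (hd w) else 0) +o coboundaries G 1"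

lemma coboundaries_1: "coboundaries G 1 = {0}"
proof -
  have "cobd G 0 f = 0" for f
    by (auto simp: cobd_def tuples_def fun_eq_iff length_Suc_conv)
  moreover have "0 \<in> cochains G 0"
    by (simp add: cochains_def)
  ultimately show ?thesis
    by auto
qed

lemma bij_betw_H1_class:
  assumes "group G"
  shows "bij_betw (H1_class G) (H1 G) (cohomology G 1)"
proof -
  interpret group G by fact
  let ?c = "\<lambda>\<chi> w. if w \<in> tuples G 1 then \<chi> (hd w) else (0::real)"
  have cls: "H1_class G \<chi> = {?c \<chi>}" for \<chi>
    unfolding H1_class_def coboundaries_1 by (simp add: elt_set_plus_def)
  have coh: "cohomology G 1 = (\<lambda>f. {f}) ` cocycles G 1"
    unfolding cohomology_def coboundaries_1 by (auto simp: elt_set_plus_def)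
  have cobd1: "cobd G 1 f [g, h] = 0 \<longleftrightarrow> f [g \<otimes>\<^bsub>G\<^esub> h] = f [g] + f [h]"
    if "g \<in> carrier G" "h \<in> carrier G" for f g h
    using that by (auto simp: cobd_def tuples_def merge_at_def)
  have Z: "f \<in> cocycles G 1 \<longleftrightarrow> f \<in> cochains G 1 \<and>
      (\<forall>g\<in>carrier G. \<forall>h\<in>carrier G. f [g \<otimes>\<^bsub>G\<^esub> h] = f [g] + f [h])" for f
  proof -
    have "cobd G 1 f = 0 \<longleftrightarrow> (\<forall>g\<in>carrier G. \<forall>h\<in>carrier G. cobd G 1 f [g, h] = 0)"
    proof
      assume *: "\<forall>g\<in>carrier G. \<forall>h\<in>carrier G. cobd G 1 f [g, h] = 0"
      have "cobd G 1 f w = 0" for w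
      proof (cases "w \<in> tuples G 2")
        case True
        then obtain g h where "w = [g, h]" "g \<in> carrier G" "h \<in> carrier G"
          by (auto simp: tuples_def numeral_2_eq_2 length_Suc_conv)
        with * show ?thesis by (simp only:)
      next
        case False
        then show ?thesis by (simp add: cobd_def numeral_2_eq_2)
      qed
      then show "cobd G 1 f = 0" by (auto simp: fun_eq_iff)
    qed simp
    then show ?thesis
      by (auto simp: cocycles_def cobd1 simp del: One_nat_def)
  qed
  have "inj_on (H1_class G) (H1 G)"
  proof (rule inj_onI, rule ext)
    fix \<chi> \<psi> g
    assume *: "\<chi> \<in> H1 G" "\<psi> \<in> H1 G" "H1_class G \<chi> = H1_class G \<psi>"
    show "\<chi> g = \<psi> g"
    proof (cases "g \<in> carrier G")
      case True
      have "?c \<chi> = ?c \<psi>"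
        using *(3) unfolding cls by (rule singleton_inject)
      then have "?c \<chi> [g] = ?c \<psi> [g]" by (rule fun_cong)
      with True show ?thesis by (simp add: tuples_def)
    qed (use * in \<open>simp add: H1_def\<close>)
  qed
  moreover have "H1_class G \<chi> \<in> cohomology G 1" if "\<chi> \<in> H1 G" for \<chi>
  proof -
    have "?c \<chi> \<in> cocycles G 1"
      using that unfolding Z by (auto simp: cochains_def tuples_def H1_def hom_def real_add_group_def)
    then show ?thesis unfolding cls coh by (rule imageI)
  qed
  moreover have "\<exists>\<chi>\<in>H1 G. {f} = H1_class G \<chi>" if "f \<in> cocycles G 1" for f
  proof -
    define \<chi> where "\<chi> g = (if g \<in> carrier G then f [g] else 0)" for g
    have "\<chi> \<in> H1 G"
      using that unfolding Z by (auto simp: H1_def hom_def real_add_group_def \<chi>_def)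
    moreover have "?c \<chi> = f"
      using that unfolding Z by (auto simp: cochains_def tuples_def \<chi>_def fun_eq_iff length_Suc_conv)
    ultimately show ?thesis by (intro bexI[of _ \<chi>]) (simp_all only: cls)
  qed
  ultimately show ?thesis
    unfolding bij_betw_def coh by (intro conjI equalityI subsetI) (auto simp only: image_iff)
qed

text \<open>
  The degree one cocycles and coboundaries of the complex on the cohomology algebra with
  differential multiplication by a. The zero element of the second cohomology is the set of
  2-coboundaries.
\<close>

definition aomoto_cocycles ::
  "('a, 'm) monoid_scheme \<Rightarrow> ('a list \<Rightarrow> real) set \<Rightarrow> ('a list \<Rightarrow> real) set set" where
  "aomoto_cocycles G a = {b \<in> cohomology G 1. cup G 1 1 b a = coboundaries G 2}"

definition aomoto_coboundaries ::
  "('a, 'm) monoid_scheme \<Rightarrow> ('a list \<Rightarrow> real) set \<Rightarrow> ('a list \<Rightarrow> real) set set" where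
  "aomoto_coboundaries G a = (\<lambda>c. cup G 0 1 c a) ` cohomology G 0"

definition resonance1 :: "('a, 'm) monoid_scheme \<Rightarrow> ('a \<Rightarrow> real) set" where
  "resonance1 G =
    {\<chi> \<in> H1 G. aomoto_cocycles G (H1_class G \<chi>) \<noteq> aomoto_coboundaries G (H1_class G \<chi>)}"

definition rational_subspace :: "('a, 'm) monoid_scheme \<Rightarrow> ('a \<Rightarrow> real) set \<Rightarrow> bool" where
  "rational_subspace G L \<longleftrightarrow> rfun.subspace L \<and> L \<subseteq> H1 G \<and>
    L = rfun.span {\<chi> \<in> L. \<forall>g. \<chi> g \<in> \<rat>}"


section \<open>The Bieri-Neumann-Strebel invariant\<close>

text \<open>
  The library's notion of connectedness for digraphs forgets the orientation of the arcs.
\<close>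

definition cayley_graph :: "('a, 'm) monoid_scheme \<Rightarrow> 'a set \<Rightarrow> ('a, 'a \<times> 'a) pre_digraph" where
  "cayley_graph G S =
    \<lparr>verts = carrier G, arcs = carrier G \<times> S, tail = fst, head = (\<lambda>(g, s). g \<otimes>\<^bsub>G\<^esub> s)\<rparr>"

definition BNS :: "('a, 'm) monoid_scheme \<Rightarrow> 'a set \<Rightarrow> ('a \<Rightarrow> real) set" where
  "BNS G S = {\<chi> \<in> H1 G - {0}.
    Digraph_Component.connected (cayley_graph G S \<restriction> {g \<in> carrier G. 0 \<le> \<chi> g})}"

end

theory Submission
  imports
    Defs
    "HOL-Computational_Algebra.Polynomial"
    "HOL-Computational_Algebra.Formal_Power_Series"
    "Jordan_Normal_Form.Determinant"
begin

text \<open>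
  A nonzero character \<open>v\<close> of a 1-formal group is resonant if and only if the character \<open>exp (t v)\<close> with values in
  formal power series has a cocycle that is not principal. If it has one, the first two
  coefficients of a normalised cocycle exhibit a trivial cup product. Conversely, let
  \<open>v \<union> w = 0\<close>. For a 1-formal group the pair \<open>(v, w)\<close> defines a Lie algebra homomorphism
  from the quadratically presented Lie algebra to the affine Lie algebra over formal power series.
  It is evaluated on \<open>log g\<close>, and the action of \<open>g\<close> on the Malcev Lie algebra by
  conjugation, which is \<open>exp (ad (log g))\<close>, shows that this yields a cocycle with constant
  coefficient \<open>w\<close>. No Baker-Campbell-Hausdorff formula is needed, as conjugation is an action.

  The existence of a cocycle is expressed by the vanishing of determinants whose entries are
  combinations of the exponentials \<open>exp (t v(g))\<close>. Since exponentials are linearly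
  independent, the zeros of such an expression form a finite union of subspaces, each cut out by
  equations \<open>v(g) = v(h)\<close>.

  If \<open>v\<close> lies in the Bieri-Neumann-Strebel invariant, paths in the half space \<open>v \<ge> 0\<close>
  express the values of a normalised cocycle on the generators by themselves, with coefficients
  that are combinations of exponentials of positive exponents. The identity minus the matrix
  of these coefficients is nonsingular, so the cocycle vanishes.
\<close>

section \<open>Linear maps between spaces with a basis\<close>

text \<open>The homomorphism sends a generator \<open>x\<close> to \<open>(t v(x), w(x))\<close> in
  the Lie algebra with bracket \<open>[(a, b), (a', b')] = (0, a b' - a' b)\<close>. As relators
  have degree two, the only obstruction is the value of \<open>v \<union> w\<close> on them;
  relators of higher degree would impose further conditions. Exponentials and logarithms as infinite
  series are avoided: modulo each power of the augmentation ideal, \<open>g ^ m\<close> is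
  polynomial in \<open>m\<close>, so logarithm, bracket and conjugation are coefficients of
  polynomials, read off from finitely many values by rational weights. The exponential of
  \<open>ad (log g)\<close> reappears as the solution of a differential equation in
  \<open>m\<close>. Conjugation is evaluated on \<open>log s\<close> for some \<open>s\<close> with
  \<open>v(s) \<noteq> 0\<close>; this yields the cocycle identity multiplied by
  \<open>t v(s)\<close>, a factor that cancels. Principal cocycles are excluded by asking for the
  value 0 at a generator on which \<open>v\<close> does not vanish. Such a generator varies with
  \<open>v\<close>, whereas the determinants have to be chosen before \<open>v\<close>; hence the
  condition is imposed at every generator.\<close>

abbreviation qscale :: "rat \<Rightarrow> ('b \<Rightarrow>\<^sub>0 rat) \<Rightarrow> ('b \<Rightarrow>\<^sub>0 rat)" where
  "qscale c f \<equiv> Poly_Mapping.map ((*) c) f"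

abbreviation qlinear :: "(('b \<Rightarrow>\<^sub>0 rat) \<Rightarrow> ('c \<Rightarrow>\<^sub>0 rat)) \<Rightarrow> bool" where
  "qlinear \<equiv> Vector_Spaces.linear qscale qscale"

lemma lookup_qscale [simp]: "Poly_Mapping.lookup (qscale c f) s = c * Poly_Mapping.lookup f s"
  by (simp add: Poly_Mapping.map.rep_eq when_def)

lemma qscale_single [simp]: "qscale c (Poly_Mapping.single s a) = Poly_Mapping.single s (c * a)"
  by (rule poly_mapping_eqI) (simp add: lookup_single when_def)

lemma poly_mapping_map_ident [simp]: "Poly_Mapping.map (\<lambda>a. a) f = f"
  by (rule poly_mapping_eqI) (simp add: Poly_Mapping.map.rep_eq when_def)

lemma qlinearI:
  assumes "\<And>f g. A (f + g) = A f + A g" and "\<And>c f. A (qscale c f) = qscale c (A f)"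
  shows "qlinear A"
  using assms by (simp add: Vector_Spaces.linear_iff qvs.vector_space_axioms)

lemma qlinear_add: "qlinear A \<Longrightarrow> A (f + g) = A f + A g"
  and qlinear_scale: "qlinear A \<Longrightarrow> A (qscale c f) = qscale c (A f)"
  by (simp_all add: Vector_Spaces.linear_iff)

lemma qlinear_zero: "qlinear A \<Longrightarrow> A 0 = 0"
  using qlinear_add[of A 0 0] by simp

lemma qlinear_diff: "qlinear A \<Longrightarrow> A (f - g) = A f - A g"
  using qlinear_add[of A "f - g" g] by simp

lemma qlinear_sum: "qlinear A \<Longrightarrow> A (\<Sum>i\<in>I. f i) = (\<Sum>i\<in>I. A (f i))"
  by (induction I rule: infinite_finite_induct) (simp_all add: qlinear_zero qlinear_add)

lemma qlinear_id: "qlinear (\<lambda>f. f)"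
  by (rule qlinearI) auto

lemma qlinear_compose: "qlinear A \<Longrightarrow> qlinear B \<Longrightarrow> qlinear (\<lambda>f. A (B f))"
  by (rule qlinearI) (simp_all add: qlinear_add qlinear_scale)

lemma qlinear_minus: "qlinear A \<Longrightarrow> qlinear B \<Longrightarrow> qlinear (\<lambda>f. A f - B f)"
  by (rule qlinearI) (simp_all add: qlinear_add qlinear_scale qvs.scale_right_diff_distrib)

lemma qlinear_funpow:
  fixes A :: "('b \<Rightarrow>\<^sub>0 rat) \<Rightarrow> ('b \<Rightarrow>\<^sub>0 rat)"
  shows "qlinear A \<Longrightarrow> qlinear (A ^^ n)"
proof (induction n)
  case 0
  have "A ^^ 0 = (\<lambda>f. f)" by auto
  then show ?case by (simp only: qlinear_id)
next
  case (Suc n)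
  then show ?case using qlinear_compose[of A "A ^^ n"] by (simp add: comp_def)
qed

lemma qlinear_span_mem:
  assumes "qlinear A" "qvs.subspace V" "\<And>f. f \<in> S \<Longrightarrow> A f \<in> V" "f \<in> qvs.span S"
  shows "A f \<in> V"
  using assms(4)
proof (induction rule: qvs.span_induct_alt)
  case base
  then show ?case using assms by (simp add: qlinear_zero qvs.subspace_0)
next
  case (step c x y)
  then show ?case using assms
    by (simp add: qlinear_add qlinear_scale qvs.subspace_add qvs.subspace_scale)
qed

text \<open>Scaling by 0 removes keys, so the sums run over different sets; the assumption on
  \<open>h s 0\<close> makes up for this.\<close>

lemma sum_keys_scale:
  fixes h :: "'b \<Rightarrow> rat \<Rightarrow> 'v::comm_monoid_add"
  assumes "\<And>s. h s 0 = 0"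
  shows "(\<Sum>s\<in>Poly_Mapping.keys (qscale c f). h s (Poly_Mapping.lookup (qscale c f) s)) =
    (\<Sum>s\<in>Poly_Mapping.keys f. h s (c * Poly_Mapping.lookup f s))"
  by (rule sum.mono_neutral_cong_left) (auto simp: in_keys_iff assms)

lemma qlinear_lin_ext: "qlinear (lin_ext t)"
  unfolding lin_ext_def
  by (rule qlinearI; subst setsum_keys_plus_distrib sum_keys_scale)
     (simp_all add: single_add qvs.scale_sum_right)

lemma lin_ext_single [simp]: "lin_ext t (Poly_Mapping.single s a) = Poly_Mapping.single (t s) a"
  by (simp add: lin_ext_def)

lemma qlinear_bilin_ext_left: "qlinear (\<lambda>f. bilin_ext t f g)"
  unfolding bilin_ext_def
  by (rule qlinearI; subst setsum_keys_plus_distrib sum_keys_scale)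
     (simp_all add: single_add qvs.scale_sum_right distrib_right mult.assoc sum.distrib)

lemma qlinear_bilin_ext_right: "qlinear (\<lambda>g. bilin_ext t f g)"
proof (rule qlinearI)
  fix g h c
  show "bilin_ext t f (g + h) = bilin_ext t f g + bilin_ext t f h"
    unfolding bilin_ext_def sum.distrib[symmetric]
    by (intro sum.cong refl, subst setsum_keys_plus_distrib) (simp_all add: single_add distrib_left)
  show "bilin_ext t f (qscale c g) = qscale c (bilin_ext t f g)"
    unfolding bilin_ext_def qvs.scale_sum_right
    by (rule sum.cong[OF refl], subst sum_keys_scale) (simp_all add: mult.left_commute)
qed

lemmas bilin_ext_add_left = qlinear_add[OF qlinear_bilin_ext_left]
  and bilin_ext_add_right = qlinear_add[OF qlinear_bilin_ext_right]
  and bilin_ext_diff_left = qlinear_diff[OF qlinear_bilin_ext_left]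
  and bilin_ext_diff_right = qlinear_diff[OF qlinear_bilin_ext_right]
  and bilin_ext_zero_left [simp] = qlinear_zero[OF qlinear_bilin_ext_left]
  and bilin_ext_zero_right [simp] = qlinear_zero[OF qlinear_bilin_ext_right]

lemma bilin_ext_single [simp]:
  "bilin_ext t (Poly_Mapping.single s a) (Poly_Mapping.single u b) =
    Poly_Mapping.single (t s u) (a * b)"
  by (simp add: bilin_ext_def)

lemma subspace_qspace: "qvs.subspace (qspace B)"
  unfolding qvs.subspace_def qspace_def subset_iff in_keys_iff
  by (simp add: lookup_add) (metis add.right_neutral)

lemma single_in_qspace [simp]: "s \<in> B \<Longrightarrow> Poly_Mapping.single s a \<in> qspace B"
  by (auto simp: qspace_def)

lemma poly_mapping_sum_single:
  "f = (\<Sum>s\<in>Poly_Mapping.keys f. qscale (Poly_Mapping.lookup f s) (Poly_Mapping.single s 1))"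
  by (rule poly_mapping_eqI)
     (simp add: lookup_sum lookup_single when_def sum.delta' in_keys_iff)

lemma qspace_eq_span: "qspace B = qvs.span ((\<lambda>s. Poly_Mapping.single s 1) ` B)"
proof
  show "qspace B \<subseteq> qvs.span ((\<lambda>s. Poly_Mapping.single s 1) ` B)"
    by (rule subsetI, subst poly_mapping_sum_single)
       (rule qvs.span_sum, rule qvs.span_scale, rule qvs.span_base, auto simp: qspace_def)
  show "qvs.span ((\<lambda>s. Poly_Mapping.single s 1) ` B) \<subseteq> qspace B"
    by (rule qvs.span_minimal[OF _ subspace_qspace]) auto
qed

lemma qlinear_mem_on_qspace:
  assumes "qlinear A" "qvs.subspace V" "f \<in> qspace B"
    and "\<And>s. s \<in> B \<Longrightarrow> A (Poly_Mapping.single s 1) \<in> V"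
  shows "A f \<in> V"
  using qlinear_span_mem[OF assms(1,2), of "(\<lambda>s. Poly_Mapping.single s 1) ` B"] assms
  unfolding qspace_eq_span by auto

text \<open>One extension serves both sides of the presentation: real functions are evaluated on the
  rational group algebra and on rational combinations of trees.\<close>

definition real_ext :: "('b \<Rightarrow> real) \<Rightarrow> ('b \<Rightarrow>\<^sub>0 rat) \<Rightarrow> real" where
  "real_ext u f = (\<Sum>s\<in>Poly_Mapping.keys f. of_rat (Poly_Mapping.lookup f s) * u s)"

lemma real_ext_add: "real_ext u (f + g) = real_ext u f + real_ext u g"
  unfolding real_ext_def by (subst setsum_keys_plus_distrib) (simp_all add: of_rat_add distrib_right)

lemma real_ext_scale: "real_ext u (qscale c f) = of_rat c * real_ext u f"
  unfolding real_ext_def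
  by (subst sum_keys_scale) (simp_all add: of_rat_mult sum_distrib_left mult.assoc)

lemma real_ext_zero [simp]: "real_ext u 0 = 0"
  by (simp add: real_ext_def)

lemma real_ext_diff: "real_ext u (f - g) = real_ext u f - real_ext u g"
  using real_ext_add[of u "f - g" g] by simp

lemma real_ext_sum: "real_ext u (\<Sum>i\<in>I. f i) = (\<Sum>i\<in>I. real_ext u (f i))"
  by (induction I rule: infinite_finite_induct) (simp_all add: real_ext_add)

lemma real_ext_single [simp]: "real_ext u (Poly_Mapping.single s a) = of_rat a * u s"
  by (simp add: real_ext_def)

lemma subspace_real_ext_kernel: "qvs.subspace {f. real_ext u f = 0}"
  by (simp add: qvs.subspace_def real_ext_add real_ext_scale)

lemma real_ext_zero_on_span:
  assumes "\<And>f. f \<in> S \<Longrightarrow> real_ext u f = 0" "f \<in> qvs.span S"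
  shows "real_ext u f = 0"
  using qvs.span_minimal[OF _ subspace_real_ext_kernel, of S u] assms by auto

lemma real_ext_cong_qspace:
  assumes "f \<in> qspace B" "\<And>s. s \<in> B \<Longrightarrow> u s = u' s"
  shows "real_ext u f = real_ext u' f"
  unfolding real_ext_def using assms by (intro sum.cong) (auto simp: qspace_def)

lemma real_ext_bilin_ext:
  "real_ext u (bilin_ext t f g) =
    (\<Sum>s\<in>Poly_Mapping.keys f. of_rat (Poly_Mapping.lookup f s) *
      (\<Sum>r\<in>Poly_Mapping.keys g. of_rat (Poly_Mapping.lookup g r) * u (t s r)))"
  by (simp add: bilin_ext_def real_ext_sum sum_distrib_left of_rat_mult mult.assoc)

section \<open>Polynomial functions of an exponent\<close>

text \<open>Lagrange interpolation at the nodes 0, ..., N - 1: the weight of node \<open>m\<close>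
  is the k-th coefficient of the m-th Lagrange polynomial.\<close>

lemma interpolation_functional:
  "\<exists>w. \<forall>p :: rat poly. degree p < N \<longrightarrow> (\<Sum>m<N. w m * poly p (of_nat m)) = coeff p k"
proof -
  define L :: "nat \<Rightarrow> rat poly" where
    "L m = smult (inverse (\<Prod>j\<in>{..<N} - {m}. of_nat m - of_nat j))
      (\<Prod>j\<in>{..<N} - {m}. [:- of_nat j, 1:])" for m
  have deg: "degree (L m) < N" if "m < N" for m
  proof -
    have "degree (\<Prod>j\<in>{..<N} - {m}. [:- of_nat j, 1 :: rat:]) \<le> (\<Sum>j\<in>{..<N} - {m}. 1)"
      by (rule order.trans[OF degree_prod_sum_le]) auto
    also have "\<dots> < N" using that by simp
    finally show ?thesis unfolding L_def by (rule le_less_trans[OF degree_smult_le])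
  qed
  have val: "poly (L m) (of_nat i) = (if i = m then 1 else 0)" if "i < N" for m i
    using that by (auto simp: L_def poly_prod intro!: prod_zero)
  have "(\<Sum>m<N. coeff (L m) k * poly p (of_nat m)) = coeff p k" if "degree p < N" for p
  proof -
    let ?q = "\<Sum>m<N. smult (poly p (of_nat m)) (L m)"
    have "p = ?q"
    proof (rule poly_eqI_degree[where A = "of_nat ` {..<N}"])
      fix x :: rat assume "x \<in> of_nat ` {..<N}"
      then obtain i where i: "x = of_nat i" "i < N" by auto
      have "poly ?q x = (\<Sum>m<N. poly p (of_nat m) * (if i = m then 1 else 0))"
        using i by (simp add: poly_sum val)
      also have "\<dots> = (\<Sum>m<N. if i = m then poly p (of_nat m) else 0)"
        by (intro sum.cong) auto
      finally show "poly p x = poly ?q x" using i by simp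
    next
      show "card (of_nat ` {..<N} :: rat set) > degree p"
        using that by (subst card_image) (auto simp: inj_on_def)
      have "degree ?q < N" using that deg
        by (intro degree_sum_less) (auto intro: le_less_trans[OF degree_smult_le])
      then show "card (of_nat ` {..<N} :: rat set) > degree ?q"
        by (subst card_image) (auto simp: inj_on_def)
    qed
    then have "coeff p k = coeff ?q k" by simp
    then show ?thesis by (simp add: coeff_sum mult.commute)
  qed
  then show ?thesis by (intro exI[of _ "\<lambda>m. coeff (L m) k"]) simp
qed

text \<open>Rational values allow the weights to multiply elements of the rational group algebra.
  The case \<open>k = 1\<close> gives logarithms and derivatives at 0; all \<open>k\<close> together
  give interpolation.\<close>

definition coeff_weight :: "nat \<Rightarrow> nat \<Rightarrow> nat \<Rightarrow> rat" where
  "coeff_weight N k = (SOME w. \<forall>p :: rat poly. degree p < N \<longrightarrow>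
    (\<Sum>m<N. w m * poly p (of_nat m)) = coeff p k)"

lemma coeff_weight:
  "degree p < N \<Longrightarrow> (\<Sum>m<N. coeff_weight N k m * poly p (of_nat m)) = coeff p k"
  unfolding coeff_weight_def using someI_ex[OF interpolation_functional[of N k]] by simp

definition binomial_poly :: "nat \<Rightarrow> rat poly" where
  "binomial_poly k = smult (inverse (fact k)) (\<Prod>i<k. [:- of_nat i, 1:])"

lemma poly_binomial_poly: "poly (binomial_poly k) (of_nat m) = of_nat (m choose k)"
  by (simp add: binomial_poly_def poly_prod binomial_gbinomial gbinomial_prod_rev
      divide_inverse mult.commute atLeast0LessThan)

lemma degree_binomial_poly: "degree (binomial_poly k) \<le> k"
proof -
  have "degree (\<Prod>i<k. [:- of_nat i, 1 :: rat:]) \<le> (\<Sum>i<k. 1)"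
    by (rule order.trans[OF degree_prod_sum_le]) auto
  then show ?thesis unfolding binomial_poly_def by (simp add: order.trans[OF degree_smult_le])
qed

lemma coeff_binomial_poly_0: "k > 0 \<Longrightarrow> coeff (binomial_poly k) 0 = 0"
  by (simp add: binomial_poly_def poly_prod flip: poly_0_coeff_0)

section \<open>Powers of operators that are unipotent modulo each step of a filtration\<close>

lemma unipotent_power:
  assumes "qlinear A"
  shows "((\<lambda>f. f + A f) ^^ m) f = (\<Sum>p\<le>m. qscale (of_nat (m choose p)) ((A ^^ p) f))"
proof (induction m)
  case (Suc m)
  let ?c = "\<lambda>m p. qscale (of_nat (m choose p)) ((A ^^ p) f)"
  have "((\<lambda>f. f + A f) ^^ Suc m) f = (\<Sum>p\<le>m. ?c m p) + (\<Sum>p\<le>m. A (?c m p))"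
    using Suc by (simp add: qlinear_sum[OF assms])
  also have "(\<Sum>p\<le>m. A (?c m p)) = (\<Sum>p\<le>m. qscale (of_nat (m choose p)) ((A ^^ Suc p) f))"
    by (simp add: qlinear_scale[OF assms])
  also have "(\<Sum>p\<le>m. ?c m p) = f + (\<Sum>p\<le>m. qscale (of_nat (m choose Suc p)) ((A ^^ Suc p) f))"
    using sum.atMost_Suc_shift[of "?c m" m] by (simp add: binomial_eq_0 del: funpow.simps)
  also have "f + (\<Sum>p\<le>m. qscale (of_nat (m choose Suc p)) ((A ^^ Suc p) f)) +
      (\<Sum>p\<le>m. qscale (of_nat (m choose p)) ((A ^^ Suc p) f)) =
      f + (\<Sum>p\<le>m. qscale (of_nat (Suc m choose Suc p)) ((A ^^ Suc p) f))"
    by (simp add: qvs.scale_left_distrib sum.distrib add.commute add.left_commute del: funpow.simps)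
  also have "\<dots> = (\<Sum>p\<le>Suc m. ?c (Suc m) p)"
    by (simp only: sum.atMost_Suc_shift) simp
  finally show ?case .
qed simp

text \<open>Two instances are intended: left multiplication by \<open>g\<close> and right
  multiplication by \<open>h\<close>, each minus the identity, on the group algebra; and left
  multiplication by \<open>(g, \<one>)\<close> and by \<open>(\<one>, g)\<close>, each minus the
  identity, on the tensor square.\<close>

locale filtered_operators =
  fixes U :: "nat \<Rightarrow> ('b \<Rightarrow>\<^sub>0 rat) set" and A B :: "('b \<Rightarrow>\<^sub>0 rat) \<Rightarrow> ('b \<Rightarrow>\<^sub>0 rat)"
  assumes subspace: "qvs.subspace (U n)"
    and decreasing: "U (Suc n) \<subseteq> U n"
    and linear: "qlinear A" "qlinear B"
    and raise: "f \<in> U n \<Longrightarrow> A f \<in> U (Suc n)" "f \<in> U n \<Longrightarrow> B f \<in> U (Suc n)"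
begin

lemma antimono: "m \<le> n \<Longrightarrow> U n \<subseteq> U m"
  by (rule lift_Suc_antimono_le[of U, OF decreasing])

lemma funpow_raise:
  assumes "f \<in> U 0" shows "(A ^^ p) ((B ^^ q) f) \<in> U (p + q)"
proof -
  have "(B ^^ q) f \<in> U q" by (induction q) (use assms raise in auto)
  then show ?thesis by (induction p) (use raise in auto)
qed

lemma expand:
  "qscale c (\<Sum>p\<in>P. qscale (a p) ((A ^^ p) (\<Sum>q\<in>Q. qscale (b q) ((B ^^ q) f)))) =
    (\<Sum>p\<in>P. \<Sum>q\<in>Q. qscale (c * (a p * b q)) ((A ^^ p) ((B ^^ q) f)))"
proof -
  have "(A ^^ p) (\<Sum>q\<in>Q. qscale (b q) ((B ^^ q) f)) = (\<Sum>q\<in>Q. qscale (b q) ((A ^^ p) ((B ^^ q) f)))"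
    for p
    by (simp only: qlinear_sum[OF qlinear_funpow[OF linear(1)]]
        qlinear_scale[OF qlinear_funpow[OF linear(1)]])
  then show ?thesis by (simp only: qvs.scale_sum_right qvs.scale_scale)
qed

text \<open>Terms with \<open>p + q \<ge> n\<close> lie in \<open>U n\<close> because each operator
  raises the filtration; the weights annihilate all others.\<close>

lemma weighted_sum_mem:
  assumes "f \<in> U 0"
    and "\<And>p q. p \<in> I \<Longrightarrow> q \<in> I \<Longrightarrow> p + q < n \<Longrightarrow> (\<Sum>m\<in>M. \<mu> m * (b m p * b m q)) = 0"
  shows "(\<Sum>m\<in>M. \<Sum>p\<in>I. \<Sum>q\<in>I. qscale (\<mu> m * (b m p * b m q)) ((A ^^ p) ((B ^^ q) f))) \<in> U n"
proof -
  have "(\<Sum>m\<in>M. \<Sum>p\<in>I. \<Sum>q\<in>I. qscale (\<mu> m * (b m p * b m q)) ((A ^^ p) ((B ^^ q) f))) =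
    (\<Sum>p\<in>I. \<Sum>q\<in>I. \<Sum>m\<in>M. qscale (\<mu> m * (b m p * b m q)) ((A ^^ p) ((B ^^ q) f)))"
    by (subst sum.swap, rule sum.cong[OF refl], rule sum.swap)
  also have "\<dots> = (\<Sum>p\<in>I. \<Sum>q\<in>I. qscale (\<Sum>m\<in>M. \<mu> m * (b m p * b m q)) ((A ^^ p) ((B ^^ q) f)))"
    by (simp add: qvs.scale_sum_left)
  also have "\<dots> \<in> U n"
  proof (intro qvs.subspace_sum[OF subspace])
    fix p q assume pq: "p \<in> I" "q \<in> I"
    show "qscale (\<Sum>m\<in>M. \<mu> m * (b m p * b m q)) ((A ^^ p) ((B ^^ q) f)) \<in> U n"
    proof (cases "p + q < n")
      case True
      then show ?thesis using assms(2)[OF pq] qvs.subspace_0[OF subspace] by simp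
    next
      case False
      then have "(A ^^ p) ((B ^^ q) f) \<in> U n"
        using funpow_raise[OF assms(1)] antimono[of n "p + q"] by (auto simp: not_less)
      then show ?thesis by (rule qvs.subspace_scale[OF subspace])
    qed
  qed
  finally show ?thesis .
qed

lemma degree_binomial_poly_mult:
  "p + q < n \<Longrightarrow> degree (binomial_poly p * binomial_poly q) < n"
  using degree_mult_le[of "binomial_poly p" "binomial_poly q"] degree_binomial_poly[of p]
    degree_binomial_poly[of q] by linarith

text \<open>Modulo \<open>U n\<close>, the sequence in question is polynomial of degree less than \<open>n\<close> in \<open>m\<close>.\<close>

lemma moment:
  assumes "finite M" "f \<in> U 0"
    and "\<And>p :: rat poly. degree p < n \<Longrightarrow> (\<Sum>m\<in>M. \<mu> m * poly p (of_nat m)) = 0"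
  shows "(\<Sum>m\<in>M. qscale (\<mu> m) (((\<lambda>f. f + A f) ^^ m) (((\<lambda>f. f + B f) ^^ m) f))) \<in> U n"
proof -
  obtain K where K: "\<And>m. m \<in> M \<Longrightarrow> m \<le> K" using \<open>finite M\<close> finite_nat_set_iff_bounded_le by auto
  let ?C = "\<lambda>m p. of_nat (m choose p) :: rat"
  have ex: "((\<lambda>f. f + D f) ^^ m) f = (\<Sum>p\<le>K. qscale (?C m p) ((D ^^ p) f))"
    if "m \<in> M" "qlinear D" for m f and D :: "('b \<Rightarrow>\<^sub>0 rat) \<Rightarrow> ('b \<Rightarrow>\<^sub>0 rat)"
    unfolding unipotent_power[OF that(2)]
    by (rule sum.mono_neutral_left) (use K[OF that(1)] in \<open>auto simp: binomial_eq_0\<close>)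
  have "(\<Sum>m\<in>M. qscale (\<mu> m) (((\<lambda>f. f + A f) ^^ m) (((\<lambda>f. f + B f) ^^ m) f))) =
    (\<Sum>m\<in>M. \<Sum>p\<le>K. \<Sum>q\<le>K. qscale (\<mu> m * (?C m p * ?C m q)) ((A ^^ p) ((B ^^ q) f)))"
    by (intro sum.cong refl) (simp only: ex[OF _ linear(1)] ex[OF _ linear(2)] expand)
  also have "\<dots> \<in> U n"
  proof (rule weighted_sum_mem[OF assms(2)])
    fix p q assume "p + q < n"
    then show "(\<Sum>m\<in>M. \<mu> m * (?C m p * ?C m q)) = 0"
      using assms(3)[OF degree_binomial_poly_mult] by (simp add: poly_binomial_poly)
  qed
  finally show ?thesis .
qed

text \<open>An infinitesimal form of log (x y) = log x + log y. Once the pure terms are subtracted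
  only \<open>p, q \<ge> 1\<close> remain, and the product of two binomial polynomials that vanish
  at 0 has no linear coefficient.\<close>

lemma moment_mixed:
  assumes "f \<in> U 0" "n \<le> N"
  shows "(\<Sum>m<N. qscale (coeff_weight N (Suc 0) m)
    (((\<lambda>f. f + A f) ^^ m) (((\<lambda>f. f + B f) ^^ m) f) -
     ((\<lambda>f. f + A f) ^^ m) f - ((\<lambda>f. f + B f) ^^ m) f + f)) \<in> U n"
proof -
  let ?C = "\<lambda>m p. of_nat (m choose p) :: rat" and ?\<mu> = "coeff_weight N (Suc 0)"
  have ex: "((\<lambda>f. f + D f) ^^ m) f = f + (\<Sum>p\<in>{1..N}. qscale (?C m p) ((D ^^ p) f))"
    if "m < N" "qlinear D" for m f and D :: "('b \<Rightarrow>\<^sub>0 rat) \<Rightarrow> ('b \<Rightarrow>\<^sub>0 rat)"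
  proof -
    have "((\<lambda>f. f + D f) ^^ m) f = (\<Sum>p\<in>{0..N}. qscale (?C m p) ((D ^^ p) f))"
      unfolding unipotent_power[OF that(2)]
      by (rule sum.mono_neutral_left) (use that in \<open>auto simp: binomial_eq_0\<close>)
    then show ?thesis by (simp add: sum.atLeast_Suc_atMost)
  qed
  have "(\<Sum>m<N. qscale (?\<mu> m)
    (((\<lambda>f. f + A f) ^^ m) (((\<lambda>f. f + B f) ^^ m) f) -
     ((\<lambda>f. f + A f) ^^ m) f - ((\<lambda>f. f + B f) ^^ m) f + f)) =
    (\<Sum>m<N. \<Sum>p\<in>{1..N}. \<Sum>q\<in>{1..N}. qscale (?\<mu> m * (?C m p * ?C m q)) ((A ^^ p) ((B ^^ q) f)))"
  proof (rule sum.cong[OF refl])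
    fix m assume "m \<in> {..<N}"
    then have m: "m < N" by simp
    let ?T = "\<lambda>D f. \<Sum>p\<in>{1..N}. qscale (?C m p) ((D ^^ p) f)"
    have eq: "((\<lambda>f. f + A f) ^^ m) (((\<lambda>f. f + B f) ^^ m) f) -
       ((\<lambda>f. f + A f) ^^ m) f - ((\<lambda>f. f + B f) ^^ m) f + f = ?T A (?T B f)"
      unfolding ex[OF m linear(1)] ex[OF m linear(2)]
      by (simp add: qlinear_add[OF qlinear_funpow[OF linear(1)]] qvs.scale_right_distrib sum.distrib)
    show "qscale (?\<mu> m) (((\<lambda>f. f + A f) ^^ m) (((\<lambda>f. f + B f) ^^ m) f) -
       ((\<lambda>f. f + A f) ^^ m) f - ((\<lambda>f. f + B f) ^^ m) f + f) =
      (\<Sum>p\<in>{1..N}. \<Sum>q\<in>{1..N}. qscale (?\<mu> m * (?C m p * ?C m q)) ((A ^^ p) ((B ^^ q) f)))"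
      unfolding eq by (rule expand)
  qed
  also have "\<dots> \<in> U n"
  proof (rule weighted_sum_mem[OF assms(1)])
    fix p q assume pq: "p \<in> {1..N}" "q \<in> {1..N}" "p + q < n"
    have "(\<Sum>m<N. ?\<mu> m * (?C m p * ?C m q)) = coeff (binomial_poly p * binomial_poly q) (Suc 0)"
      using coeff_weight[OF degree_binomial_poly_mult, of p q N "Suc 0"] pq assms(2)
      by (simp add: poly_binomial_poly)
    also have "\<dots> = 0"
      using pq by (simp add: coeff_mult coeff_binomial_poly_0)
    finally show "(\<Sum>m<N. ?\<mu> m * (?C m p * ?C m q)) = 0" .
  qed
  finally show ?thesis .
qed

end

section \<open>Powers of the augmentation ideal\<close>

lemma qspace_induct [consumes 1, case_names single zero add]:
  assumes "f \<in> qspace B"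
    and "\<And>s a. s \<in> B \<Longrightarrow> P (Poly_Mapping.single s a)" and "P 0"
    and "\<And>f g. P f \<Longrightarrow> P g \<Longrightarrow> P (f + g)"
  shows "P f"
proof -
  have "P (\<Sum>s\<in>K. Poly_Mapping.single s (Poly_Mapping.lookup f s))" if "finite K" "K \<subseteq> B" for K
    using that by (induction K rule: finite_induct) (auto intro: assms)
  from this[of "Poly_Mapping.keys f"] assms(1) poly_mapping_sum_single[of f]
  show ?thesis by (simp add: qspace_def)
qed

lemma poly_mapping_additive_induct [case_names single zero add]:
  assumes "\<And>s a. P (Poly_Mapping.single s (a :: rat))" and "P 0"
    and "\<And>f g. P f \<Longrightarrow> P g \<Longrightarrow> P (f + g)"
  shows "P f"
  by (rule qspace_induct[of f UNIV]) (auto simp: qspace_def intro: assms)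

lemma single_sum: "Poly_Mapping.single s (\<Sum>i\<in>I. a i) = (\<Sum>i\<in>I. Poly_Mapping.single s (a i))"
  by (induction I rule: infinite_finite_induct) (simp_all add: single_add)

lemma bilin_ext_scale_left: "bilin_ext t (qscale c f) g = qscale c (bilin_ext t f g)"
  by (rule qlinear_scale[OF qlinear_bilin_ext_left])

lemma bilin_ext_scale_right: "bilin_ext t f (qscale c g) = qscale c (bilin_ext t f g)"
  by (rule qlinear_scale[OF qlinear_bilin_ext_right])

lemma bilin_ext_in_qspace:
  assumes "f \<in> qspace B" "h \<in> qspace C" "\<And>s u. s \<in> B \<Longrightarrow> u \<in> C \<Longrightarrow> t s u \<in> D"
  shows "bilin_ext t f h \<in> qspace D"
proof (rule qlinear_mem_on_qspace[OF qlinear_bilin_ext_left subspace_qspace assms(1)])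
  fix s assume "s \<in> B"
  show "bilin_ext t (Poly_Mapping.single s 1) h \<in> qspace D"
    by (rule qlinear_mem_on_qspace[OF qlinear_bilin_ext_right subspace_qspace assms(2)])
       (simp add: assms(3) \<open>s \<in> B\<close>)
qed

lemma bilin_ext_span_mem:
  assumes "qvs.subspace V" "\<And>f h. f \<in> S \<Longrightarrow> h \<in> S' \<Longrightarrow> bilin_ext t f h \<in> V"
    and "f \<in> qvs.span S" "h \<in> qvs.span S'"
  shows "bilin_ext t f h \<in> V"
proof (rule qlinear_span_mem[OF qlinear_bilin_ext_left assms(1) _ assms(3)])
  fix f assume "f \<in> S"
  then show "bilin_ext t f h \<in> V"
    by (intro qlinear_span_mem[OF qlinear_bilin_ext_right assms(1) _ assms(4)]) (rule assms(2))
qed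

section \<open>The tensor square, the comultiplication and the augmentation\<close>

lemma conv_DirProd_tensor:
  "conv (G \<times>\<times> H) (tensor f h) (tensor f' h') = tensor (conv G f f') (conv H h h')"
proof (induction f rule: poly_mapping_additive_induct)
  case (single s a)
  show ?case
  proof (induction h rule: poly_mapping_additive_induct)
    case (single s a)
    show ?case
    proof (induction f' rule: poly_mapping_additive_induct)
      case (single s a)
      show ?case
        by (induction h' rule: poly_mapping_additive_induct)
           (simp_all add: DirProd_def bilin_ext_add_left bilin_ext_add_right mult_ac)
    qed (simp_all add: bilin_ext_add_left bilin_ext_add_right)
  qed (simp_all add: bilin_ext_add_left bilin_ext_add_right)
qed (simp_all add: bilin_ext_add_left bilin_ext_add_right)

abbreviation diag :: "('a \<Rightarrow>\<^sub>0 rat) \<Rightarrow> ('a \<times> 'a \<Rightarrow>\<^sub>0 rat)" where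
  "diag \<equiv> lin_ext (\<lambda>g. (g, g))"

lemmas diag_add = qlinear_add[OF qlinear_lin_ext]
  and diag_diff = qlinear_diff[OF qlinear_lin_ext]
  and lin_ext_zero [simp] = qlinear_zero[OF qlinear_lin_ext]

lemma diag_conv: "diag (conv G f h) = conv (G \<times>\<times> G) (diag f) (diag h)"
proof (induction f rule: poly_mapping_additive_induct)
  case (single s a)
  show ?case
    by (induction h rule: poly_mapping_additive_induct)
       (simp_all add: DirProd_def bilin_ext_add_right diag_add)
qed (simp_all add: bilin_ext_add_left diag_add)

text \<open>\<open>real_ext (\<lambda>_. 1)\<close> is the augmentation; with \<open>t\<close>
  arbitrary this covers its multiplicativity for \<open>conv\<close> and for \<open>tensor\<close>
  at once.\<close>

lemma real_ext_one_bilin_ext: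
  "real_ext (\<lambda>_. 1) (bilin_ext t f h) = real_ext (\<lambda>_. 1) f * real_ext (\<lambda>_. 1) h"
proof (induction f rule: poly_mapping_additive_induct)
  case (single s a)
  show ?case
    by (induction h rule: poly_mapping_additive_induct)
       (simp_all add: bilin_ext_add_right real_ext_add distrib_left of_rat_mult)
qed (simp_all add: bilin_ext_add_left real_ext_add distrib_right)

lemma augmentation_ideal_eq:
  "augmentation_ideal G = {f \<in> group_algebra G. real_ext (\<lambda>_. 1) f = 0}"
  by (simp add: augmentation_ideal_def real_ext_def flip: of_rat_sum)

lemma subspace_augmentation_ideal: "qvs.subspace (augmentation_ideal G)"
proof -
  have "augmentation_ideal G = group_algebra G \<inter> {f. real_ext (\<lambda>_. 1) f = 0}"
    by (auto simp: augmentation_ideal_eq)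
  then show ?thesis
    by (metis qvs.subspace_inter subspace_qspace subspace_real_ext_kernel)
qed

lemma subspace_augmentation_power: "qvs.subspace (augmentation_power G n)"
  by (cases n) (simp_all add: subspace_qspace qvs.subspace_span)

lemma subspace_tensor_filt: "qvs.subspace (tensor_filt G n)"
  by (simp add: tensor_filt_def qvs.subspace_span)

lemma augmentation_power_Suc_left:
  "f \<in> augmentation_ideal G \<Longrightarrow> h \<in> augmentation_power G n \<Longrightarrow>
    conv G f h \<in> augmentation_power G (Suc n)"
  by (auto intro: qvs.span_base)

declare augmentation_power.simps(2) [simp del]

context group
begin

lemma conv_closed: "f \<in> group_algebra G \<Longrightarrow> h \<in> group_algebra G \<Longrightarrow> conv G f h \<in> group_algebra G"
  by (rule bilin_ext_in_qspace) auto

lemma conv_assoc: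
  assumes "f \<in> group_algebra G" "h \<in> group_algebra G" "k \<in> group_algebra G"
  shows "conv G (conv G f h) k = conv G f (conv G h k)"
  using assms(1)
proof (induction f rule: qspace_induct)
  case (single s a)
  then have s: "s \<in> carrier G" .
  from assms(2) show ?case
  proof (induction h rule: qspace_induct)
    case (single r b)
    from assms(3) show ?case
      by (induction k rule: qspace_induct)
         (simp_all add: bilin_ext_add_right s single m_assoc mult.assoc)
  qed (simp_all add: bilin_ext_add_left bilin_ext_add_right)
qed (simp_all add: bilin_ext_add_left)

lemma conv_one_left: "f \<in> group_algebra G \<Longrightarrow> conv G (group_algebra_one G) f = f"
  by (induction f rule: qspace_induct) (simp_all add: bilin_ext_add_right)

lemma conv_one_right: "f \<in> group_algebra G \<Longrightarrow> conv G f (group_algebra_one G) = f"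
  by (induction f rule: qspace_induct) (simp_all add: bilin_ext_add_left)

lemma augmentation_ideal_subset: "augmentation_ideal G \<subseteq> group_algebra G"
  by (auto simp: augmentation_ideal_def)

lemma augmentation_ideal_mult:
  assumes "f \<in> group_algebra G" "h \<in> group_algebra G"
    and "f \<in> augmentation_ideal G \<or> h \<in> augmentation_ideal G"
  shows "conv G f h \<in> augmentation_ideal G"
  using assms by (auto simp: augmentation_ideal_eq real_ext_one_bilin_ext conv_closed)

lemma augmentation_power_subset: "augmentation_power G n \<subseteq> group_algebra G"
proof (induction n)
  case (Suc n)
  then show ?case
    unfolding augmentation_power.simps(2)
    by (intro qvs.span_minimal[OF _ subspace_qspace])
       (use augmentation_ideal_subset in \<open>auto intro!: conv_closed\<close>)
qed simp

lemma augmentation_power_left_ideal: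
  assumes "f \<in> group_algebra G" "h \<in> augmentation_power G n"
  shows "conv G f h \<in> augmentation_power G n"
proof (cases n)
  case 0
  then show ?thesis using assms by (simp add: conv_closed)
next
  case (Suc m)
  show ?thesis unfolding Suc
  proof (rule qlinear_span_mem[OF qlinear_bilin_ext_right subspace_augmentation_power])
    show "h \<in> qvs.span {conv G f h | f h. f \<in> augmentation_ideal G \<and> h \<in> augmentation_power G m}"
      using assms Suc by (simp add: augmentation_power.simps(2))
    fix x assume "x \<in> {conv G f h | f h. f \<in> augmentation_ideal G \<and> h \<in> augmentation_power G m}"
    then obtain k l where x: "x = conv G k l" "k \<in> augmentation_ideal G" "l \<in> augmentation_power G m"
      by auto
    then have "conv G f x = conv G (conv G f k) l"
      using assms(1) augmentation_ideal_subset augmentation_power_subset[of m]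
      by (simp add: conv_assoc subset_iff)
    then show "conv G f x \<in> augmentation_power G (Suc m)"
      using assms x augmentation_ideal_subset
      by (auto intro!: augmentation_power_Suc_left augmentation_ideal_mult)
  qed
qed

lemma augmentation_power_mult:
  assumes "f \<in> augmentation_power G p" "h \<in> augmentation_power G q"
  shows "conv G f h \<in> augmentation_power G (p + q)"
  using assms(1)
proof (induction p arbitrary: f)
  case 0
  then show ?case using assms by (simp add: augmentation_power_left_ideal)
next
  case (Suc p)
  show ?case
  proof (rule qlinear_span_mem[OF qlinear_bilin_ext_left subspace_augmentation_power])
    show "f \<in> qvs.span {conv G f h | f h. f \<in> augmentation_ideal G \<and> h \<in> augmentation_power G p}"
      using Suc.prems by (simp add: augmentation_power.simps(2))
    fix x assume "x \<in> {conv G f h | f h. f \<in> augmentation_ideal G \<and> h \<in> augmentation_power G p}"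
    then obtain k l where x: "x = conv G k l" "k \<in> augmentation_ideal G" "l \<in> augmentation_power G p"
      by auto
    then have "conv G x h = conv G k (conv G l h)"
      using assms(2) augmentation_ideal_subset augmentation_power_subset[of p]
        augmentation_power_subset[of q] by (simp add: conv_assoc subset_iff)
    then show "conv G x h \<in> augmentation_power G (Suc p + q)"
      using x Suc.IH by (auto intro!: augmentation_power_Suc_left)
  qed
qed

lemma augmentation_power_right_ideal:
  "f \<in> augmentation_power G n \<Longrightarrow> h \<in> group_algebra G \<Longrightarrow> conv G f h \<in> augmentation_power G n"
  using augmentation_power_mult[of f n h 0] by simp

lemma augmentation_power_1: "augmentation_power G (Suc 0) = augmentation_ideal G"
proof
  show "augmentation_power G (Suc 0) \<subseteq> augmentation_ideal G"
    unfolding augmentation_power.simps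
    by (rule qvs.span_minimal[OF _ subspace_augmentation_ideal])
       (use augmentation_ideal_subset in \<open>auto intro!: augmentation_ideal_mult\<close>)
  show "augmentation_ideal G \<subseteq> augmentation_power G (Suc 0)"
  proof
    fix f assume f: "f \<in> augmentation_ideal G"
    then have "conv G f (group_algebra_one G) \<in> augmentation_power G (Suc 0)"
      by (intro augmentation_power_Suc_left) auto
    then show "f \<in> augmentation_power G (Suc 0)"
      using f augmentation_ideal_subset by (auto simp: conv_one_right)
  qed
qed

lemma augmentation_power_Suc_subset: "augmentation_power G (Suc n) \<subseteq> augmentation_power G n"
  unfolding augmentation_power.simps(2)
  by (rule qvs.span_minimal[OF _ subspace_augmentation_power])
     (use augmentation_ideal_subset in \<open>auto intro: augmentation_power_left_ideal\<close>)

lemma augmentation_power_antimono: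
  "m \<le> n \<Longrightarrow> augmentation_power G n \<subseteq> augmentation_power G m"
  by (rule lift_Suc_antimono_le[of "augmentation_power G", OF augmentation_power_Suc_subset])

lemma single_diff_one_in_power:
  "g \<in> carrier G \<Longrightarrow> Poly_Mapping.single g 1 - group_algebra_one G \<in> augmentation_power G (Suc 0)"
  by (auto simp: augmentation_power_1 augmentation_ideal_eq real_ext_diff
      intro: qvs.subspace_diff[OF subspace_qspace])

lemma tensor_in_tensor_filt:
  "f \<in> augmentation_power G p \<Longrightarrow> h \<in> augmentation_power G q \<Longrightarrow> tensor f h \<in> tensor_filt G (p + q)"
  unfolding tensor_filt_def by (rule qvs.span_base) blast

lemma tensor_filt_subset: "tensor_filt G n \<subseteq> qspace (carrier G \<times> carrier G)"
  unfolding tensor_filt_def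
  by (rule qvs.span_minimal[OF _ subspace_qspace])
     (use augmentation_power_subset in \<open>fastforce intro!: bilin_ext_in_qspace\<close>)

lemma tensor_filt_0: "tensor_filt G 0 = qspace (carrier G \<times> carrier G)"
proof
  show "qspace (carrier G \<times> carrier G) \<subseteq> tensor_filt G 0"
    unfolding qspace_eq_span
  proof (rule qvs.span_minimal[OF _ subspace_tensor_filt], safe)
    fix g h assume "g \<in> carrier G" "h \<in> carrier G"
    then show "Poly_Mapping.single (g, h) 1 \<in> tensor_filt G 0"
      using tensor_in_tensor_filt[of "Poly_Mapping.single g 1" 0 "Poly_Mapping.single h 1" 0] by simp
  qed
qed (rule tensor_filt_subset)

lemma tensor_filt_mult:
  assumes "x \<in> tensor_filt G p" "y \<in> tensor_filt G q"
  shows "conv (G \<times>\<times> G) x y \<in> tensor_filt G (p + q)"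
proof (rule bilin_ext_span_mem[OF subspace_tensor_filt _ assms[unfolded tensor_filt_def]], clarify)
  fix f h a b f' h' a' b'
  assume *: "f \<in> augmentation_power G a" "h \<in> augmentation_power G b"
    "f' \<in> augmentation_power G a'" "h' \<in> augmentation_power G b'"
  have "a + b + (a' + b') = (a + a') + (b + b')" by simp
  then show "conv (G \<times>\<times> G) (tensor f h) (tensor f' h') \<in> tensor_filt G (a + b + (a' + b'))"
    unfolding conv_DirProd_tensor using * augmentation_power_mult tensor_in_tensor_filt by metis
qed

lemma tensor_filt_Suc_subset: "tensor_filt G (Suc n) \<subseteq> tensor_filt G n"
  unfolding tensor_filt_def[of G "Suc n"]
proof (rule qvs.span_minimal[OF _ subspace_tensor_filt], clarify)
  fix f h p q assume *: "f \<in> augmentation_power G p" "h \<in> augmentation_power G q" "p + q = Suc n"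
  show "tensor f h \<in> tensor_filt G n"
  proof (cases p)
    case 0
    then show ?thesis using * augmentation_power_Suc_subset tensor_in_tensor_filt[of f 0 h n] by auto
  next
    case (Suc p')
    then show ?thesis
      using * augmentation_power_Suc_subset tensor_in_tensor_filt[of f p' h q] by auto
  qed
qed

text \<open>On a group element, \<open>g \<otimes> g - 1 \<otimes> 1 = (g - 1) \<otimes> g + 1
  \<otimes> (g - 1)\<close>. Replacing \<open>diag f\<close> by its difference with the constant map
  to \<open>(\<one>, \<one>)\<close> changes nothing, since that map multiplies by the augmentation
  of \<open>f\<close>.\<close>

lemma diag_augmentation_ideal:
  assumes "f \<in> augmentation_ideal G" shows "diag f \<in> tensor_filt G (Suc 0)"
proof -
  have f: "f \<in> group_algebra G" using assms augmentation_ideal_subset by blast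
  have "lin_ext (\<lambda>_. (\<one>, \<one>)) f = qscale (\<Sum>g\<in>Poly_Mapping.keys f. Poly_Mapping.lookup f g)
      (Poly_Mapping.single (\<one>, \<one>) 1)"
    unfolding lin_ext_def by (simp add: single_sum)
  also have "\<dots> = 0" using assms by (simp add: augmentation_ideal_def)
  finally have "diag f = diag f - lin_ext (\<lambda>_. (\<one>, \<one>)) f" by simp
  also have "\<dots> \<in> tensor_filt G (Suc 0)"
  proof (rule qlinear_mem_on_qspace[OF qlinear_minus[OF qlinear_lin_ext qlinear_lin_ext] subspace_tensor_filt f])
    fix g assume g: "g \<in> carrier G"
    let ?g = "Poly_Mapping.single g (1::rat)" and ?e = "group_algebra_one G"
    have "tensor (?g - ?e) ?g \<in> tensor_filt G (Suc 0)"
      using tensor_in_tensor_filt[of "?g - ?e" "Suc 0" ?g 0] g by (simp add: single_diff_one_in_power)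
    moreover have "tensor ?e (?g - ?e) \<in> tensor_filt G (Suc 0)"
      using tensor_in_tensor_filt[of ?e 0 "?g - ?e" "Suc 0"] g by (simp add: single_diff_one_in_power)
    ultimately have "tensor (?g - ?e) ?g + tensor ?e (?g - ?e) \<in> tensor_filt G (Suc 0)"
      by (rule qvs.subspace_add[OF subspace_tensor_filt])
    then show "diag ?g - lin_ext (\<lambda>_. (\<one>, \<one>)) ?g \<in> tensor_filt G (Suc 0)"
      by (simp add: bilin_ext_diff_left bilin_ext_diff_right)
  qed
  finally show ?thesis .
qed

lemma diag_augmentation_power:
  assumes "f \<in> augmentation_power G n" shows "diag f \<in> tensor_filt G n"
  using assms
proof (induction n arbitrary: f)
  case 0
  then have "f \<in> group_algebra G" by simp
  then show ?case
    unfolding tensor_filt_0 by (rule qlinear_mem_on_qspace[OF qlinear_lin_ext subspace_qspace]) simp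
next
  case (Suc n)
  show ?case
  proof (rule qlinear_span_mem[OF qlinear_lin_ext subspace_tensor_filt])
    show "f \<in> qvs.span {conv G f h | f h. f \<in> augmentation_ideal G \<and> h \<in> augmentation_power G n}"
      using Suc.prems by (simp add: augmentation_power.simps(2))
    fix x assume "x \<in> {conv G f h | f h. f \<in> augmentation_ideal G \<and> h \<in> augmentation_power G n}"
    then show "diag x \<in> tensor_filt G (Suc n)"
      using tensor_filt_mult[OF diag_augmentation_ideal Suc.IH] by (auto simp: diag_conv)
  qed
qed

end

section \<open>The Malcev Lie algebra by representatives\<close>

text \<open>Points of a completion are handled through sequences of representatives, so that
  statements about them turn into memberships modulo the n-th step.\<close>

definition coset_seq :: "(nat \<Rightarrow> 'v::ab_group_add set) \<Rightarrow> (nat \<Rightarrow> 'v) \<Rightarrow> nat \<Rightarrow> 'v set" where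
  "coset_seq F f = (\<lambda>n. f n +o F n)"

definition coherent :: "'v::ab_group_add set \<Rightarrow> (nat \<Rightarrow> 'v set) \<Rightarrow> (nat \<Rightarrow> 'v) \<Rightarrow> bool" where
  "coherent A F f \<longleftrightarrow> (\<forall>n. f n \<in> A \<and> f (Suc n) - f n \<in> F n)"

lemma mem_coset_iff: "g \<in> f +o V \<longleftrightarrow> g - f \<in> (V :: 'v::ab_group_add set)"
  by (auto simp: elt_set_plus_def algebra_simps intro: bexI[of _ "g - f"])

lemma coset_eq_iff:
  assumes "qvs.subspace V"
  shows "f +o V = g +o V \<longleftrightarrow> f - g \<in> V"
proof
  assume "f +o V = g +o V"
  moreover have "f \<in> f +o V" using qvs.subspace_0[OF assms] by (simp add: mem_coset_iff)
  ultimately show "f - g \<in> V" by (simp add: mem_coset_iff)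
next
  assume fg: "f - g \<in> V"
  have "x - f \<in> V \<longleftrightarrow> x - g \<in> V" for x
    using qvs.subspace_add[OF assms _ fg, of "x - f"] qvs.subspace_diff[OF assms _ fg, of "x - g"]
    by (auto simp: algebra_simps)
  then show "f +o V = g +o V" by (auto simp: mem_coset_iff)
qed

locale qfiltration =
  fixes A :: "('b \<Rightarrow>\<^sub>0 rat) set" and F :: "nat \<Rightarrow> ('b \<Rightarrow>\<^sub>0 rat) set"
  assumes subspace: "qvs.subspace (F n)"
    and decreasing: "F (Suc n) \<subseteq> F n"
    and carrier: "qvs.subspace A"
begin

lemma coset_seq_in_completion:
  assumes "coherent A F f" shows "coset_seq F f \<in> completion A F"
  unfolding completion_def
proof (safe, goal_cases)
  case (1 n)
  then show ?case using assms by (auto simp: coset_seq_def coherent_def)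
next
  case (2 n x)
  then have "x - f (Suc n) \<in> F n" "f (Suc n) - f n \<in> F n"
    using assms decreasing by (auto simp: coset_seq_def coherent_def mem_coset_iff)
  from qvs.subspace_add[OF subspace this] show ?case
    by (simp add: coset_seq_def mem_coset_iff)
qed

lemma completion_obtain:
  assumes "x \<in> completion A F"
  obtains f where "coherent A F f" "x = coset_seq F f"
proof -
  have "\<forall>n. \<exists>f\<in>A. x n = f +o F n" and sub: "\<And>n. x (Suc n) \<subseteq> x n"
    using assms by (auto simp: completion_def)
  then obtain f where f: "\<And>n. f n \<in> A" "\<And>n. x n = f n +o F n" by metis
  have "f (Suc n) \<in> x (Suc n)" for n
    using f qvs.subspace_0[OF subspace] by (simp add: mem_coset_iff)
  then have "f (Suc n) - f n \<in> F n" for n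
    using sub[of n] unfolding f(2)[of n] by (simp add: subset_iff mem_coset_iff)
  with f that[of f] show thesis by (auto simp: coherent_def coset_seq_def)
qed

lemma completion_mem_antimono:
  assumes "x \<in> completion A F" "m \<le> n" shows "x n \<subseteq> x m"
  by (rule lift_Suc_antimono_le[of x, OF _ assms(2)]) (use assms(1) in \<open>auto simp: completion_def\<close>)

lemma completed2_plus:
  "completed2 F (+) (coset_seq F f) (coset_seq F g) = coset_seq F (\<lambda>n. f n + g n)"
proof (rule ext)
  fix n
  have "(a + b) +o F n = (f n + g n) +o F n" if "a \<in> f n +o F n" "b \<in> g n +o F n" for a b
    using qvs.subspace_add[OF subspace that[unfolded mem_coset_iff]]
    by (simp add: coset_eq_iff[OF subspace] algebra_simps)
  moreover have "f n \<in> f n +o F n" "g n \<in> g n +o F n"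
    by (simp_all add: mem_coset_iff qvs.subspace_0[OF subspace])
  ultimately show "completed2 F (+) (coset_seq F f) (coset_seq F g) n = coset_seq F (\<lambda>n. f n + g n) n"
    unfolding completed2_def coset_seq_def by blast
qed

lemma completed1_coset_seq:
  assumes "qlinear t" "\<And>n d. d \<in> F n \<Longrightarrow> t d \<in> F' n" "\<And>n. qvs.subspace (F' n)"
  shows "completed1 F' t (coset_seq F f) = coset_seq F' (\<lambda>n. t (f n))"
proof (rule ext)
  fix n
  have "t a +o F' n = t (f n) +o F' n" if "a \<in> f n +o F n" for a
    using assms(2)[OF that[unfolded mem_coset_iff]]
    by (simp add: coset_eq_iff[OF assms(3)] qlinear_diff[OF assms(1)])
  moreover have "f n \<in> f n +o F n"
    by (simp add: mem_coset_iff qvs.subspace_0[OF subspace])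
  ultimately show "completed1 F' t (coset_seq F f) n = coset_seq F' (\<lambda>n. t (f n)) n"
    unfolding completed1_def coset_seq_def by blast
qed

text \<open>Write \<open>t a b - t a' b'\<close> as \<open>t (a - a') b + t a' (b - b')\<close>;
  both terms lie in \<open>F n\<close>, which absorbs products with \<open>A\<close>.\<close>

lemma completed2_coset_seq:
  assumes "\<And>h. qlinear (\<lambda>f. t f h)" "\<And>f. qlinear (t f)"
    and "\<And>n f d. f \<in> A \<Longrightarrow> d \<in> F n \<Longrightarrow> t f d \<in> F n \<and> t d f \<in> F n"
    and "\<And>n. f n \<in> A" "\<And>n. g n \<in> A" "\<And>n. F n \<subseteq> A"
  shows "completed2 F t (coset_seq F f) (coset_seq F g) = coset_seq F (\<lambda>n. t (f n) (g n))"
proof (rule ext)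
  fix n
  have "t a b +o F n = t (f n) (g n) +o F n" if "a \<in> f n +o F n" "b \<in> g n +o F n" for a b
  proof -
    have d: "a - f n \<in> F n" "b - g n \<in> F n" using that by (simp_all add: mem_coset_iff)
    have "b = g n + (b - g n)" by simp
    then have "b \<in> A" using qvs.subspace_add[OF carrier] d assms(5,6) by (metis subsetD)
    then have "t (a - f n) b + t (f n) (b - g n) \<in> F n"
      using d assms(3,4) by (intro qvs.subspace_add[OF subspace]) auto
    also have "t (a - f n) b + t (f n) (b - g n) = t a b - t (f n) (g n)"
      by (simp add: qlinear_diff[OF assms(1)] qlinear_diff[OF assms(2)])
    finally show ?thesis by (simp add: coset_eq_iff[OF subspace])
  qed
  moreover have "f n \<in> f n +o F n" "g n \<in> g n +o F n"
    by (simp_all add: mem_coset_iff qvs.subspace_0[OF subspace])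
  ultimately show "completed2 F t (coset_seq F f) (coset_seq F g) n = coset_seq F (\<lambda>n. t (f n) (g n)) n"
    unfolding completed2_def coset_seq_def by blast
qed

end

lemma qlinear_qscale: "qlinear (qscale c)"
  by (rule qlinearI) (simp_all add: qvs.scale_right_distrib mult.commute)

section \<open>Primitive elements of the completed group algebra, level by level\<close>

definition primitive_defect :: "('a, 'm) monoid_scheme \<Rightarrow> ('a \<Rightarrow>\<^sub>0 rat) \<Rightarrow> ('a \<times> 'a \<Rightarrow>\<^sub>0 rat)" where
  "primitive_defect G f = diag f - tensor f (group_algebra_one G) - tensor (group_algebra_one G) f"

text \<open>A representative has to satisfy the primitive equation only modulo the tensor filtration
  at its own level; no single element of the group algebra is asked to be primitive.\<close>

definition primitive_seqs :: "('a, 'm) monoid_scheme \<Rightarrow> (nat \<Rightarrow> ('a \<Rightarrow>\<^sub>0 rat)) set" where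
  "primitive_seqs G = {f. coherent (group_algebra G) (augmentation_power G) f \<and>
    (\<forall>n. primitive_defect G (f n) \<in> tensor_filt G n)}"

lemma qlinear_primitive_defect: "qlinear (primitive_defect G)"
  unfolding primitive_defect_def
  by (intro qlinear_minus qlinear_lin_ext qlinear_bilin_ext_left qlinear_bilin_ext_right)

abbreviation conv_comm :: "('a, 'm) monoid_scheme \<Rightarrow> ('a \<Rightarrow>\<^sub>0 rat) \<Rightarrow> ('a \<Rightarrow>\<^sub>0 rat) \<Rightarrow> ('a \<Rightarrow>\<^sub>0 rat)" where
  "conv_comm G f h \<equiv> conv G f h - conv G h f"

lemma primitive_seqs_lincomb:
  assumes "\<And>i. i \<in> I \<Longrightarrow> f i \<in> primitive_seqs G"
  shows "(\<lambda>n. \<Sum>i\<in>I. qscale (c i) (f i n)) \<in> primitive_seqs G"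
  unfolding primitive_seqs_def coherent_def mem_Collect_eq
proof (intro conjI allI)
  fix n
  note a = assms[unfolded primitive_seqs_def coherent_def mem_Collect_eq]
  show "(\<Sum>i\<in>I. qscale (c i) (f i n)) \<in> group_algebra G"
    by (intro qvs.subspace_sum[OF subspace_qspace] qvs.subspace_scale[OF subspace_qspace]) (use a in blast)
  have "(\<Sum>i\<in>I. qscale (c i) (f i (Suc n) - f i n)) \<in> augmentation_power G n"
    by (intro qvs.subspace_sum[OF subspace_augmentation_power]
        qvs.subspace_scale[OF subspace_augmentation_power]) (use a in blast)
  then show "(\<Sum>i\<in>I. qscale (c i) (f i (Suc n))) - (\<Sum>i\<in>I. qscale (c i) (f i n)) \<in> augmentation_power G n"
    by (simp add: qvs.scale_right_diff_distrib sum_subtractf)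
  show "primitive_defect G (\<Sum>i\<in>I. qscale (c i) (f i n)) \<in> tensor_filt G n"
    unfolding qlinear_sum[OF qlinear_primitive_defect] qlinear_scale[OF qlinear_primitive_defect]
    by (intro qvs.subspace_sum[OF subspace_tensor_filt] qvs.subspace_scale[OF subspace_tensor_filt])
       (use a in blast)
qed

lemma primitive_seqs_scale: "f \<in> primitive_seqs G \<Longrightarrow> (\<lambda>n. qscale c (f n)) \<in> primitive_seqs G"
  using primitive_seqs_lincomb[of "{()}" "\<lambda>_. f" G "\<lambda>_. c"] by simp

lemma primitive_seqs_add:
  assumes "f \<in> primitive_seqs G" "h \<in> primitive_seqs G"
  shows "(\<lambda>n. f n + h n) \<in> primitive_seqs G"
  using primitive_seqs_lincomb[of "UNIV :: bool set" "\<lambda>b. if b then f else h" G "\<lambda>_. 1"] assms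
  by (simp add: UNIV_bool add.commute)

lemma primitive_seqs_diff:
  assumes "f \<in> primitive_seqs G" "h \<in> primitive_seqs G"
  shows "(\<lambda>n. f n - h n) \<in> primitive_seqs G"
  using primitive_seqs_add[OF assms(1) primitive_seqs_scale[OF assms(2), of "-1"]] by simp

context group
begin

sublocale aug: qfiltration "group_algebra G" "augmentation_power G"
  by unfold_locales
     (simp_all add: subspace_augmentation_power augmentation_power_Suc_subset subspace_qspace)

sublocale aug2: qfiltration "qspace (carrier G \<times> carrier G)" "tensor_filt G"
  by unfold_locales (simp_all add: subspace_tensor_filt tensor_filt_Suc_subset subspace_qspace)

lemma primitives_eq: "primitives G = coset_seq (augmentation_power G) ` primitive_seqs G"
proof -
  have "coset_seq (augmentation_power G) f \<in> primitives G \<longleftrightarrow>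
      (\<forall>n. primitive_defect G (f n) \<in> tensor_filt G n)"
    if "coherent (group_algebra G) (augmentation_power G) f" for f
  proof -
    have one: "group_algebra_one G \<in> augmentation_power G 0" by simp
    have "completed1 (tensor_filt G) diag (coset_seq (augmentation_power G) f) =
        coset_seq (tensor_filt G) (\<lambda>n. diag (f n))"
      by (rule aug.completed1_coset_seq[OF qlinear_lin_ext])
         (simp_all add: diag_augmentation_power subspace_tensor_filt)
    moreover have "completed1 (tensor_filt G) (\<lambda>f. tensor f (group_algebra_one G))
        (coset_seq (augmentation_power G) f) =
        coset_seq (tensor_filt G) (\<lambda>n. tensor (f n) (group_algebra_one G))"
      by (rule aug.completed1_coset_seq[OF qlinear_bilin_ext_left])
         (use tensor_in_tensor_filt[OF _ one] in \<open>simp_all add: subspace_tensor_filt\<close>)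
    moreover have "completed1 (tensor_filt G) (\<lambda>f. tensor (group_algebra_one G) f)
        (coset_seq (augmentation_power G) f) =
        coset_seq (tensor_filt G) (\<lambda>n. tensor (group_algebra_one G) (f n))"
      by (rule aug.completed1_coset_seq[OF qlinear_bilin_ext_right])
         (use tensor_in_tensor_filt[OF one] in \<open>simp_all add: subspace_tensor_filt\<close>)
    ultimately show ?thesis
      using aug.coset_seq_in_completion[OF that]
      by (simp add: primitives_def aug2.completed2_plus)
         (simp add: coset_seq_def fun_eq_iff coset_eq_iff[OF subspace_tensor_filt]
          primitive_defect_def diff_diff_eq)
  qed
  moreover have "x \<in> completion (group_algebra G) (augmentation_power G)" if "x \<in> primitives G" for x
    using that by (simp add: primitives_def)
  ultimately show ?thesis
    unfolding primitive_seqs_def by (blast elim: aug.completion_obtain)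
qed

lemma malcev_lie_simps:
  "lie_carrier (malcev_lie G) = primitives G"
  "lie_add (malcev_lie G) = completed2 (augmentation_power G) (+)"
  "lie_scale (malcev_lie G) c = completed1 (augmentation_power G) (qscale c)"
  "lie_bracket (malcev_lie G) = completed2 (augmentation_power G) (conv_comm G)"
  "lie_filt (malcev_lie G) n =
    primitives G \<inter> {x \<in> completion (group_algebra G) (augmentation_power G). x n = augmentation_power G n}"
  by (simp_all add: malcev_lie_def completed_lie_def Let_def)

abbreviation malcev_of :: "(nat \<Rightarrow> ('a \<Rightarrow>\<^sub>0 rat)) \<Rightarrow> (nat \<Rightarrow> ('a \<Rightarrow>\<^sub>0 rat) set)" where
  "malcev_of \<equiv> coset_seq (augmentation_power G)"

lemma malcev_add:
  "lie_add (malcev_lie G) (malcev_of f) (malcev_of h) = malcev_of (\<lambda>n. f n + h n)"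
  by (simp add: malcev_lie_simps aug.completed2_plus)

lemma malcev_scale: "lie_scale (malcev_lie G) c (malcev_of f) = malcev_of (\<lambda>n. qscale c (f n))"
  unfolding malcev_lie_simps
  by (rule aug.completed1_coset_seq[OF qlinear_qscale])
     (simp_all add: qvs.subspace_scale subspace_augmentation_power)

lemma primitive_seqs_carrier: "f \<in> primitive_seqs G \<Longrightarrow> f n \<in> group_algebra G"
  by (simp add: primitive_seqs_def coherent_def)

lemma malcev_bracket:
  assumes "f \<in> primitive_seqs G" "h \<in> primitive_seqs G"
  shows "lie_bracket (malcev_lie G) (malcev_of f) (malcev_of h) = malcev_of (\<lambda>n. conv_comm G (f n) (h n))"
  unfolding malcev_lie_simps
proof (rule aug.completed2_coset_seq)
  show "conv_comm G k d \<in> augmentation_power G n \<and> conv_comm G d k \<in> augmentation_power G n"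
    if "k \<in> group_algebra G" "d \<in> augmentation_power G n" for k d n
    using that augmentation_power_left_ideal augmentation_power_right_ideal
    by (auto intro!: qvs.subspace_diff[OF subspace_augmentation_power])
qed (use assms augmentation_power_subset in \<open>auto intro!: qlinear_minus qlinear_bilin_ext_left
  qlinear_bilin_ext_right simp: primitive_seqs_carrier\<close>)

lemma malcev_filt_iff:
  assumes "f \<in> primitive_seqs G"
  shows "malcev_of f \<in> lie_filt (malcev_lie G) n \<longleftrightarrow> f n \<in> augmentation_power G n"
proof -
  have "malcev_of f \<in> primitives G" using assms by (auto simp: primitives_eq)
  moreover have "f n +o augmentation_power G n = augmentation_power G n \<longleftrightarrow> f n \<in> augmentation_power G n"
    using coset_eq_iff[OF subspace_augmentation_power, of "f n" G n 0] by simp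
  moreover have "malcev_of f \<in> completion (group_algebra G) (augmentation_power G)"
    using calculation(1) by (simp add: primitives_def)
  ultimately show ?thesis
    unfolding malcev_lie_simps Int_iff mem_Collect_eq by (simp only: coset_seq_def simp_thms)
qed

lemma primitive_seqs_level:
  assumes "f \<in> primitive_seqs G" "m \<le> n" shows "f n - f m \<in> augmentation_power G m"
  using assms(2)
proof (induction n rule: dec_induct)
  case base
  then show ?case by (simp add: qvs.subspace_0[OF subspace_augmentation_power])
next
  case (step n)
  have "f (Suc n) - f n \<in> augmentation_power G m"
    using assms(1) augmentation_power_antimono[OF step(1)]
    by (auto simp: primitive_seqs_def coherent_def)
  from qvs.subspace_add[OF subspace_augmentation_power this step.IH] show ?case by simp
qed

text \<open>Applied to the primitive equation at level 1, the augmentation of the tensor square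
  gives \<open>\<epsilon> = 2 \<epsilon>\<close> for the augmentation \<open>\<epsilon>\<close> of
  the representative. Level 0 carries no information, hence \<open>n > 0\<close>.\<close>

lemma primitive_seqs_augmentation:
  assumes "f \<in> primitive_seqs G" "n > 0" shows "f n \<in> augmentation_ideal G"
proof -
  have "real_ext (\<lambda>_. 1) x = 0" if "x \<in> tensor_filt G (Suc 0)" for x
  proof (rule real_ext_zero_on_span[OF _ that[unfolded tensor_filt_def]], clarify)
    fix f h p q assume *: "f \<in> augmentation_power G p" "h \<in> augmentation_power G q" "p + q = Suc 0"
    then consider "p = Suc 0" | "q = Suc 0" by (auto simp: add_is_1)
    then show "real_ext (\<lambda>_. 1) (tensor f h) = 0"
      using * by cases (auto simp: augmentation_power_1 augmentation_ideal_eq real_ext_one_bilin_ext)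
  qed
  moreover have "primitive_defect G (f 1) \<in> tensor_filt G (Suc 0)"
    using assms by (simp add: primitive_seqs_def)
  moreover have "real_ext (\<lambda>_. 1) (diag k) = real_ext (\<lambda>_. 1) k" for k :: "'a \<Rightarrow>\<^sub>0 rat"
    by (induction k rule: poly_mapping_additive_induct) (simp_all add: diag_add real_ext_add)
  ultimately have "real_ext (\<lambda>_. 1) (primitive_defect G (f 1)) = 0"
    "real_ext (\<lambda>_. 1) (diag (f 1)) = real_ext (\<lambda>_. 1) (f 1)" by blast+
  then have "real_ext (\<lambda>_. 1) (f 1) = 0"
    by (simp add: primitive_defect_def real_ext_diff real_ext_one_bilin_ext)
  moreover have "f n - f 1 \<in> augmentation_ideal G"
    using primitive_seqs_level[OF assms(1), of 1 n] assms(2) by (simp add: augmentation_power_1)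
  ultimately show ?thesis
    using primitive_seqs_carrier[OF assms(1), of n] by (simp add: augmentation_ideal_eq real_ext_diff)
qed

lemma primitive_seqs_bracket:
  assumes "f \<in> primitive_seqs G" "h \<in> primitive_seqs G"
  shows "(\<lambda>n. conv_comm G (f n) (h n)) \<in> primitive_seqs G"
  unfolding primitive_seqs_def coherent_def mem_Collect_eq
proof (intro conjI allI)
  fix n
  let ?e = "group_algebra_one G" and ?m = "conv (G \<times>\<times> G)"
  note c = primitive_seqs_carrier[OF assms(1)] primitive_seqs_carrier[OF assms(2)]
  show "conv_comm G (f n) (h n) \<in> group_algebra G"
    by (intro qvs.subspace_diff[OF subspace_qspace] conv_closed c)
  have d: "f (Suc n) - f n \<in> augmentation_power G n" "h (Suc n) - h n \<in> augmentation_power G n"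
    using assms by (auto simp: primitive_seqs_def coherent_def)
  have "conv_comm G (f (Suc n) - f n) (h (Suc n)) + conv_comm G (f n) (h (Suc n) - h n)
      \<in> augmentation_power G n"
    using c d augmentation_power_left_ideal augmentation_power_right_ideal
    by (auto intro!: qvs.subspace_add[OF subspace_augmentation_power]
        qvs.subspace_diff[OF subspace_augmentation_power])
  then show "conv_comm G (f (Suc n)) (h (Suc n)) - conv_comm G (f n) (h n) \<in> augmentation_power G n"
    by (simp add: bilin_ext_diff_left bilin_ext_diff_right algebra_simps)
  \<comment> \<open>Modulo the filtration the factors may be replaced by
    \<open>f \<otimes> 1 + 1 \<otimes> f\<close> and \<open>h \<otimes> 1 + 1 \<otimes> h\<close>.
    The cross terms are symmetric in \<open>f\<close> and \<open>h\<close>, so they cancel in the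
    commutator.\<close>
  have key: "?m (diag f) (diag h) - tensor (conv G f h) ?e - tensor ?e (conv G f h) -
      (tensor f h + tensor h f) \<in> tensor_filt G n"
    if f: "f \<in> group_algebra G" "primitive_defect G f \<in> tensor_filt G n"
      and h: "h \<in> group_algebra G" "primitive_defect G h \<in> tensor_filt G n" for f h
  proof -
    have 0: "diag h \<in> tensor_filt G 0" "tensor f ?e + tensor ?e f \<in> tensor_filt G 0"
      using diag_augmentation_power[of h 0] tensor_in_tensor_filt[of f 0 ?e 0]
        tensor_in_tensor_filt[of ?e 0 f 0] f h
      by (auto intro!: qvs.subspace_add[OF subspace_tensor_filt])
    have "?m (primitive_defect G f) (diag h) + ?m (tensor f ?e + tensor ?e f) (primitive_defect G h)
        \<in> tensor_filt G n"
      using tensor_filt_mult[OF f(2) 0(1)] tensor_filt_mult[OF 0(2) h(2)]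
      by (auto intro!: qvs.subspace_add[OF subspace_tensor_filt])
    then show ?thesis
      using f(1) h(1)
      by (simp add: primitive_defect_def bilin_ext_diff_left bilin_ext_diff_right bilin_ext_add_left
          bilin_ext_add_right conv_DirProd_tensor conv_one_left conv_one_right algebra_simps)
  qed
  have "primitive_defect G (f n) \<in> tensor_filt G n" "primitive_defect G (h n) \<in> tensor_filt G n"
    using assms by (auto simp: primitive_seqs_def)
  from qvs.subspace_diff[OF subspace_tensor_filt key[OF c(1) this(1) c(2) this(2)]
      key[OF c(2) this(2) c(1) this(1)]]
  show "primitive_defect G (conv_comm G (f n) (h n)) \<in> tensor_filt G n"
    by (simp add: primitive_defect_def bilin_ext_diff_left bilin_ext_diff_right diag_diff diag_conv
        algebra_simps)
qed

end

section \<open>Logarithms and conjugation\<close>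

lemma coeff_weight_sum_0:
  assumes "N > 0" shows "(\<Sum>m<N. coeff_weight N (Suc 0) m) = 0"
  using coeff_weight[of "1 :: rat poly" N "Suc 0"] assms by simp

lemma coeff_weight_sum_1:
  assumes "N > 1" shows "(\<Sum>m<N. coeff_weight N (Suc 0) m * of_nat m) = 1"
  using coeff_weight[of "[:0, 1 :: rat:]" N "Suc 0"] assms by simp

text \<open>Modulo each power of the augmentation ideal, \<open>g ^ m\<close> is polynomial in \<open>m\<close>;
  the logarithm of \<open>g\<close> is its linear coefficient, extracted from finitely many values.\<close>

definition log_seq :: "('a, 'm) monoid_scheme \<Rightarrow> 'a \<Rightarrow> nat \<Rightarrow> ('a \<Rightarrow>\<^sub>0 rat)" where
  "log_seq G g n = (\<Sum>m<n + 2. qscale (coeff_weight (n + 2) (Suc 0) m)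
    (Poly_Mapping.single (g [^]\<^bsub>G\<^esub> m) 1))"

definition conj_seq ::
  "('a, 'm) monoid_scheme \<Rightarrow> 'a \<Rightarrow> (nat \<Rightarrow> ('a \<Rightarrow>\<^sub>0 rat)) \<Rightarrow> nat \<Rightarrow> ('a \<Rightarrow>\<^sub>0 rat)" where
  "conj_seq G g f n =
    conv G (Poly_Mapping.single g 1) (conv G (f n) (Poly_Mapping.single (inv\<^bsub>G\<^esub> g) 1))"

context group
begin

abbreviation delta :: "'a \<Rightarrow> ('a \<Rightarrow>\<^sub>0 rat)" where
  "delta g \<equiv> Poly_Mapping.single g 1"

lemma conv_delta_funpow_left:
  assumes "g \<in> carrier G" "f \<in> group_algebra G"
  shows "(conv G (delta g) ^^ m) f = conv G (delta (g [^] m)) f"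
proof (induction m)
  case (Suc m)
  have "conv G (delta g) (conv G (delta (g [^] m)) f) = conv G (delta (g \<otimes> g [^] m)) f"
    using assms by (simp flip: conv_assoc)
  then show ?case using Suc assms nat_pow_Suc2[of g m] by simp
qed (simp add: assms conv_one_left)

lemma conv_delta_funpow_right:
  assumes "h \<in> carrier G" "f \<in> group_algebra G"
  shows "((\<lambda>f. conv G f (delta h)) ^^ m) f = conv G f (delta (h [^] m))"
proof (induction m)
  case (Suc m)
  have "conv G (conv G f (delta (h [^] m))) (delta h) = conv G f (delta (h [^] m \<otimes> h))"
    using assms by (simp add: conv_assoc)
  then show ?case using Suc assms by simp
qed (simp add: assms conv_one_right)

lemma filtered_operators_conv:
  assumes "g \<in> carrier G" "h \<in> carrier G"
  shows "filtered_operators (augmentation_power G)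
    (\<lambda>f. conv G (delta g) f - f) (\<lambda>f. conv G f (delta h) - f)"
proof
  fix f n assume f: "f \<in> augmentation_power G n"
  then have c: "f \<in> group_algebra G" using augmentation_power_subset by blast
  have "conv G (delta g - group_algebra_one G) f \<in> augmentation_power G (Suc 0 + n)"
    by (rule augmentation_power_mult[OF single_diff_one_in_power[OF assms(1)] f])
  then show "conv G (delta g) f - f \<in> augmentation_power G (Suc n)"
    by (simp add: bilin_ext_diff_left conv_one_left c)
  have "conv G f (delta h - group_algebra_one G) \<in> augmentation_power G (n + Suc 0)"
    by (rule augmentation_power_mult[OF f single_diff_one_in_power[OF assms(2)]])
  then show "conv G f (delta h) - f \<in> augmentation_power G (Suc n)"
    by (simp add: bilin_ext_diff_right conv_one_right c)
qed (simp_all add: subspace_augmentation_power augmentation_power_Suc_subset bilin_ext_add_left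
    bilin_ext_add_right bilin_ext_scale_left bilin_ext_scale_right qvs.scale_right_diff_distrib)

lemma conv_moment:
  assumes "g \<in> carrier G" "h \<in> carrier G" "finite M" "f \<in> group_algebra G"
    and "\<And>p :: rat poly. degree p < n \<Longrightarrow> (\<Sum>m\<in>M. \<mu> m * poly p (of_nat m)) = 0"
  shows "(\<Sum>m\<in>M. qscale (\<mu> m) (conv G (delta (g [^] m)) (conv G f (delta (h [^] m)))))
    \<in> augmentation_power G n"
proof -
  interpret filtered_operators "augmentation_power G"
    "\<lambda>f. conv G (delta g) f - f" "\<lambda>f. conv G f (delta h) - f"
    by (rule filtered_operators_conv[OF assms(1,2)])
  have "conv G f (delta (h [^] m)) \<in> group_algebra G" for m :: nat
    using assms by (simp add: conv_closed)
  with moment[OF assms(3) _ assms(5), of f] assms(4) show ?thesis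
    by (simp add: conv_delta_funpow_left conv_delta_funpow_right assms(1,2))
qed

lemma conv_moment_mixed:
  assumes "g \<in> carrier G" "h \<in> carrier G" "f \<in> group_algebra G" "n \<le> N"
  shows "(\<Sum>m<N. qscale (coeff_weight N (Suc 0) m)
    (conv G (delta (g [^] m)) (conv G f (delta (h [^] m))) -
     conv G (delta (g [^] m)) f - conv G f (delta (h [^] m)) + f)) \<in> augmentation_power G n"
proof -
  interpret filtered_operators "augmentation_power G"
    "\<lambda>f. conv G (delta g) f - f" "\<lambda>f. conv G f (delta h) - f"
    by (rule filtered_operators_conv[OF assms(1,2)])
  have "conv G f (delta (h [^] m)) \<in> group_algebra G" for m :: nat
    using assms by (simp add: conv_closed)
  with moment_mixed[of f n N] assms(3,4) show ?thesis
    by (simp add: conv_delta_funpow_left conv_delta_funpow_right assms(1,2))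
qed

text \<open>\<open>(g, g)\<close> is the product of the commuting elements
  \<open>(g, \<one>)\<close> and \<open>(\<one>, g)\<close>, so its logarithm is the sum of theirs.
  This is what makes \<open>log g\<close> primitive.\<close>

lemma tensor_moment_mixed:
  assumes "g \<in> carrier G" "n \<le> N"
  shows "(\<Sum>m<N. qscale (coeff_weight N (Suc 0) m)
    (Poly_Mapping.single (g [^] m, g [^] m) 1 - Poly_Mapping.single (g [^] m, \<one>) 1 -
     Poly_Mapping.single (\<one>, g [^] m) 1 + Poly_Mapping.single (\<one>, \<one>) 1)) \<in> tensor_filt G n"
proof -
  let ?c = "\<lambda>x. conv (G \<times>\<times> G) (Poly_Mapping.single x 1)"
  have raise: "?c x f - f \<in> tensor_filt G (Suc n)"
    if "Poly_Mapping.single x 1 - Poly_Mapping.single (\<one>, \<one>) 1 \<in> tensor_filt G (Suc 0)"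
      and f: "f \<in> tensor_filt G n" for x f n
  proof -
    have "f \<in> qspace (carrier G \<times> carrier G)" using f tensor_filt_subset by blast
    then have "?c (\<one>, \<one>) f = f"
      by (induction f rule: qspace_induct) (auto simp: bilin_ext_add_right DirProd_def)
    then show ?thesis
      using tensor_filt_mult[OF that] by (simp add: bilin_ext_diff_left)
  qed
  have g: "Poly_Mapping.single (g, \<one>) 1 - Poly_Mapping.single (\<one>, \<one>) (1::rat) \<in> tensor_filt G (Suc 0)"
    "Poly_Mapping.single (\<one>, g) 1 - Poly_Mapping.single (\<one>, \<one>) (1::rat) \<in> tensor_filt G (Suc 0)"
    using tensor_in_tensor_filt[OF single_diff_one_in_power[OF assms(1)], of "group_algebra_one G" 0]
      tensor_in_tensor_filt[OF _ single_diff_one_in_power[OF assms(1)], of "group_algebra_one G" 0]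
    by (simp_all add: bilin_ext_diff_left bilin_ext_diff_right)
  interpret filtered_operators "tensor_filt G" "\<lambda>f. ?c (g, \<one>) f - f" "\<lambda>f. ?c (\<one>, g) f - f"
    by unfold_locales
       (simp_all add: subspace_tensor_filt tensor_filt_Suc_subset bilin_ext_add_right
        bilin_ext_scale_right qvs.scale_right_diff_distrib raise[OF g(1)] raise[OF g(2)])
  have l: "(?c (g, \<one>) ^^ m) (Poly_Mapping.single (\<one>, y) 1) = Poly_Mapping.single (g [^] m, y) 1"
    if "y \<in> carrier G" for m y
  proof (induction m)
    case (Suc m)
    then show ?case using assms that nat_pow_Suc2[of g m] by (simp add: DirProd_def)
  qed simp
  have r: "(?c (\<one>, g) ^^ m) (Poly_Mapping.single (\<one>, \<one>) 1) = Poly_Mapping.single (\<one>, g [^] m) 1" for m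
  proof (induction m)
    case (Suc m)
    then show ?case using assms nat_pow_Suc2[of g m] by (simp add: DirProd_def)
  qed simp
  have "Poly_Mapping.single (\<one>, \<one>) 1 \<in> tensor_filt G 0" by (simp add: tensor_filt_0)
  from moment_mixed[OF this assms(2)] show ?thesis by (simp add: l r assms(1))
qed

lemma log_seq_primitive:
  assumes "g \<in> carrier G" shows "log_seq G g \<in> primitive_seqs G"
  unfolding primitive_seqs_def coherent_def mem_Collect_eq
proof (intro conjI allI)
  fix n
  show "log_seq G g n \<in> group_algebra G"
    unfolding log_seq_def
    by (intro qvs.subspace_sum[OF subspace_qspace] qvs.subspace_scale[OF subspace_qspace])
       (simp add: assms)
  \<comment> \<open>Both weights read off the linear coefficient, the first with one more node, so
    their difference annihilates all polynomials of degree below \<open>n\<close>. This is the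
    coherence of consecutive levels.\<close>
  define \<mu> where "\<mu> m = coeff_weight (n + 3) (Suc 0) m -
    (if m < n + 2 then coeff_weight (n + 2) (Suc 0) m else 0)" for m
  have split: "(\<Sum>m<n + 3. if m < n + 2 then x m else 0) = (\<Sum>m<n + 2. x m)"
    for x :: "nat \<Rightarrow> 'c::comm_monoid_add"
    by (rule sum.mono_neutral_cong_right) auto
  have \<mu>: "(\<Sum>m<n + 3. \<mu> m * poly p (of_nat m)) = 0" if "degree p < n" for p
  proof -
    have "(\<Sum>m<n + 3. \<mu> m * poly p (of_nat m)) =
      (\<Sum>m<n + 3. coeff_weight (n + 3) (Suc 0) m * poly p (of_nat m)) -
      (\<Sum>m<n + 3. if m < n + 2 then coeff_weight (n + 2) (Suc 0) m * poly p (of_nat m) else 0)"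
      unfolding sum_subtractf[symmetric] \<mu>_def by (intro sum.cong refl) (auto simp: left_diff_distrib)
    then show ?thesis
      unfolding split using coeff_weight[of p "n + 3" "Suc 0"] coeff_weight[of p "n + 2" "Suc 0"] that
      by simp
  qed
  have "log_seq G g (Suc n) - log_seq G g n = (\<Sum>m<n + 3. qscale (\<mu> m) (delta (g [^] m)))"
  proof -
    have "(\<Sum>m<n + 3. qscale (\<mu> m) (delta (g [^] m))) =
      (\<Sum>m<n + 3. qscale (coeff_weight (n + 3) (Suc 0) m) (delta (g [^] m))) -
      (\<Sum>m<n + 3. if m < n + 2 then qscale (coeff_weight (n + 2) (Suc 0) m) (delta (g [^] m)) else 0)"
      unfolding sum_subtractf[symmetric] \<mu>_def
      by (intro sum.cong refl) (auto simp: single_diff)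
    then show ?thesis unfolding split log_seq_def by (simp add: eval_nat_numeral)
  qed
  also have "\<dots> \<in> augmentation_power G n"
    using conv_moment[OF assms one_closed, of "{..<n + 3}" "group_algebra_one G" n \<mu>] \<mu> assms
    by simp
  finally show "log_seq G g (Suc n) - log_seq G g n \<in> augmentation_power G n" .
  have eq: "primitive_defect G (log_seq G g n) = (\<Sum>m<n + 2. qscale (coeff_weight (n + 2) (Suc 0) m)
    (Poly_Mapping.single (g [^] m, g [^] m) 1 - Poly_Mapping.single (g [^] m, \<one>) 1 -
     Poly_Mapping.single (\<one>, g [^] m) 1))"
    unfolding log_seq_def qlinear_sum[OF qlinear_primitive_defect] qlinear_scale[OF qlinear_primitive_defect]
    by (simp add: primitive_defect_def)
  \<comment> \<open>The weights sum to 0, so the constant term of the mixed moment may be added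
    without changing the defect.\<close>
  have "(\<Sum>m<n + 2. qscale (coeff_weight (n + 2) (Suc 0) m) (Poly_Mapping.single (\<one>, \<one>) 1)) =
    qscale (\<Sum>m<n + 2. coeff_weight (n + 2) (Suc 0) m) (Poly_Mapping.single (\<one>, \<one>) (1::rat))"
    by (simp only: qvs.scale_sum_left)
  also have "\<dots> = 0" using coeff_weight_sum_0[of "n + 2"] by simp
  finally have "primitive_defect G (log_seq G g n) = primitive_defect G (log_seq G g n) +
    (\<Sum>m<n + 2. qscale (coeff_weight (n + 2) (Suc 0) m) (Poly_Mapping.single (\<one>, \<one>) 1))" by simp
  also have "\<dots> \<in> tensor_filt G n"
    using tensor_moment_mixed[OF assms, of n "n + 2"]
    unfolding eq sum.distrib[symmetric] qvs.scale_right_distrib[symmetric] by simp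
  finally show "primitive_defect G (log_seq G g n) \<in> tensor_filt G n" .
qed

text \<open>Group elements are grouplike, so the defect of a conjugate is the defect conjugated by
  \<open>g \<otimes> g\<close>.\<close>

lemma conj_seq_primitive:
  assumes "g \<in> carrier G" "f \<in> primitive_seqs G" shows "conj_seq G g f \<in> primitive_seqs G"
  unfolding primitive_seqs_def coherent_def mem_Collect_eq
proof (intro conjI allI)
  fix n
  have f: "f n \<in> group_algebra G" "f (Suc n) - f n \<in> augmentation_power G n"
    "primitive_defect G (f n) \<in> tensor_filt G n"
    using assms(2) by (auto simp: primitive_seqs_def coherent_def)
  show "conj_seq G g f n \<in> group_algebra G"
    unfolding conj_seq_def by (intro conv_closed f) (simp_all add: assms)
  have "conv G (delta g) (conv G (f (Suc n) - f n) (delta (inv g))) \<in> augmentation_power G n"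
    by (intro augmentation_power_left_ideal augmentation_power_right_ideal f) (simp_all add: assms)
  then show "conj_seq G g f (Suc n) - conj_seq G g f n \<in> augmentation_power G n"
    by (simp add: conj_seq_def bilin_ext_diff_left bilin_ext_diff_right)
  let ?c = "\<lambda>x. conv (G \<times>\<times> G) (tensor (delta g) (delta g))
    (conv (G \<times>\<times> G) x (tensor (delta (inv g)) (delta (inv g))))"
  have t: "tensor (delta k) (delta k) \<in> tensor_filt G 0" if "k \<in> carrier G" for k
    using tensor_in_tensor_filt[of "delta k" 0 "delta k" 0] that by simp
  have "?c (primitive_defect G (f n)) \<in> tensor_filt G (0 + (n + 0))"
    by (intro tensor_filt_mult t f) (simp_all add: assms)
  moreover have "primitive_defect G (conj_seq G g f n) = ?c (primitive_defect G (f n))"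
    unfolding primitive_defect_def bilin_ext_diff_left bilin_ext_diff_right conv_DirProd_tensor
      conj_seq_def diag_conv using assms(1) by simp
  ultimately show "primitive_defect G (conj_seq G g f n) \<in> tensor_filt G n" by simp
qed

lemma conj_seq_mult:
  assumes "g \<in> carrier G" "h \<in> carrier G" "f \<in> primitive_seqs G"
  shows "conj_seq G (g \<otimes> h) f = conj_seq G g (conj_seq G h f)"
proof
  fix n
  let ?k = "f n" and ?i = "\<lambda>g. delta (inv g)"
  have c: "?k \<in> group_algebra G" by (rule primitive_seqs_carrier[OF assms(3)])
  have l: "delta (g \<otimes> h) = conv G (delta g) (delta h)" and r: "?i (g \<otimes> h) = conv G (?i h) (?i g)"
    using assms by (simp_all add: inv_mult_group)
  show "conj_seq G (g \<otimes> h) f n = conj_seq G g (conj_seq G h f) n"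
    unfolding conj_seq_def l r using assms c by (simp add: conv_assoc conv_closed del: bilin_ext_single)
qed

lemma conj_seq_moment:
  assumes "g \<in> carrier G" "finite M" "f \<in> primitive_seqs G"
    and "\<And>p :: rat poly. degree p < n \<Longrightarrow> (\<Sum>m\<in>M. \<mu> m * poly p (of_nat m)) = 0"
  shows "(\<Sum>m\<in>M. qscale (\<mu> m) (conj_seq G (g [^] m) f n)) \<in> augmentation_power G n"
  using conv_moment[OF assms(1) inv_closed[OF assms(1)] assms(2) primitive_seqs_carrier[OF assms(3)] assms(4)]
  by (simp add: conj_seq_def nat_pow_inv assms(1))

text \<open>The bracket with \<open>log g\<close> is the derivative at \<open>m = 0\<close> of conjugation by \<open>g ^ m\<close>.\<close>

lemma log_seq_bracket:
  assumes "g \<in> carrier G" "f \<in> primitive_seqs G"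
  shows "conv_comm G (log_seq G g n) (f n) -
    (\<Sum>m<n + 2. qscale (coeff_weight (n + 2) (Suc 0) m) (conj_seq G (g [^] m) f n))
    \<in> augmentation_power G n"
proof -
  let ?w = "coeff_weight (n + 2) (Suc 0)" and ?f = "f n"
  let ?S = "\<lambda>x. \<Sum>m<n + 2. qscale (?w m) (x m)"
  let ?a = "\<lambda>m::nat. delta (g [^] m)" and ?b = "\<lambda>m::nat. delta (inv g [^] m)"
  have f: "?f \<in> group_algebra G" by (rule primitive_seqs_carrier[OF assms(2)])
  have i: "inv g \<in> carrier G" using assms by simp
  have S_add: "?S x + ?S y = ?S (\<lambda>m. x m + y m)" for x y :: "nat \<Rightarrow> ('a \<Rightarrow>\<^sub>0 rat)"
    by (simp only: sum.distrib qvs.scale_right_distrib)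
  have S_diff: "?S x - ?S y = ?S (\<lambda>m. x m - y m)" for x y :: "nat \<Rightarrow> ('a \<Rightarrow>\<^sub>0 rat)"
    by (simp only: sum_subtractf qvs.scale_right_diff_distrib)
  have S_const: "?S (\<lambda>_. x) = 0" for x :: "'a \<Rightarrow>\<^sub>0 rat"
    using coeff_weight_sum_0[of "n + 2"] by (simp only: flip: qvs.scale_sum_left) simp
  have S_left: "conv G ?f (?S x) = ?S (\<lambda>m. conv G ?f (x m))" for x
    by (simp only: qlinear_sum[OF qlinear_bilin_ext_right] bilin_ext_scale_right)
  have S_right: "conv G (?S x) ?f = ?S (\<lambda>m. conv G (x m) ?f)" for x
    by (simp only: qlinear_sum[OF qlinear_bilin_ext_left] bilin_ext_scale_left)
  \<comment> \<open>Conjugation by \<open>g ^ m\<close> is left multiplication by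
    \<open>g ^ m\<close> composed with right multiplication by the inverse power; to first order in
    \<open>m\<close> the two contributions add up.\<close>
  have e1: "?S (\<lambda>m. conv G (?a m) (conv G ?f (?b m)) - conv G (?a m) ?f - conv G ?f (?b m) + ?f)
    \<in> augmentation_power G n"
    by (rule conv_moment_mixed[OF assms(1) i f]) simp
  have one: "g [^] m \<otimes> (inv g) [^] m = \<one>" for m :: nat
    using assms(1) by (simp add: nat_pow_inv)
  \<comment> \<open>The same identity with the unit in place of \<open>f\<close> says that the
    logarithms of \<open>g\<close> and \<open>inv g\<close> are opposite; it turns right
    multiplication by the latter into minus right multiplication by the former.\<close>
  have "?S (\<lambda>m. conv G (?a m) (conv G (group_algebra_one G) (?b m)) - conv G (?a m) (group_algebra_one G)
      - conv G (group_algebra_one G) (?b m) + group_algebra_one G) \<in> augmentation_power G n"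
    by (rule conv_moment_mixed[OF assms(1) i]) simp_all
  also have "(\<lambda>m. conv G (?a m) (conv G (group_algebra_one G) (?b m)) - conv G (?a m) (group_algebra_one G)
      - conv G (group_algebra_one G) (?b m) + group_algebra_one G) =
      (\<lambda>m. group_algebra_one G - ?a m - ?b m + group_algebra_one G)"
    using assms(1) i by (simp add: one)
  finally have "conv G ?f (?S (\<lambda>m. group_algebra_one G - ?a m - ?b m + group_algebra_one G))
      \<in> augmentation_power G n"
    by (intro augmentation_power_left_ideal f)
  then have e2: "?S (\<lambda>m. ?f - conv G ?f (?a m) - conv G ?f (?b m) + ?f) \<in> augmentation_power G n"
    unfolding S_left by (simp add: bilin_ext_add_right bilin_ext_diff_right conv_one_right f)
  have "?S (\<lambda>m. ?f - conv G ?f (?a m) - conv G ?f (?b m) + ?f) -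
      ?S (\<lambda>m. conv G (?a m) (conv G ?f (?b m)) - conv G (?a m) ?f - conv G ?f (?b m) + ?f) =
      ?S (\<lambda>m. conv G (?a m) ?f) - ?S (\<lambda>m. conv G ?f (?a m)) -
        ?S (\<lambda>m. conv G (?a m) (conv G ?f (?b m))) + ?S (\<lambda>_. ?f)"
    unfolding S_diff S_add by (simp add: algebra_simps)
  also have "\<dots> = conv_comm G (log_seq G g n) ?f - ?S (\<lambda>m. conj_seq G (g [^] m) f n)"
    unfolding S_const log_seq_def S_left S_right conj_seq_def
    using assms(1) by (simp add: nat_pow_inv)
  finally show ?thesis
    using qvs.subspace_diff[OF subspace_augmentation_power e2 e1] by simp
qed

end

section \<open>Derivations of presented Lie algebras\<close>

primrec linear_part :: "('x \<Rightarrow> real) \<Rightarrow> 'x magma \<Rightarrow> real" where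
  "linear_part v (Gen x) = v x"
| "linear_part v (Node s t) = 0"

text \<open>The value of a tree in the affine Lie algebra when \<open>x\<close> is sent to
  \<open>(t v(x), p(x))\<close>: the translation part is this number times \<open>t\<close> to the
  number of leaves minus one. Brackets have no first component, whence \<open>linear_part\<close> is
  0 on \<open>Node\<close>.\<close>

primrec derivation :: "('x \<Rightarrow> real) \<Rightarrow> ('x \<Rightarrow> real) \<Rightarrow> 'x magma \<Rightarrow> real" where
  "derivation v p (Gen x) = p x"
| "derivation v p (Node s t) = linear_part v s * derivation v p t - linear_part v t * derivation v p s"

text \<open>The coefficient of \<open>t ^ k\<close> in the translation part; it sees the trees with
  \<open>k + 1\<close> leaves.\<close>

definition derivation_part :: "('x \<Rightarrow> real) \<Rightarrow> ('x \<Rightarrow> real) \<Rightarrow> nat \<Rightarrow> 'x magma \<Rightarrow> real" where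
  "derivation_part v p k t = (if leaves t = Suc k then derivation v p t else 0)"

lemma leaves_neq_0 [simp]: "leaves t \<noteq> 0"
  by (induction t) auto

lemma linear_part_eq_0: "leaves t \<noteq> 1 \<Longrightarrow> linear_part v t = 0"
  by (cases t) auto

lemma leaves_eq_1_iff: "leaves t = Suc 0 \<longleftrightarrow> (\<exists>x. t = Gen x)"
  by (cases t) (auto simp: add_is_1)

lemma derivation_part_0: "derivation_part v p 0 = linear_part p"
proof
  fix t show "derivation_part v p 0 t = linear_part p t"
    by (cases t) (auto simp: derivation_part_def add_is_1)
qed

lemma derivation_part_Node_Suc:
  "derivation_part v p (Suc k) (Node s t) =
    linear_part v s * derivation_part v p k t - linear_part v t * derivation_part v p k s"
  by (cases s; cases t) (auto simp: derivation_part_def add_is_1)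

lemma linear_part_nprod: "real_ext (linear_part v) (nprod f g) = 0"
  by (simp add: real_ext_bilin_ext)

lemma derivation_part_nprod_0: "real_ext (derivation_part v p 0) (nprod f g) = 0"
  by (simp add: derivation_part_0 linear_part_nprod)

lemma derivation_part_nprod:
  "real_ext (derivation_part v p (Suc k)) (nprod f g) =
    real_ext (linear_part v) f * real_ext (derivation_part v p k) g -
    real_ext (linear_part v) g * real_ext (derivation_part v p k) f"
proof (induction f rule: poly_mapping_additive_induct)
  case (single s a)
  show ?case
    by (induction g rule: poly_mapping_additive_induct)
       (simp_all add: bilin_ext_add_right real_ext_add derivation_part_Node_Suc of_rat_mult algebra_simps)
qed (simp_all add: bilin_ext_add_left real_ext_add algebra_simps)

lemma nprod_in_free_nonassoc:
  "f \<in> free_nonassoc X \<Longrightarrow> g \<in> free_nonassoc X \<Longrightarrow> nprod f g \<in> free_nonassoc X"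
  unfolding free_nonassoc_def by (rule bilin_ext_in_qspace) auto

lemma subspace_free_nonassoc: "qvs.subspace (free_nonassoc X)"
  by (simp add: free_nonassoc_def subspace_qspace)

text \<open>Antisymmetry and the Jacobi identity of the affine Lie algebra, degree by degree. The
  lowest degrees are separate because a bracket has no translation part of degree 0.\<close>

lemma derivation_part_lie_identities:
  assumes "f \<in> lie_identities X"
  shows "real_ext (derivation_part v p k) f = 0"
proof (cases k)
  case 0
  then show ?thesis
    using assms by (auto simp: lie_identities_def derivation_part_nprod_0 real_ext_add)
next
  case (Suc k')
  then show ?thesis
    using assms
    by (cases k') (auto simp: lie_identities_def derivation_part_nprod derivation_part_nprod_0
        real_ext_add linear_part_nprod algebra_simps)
qed

text \<open>Relators have two leaves, so only \<open>k = 1\<close> is a condition on them. The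
  common zeros of all coefficients and of \<open>linear_part\<close> form an ideal;
  \<open>linear_part\<close> has to be included because it enters the product formula.\<close>

lemma derivation_part_relation_ideal:
  assumes "R \<subseteq> qspace {t. set_magma t \<subseteq> X \<and> leaves t = 2}"
    and "\<And>r. r \<in> R \<Longrightarrow> real_ext (derivation_part v p 1) r = 0"
    and "f \<in> relation_ideal X R"
  shows "real_ext (derivation_part v p k) f = 0" "real_ext (linear_part v) f = 0"
proof -
  let ?J = "{f \<in> free_nonassoc X. real_ext (linear_part v) f = 0 \<and>
    (\<forall>k. real_ext (derivation_part v p k) f = 0)}"
  have "relation_ideal X R \<subseteq> ?J"
    unfolding relation_ideal_def
  proof (rule hull_minimal)
    have "R \<subseteq> free_nonassoc X"
      using assms(1) by (auto simp: free_nonassoc_def qspace_def)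
    moreover have "real_ext (derivation_part v p k) r = 0 \<and> real_ext (linear_part v) r = 0"
      if "r \<in> R" for r k
    proof -
      have r: "r \<in> qspace {t. set_magma t \<subseteq> X \<and> leaves t = 2}" using assms(1) that by auto
      have "real_ext (linear_part v) r = real_ext (\<lambda>_. 0) r"
        by (rule real_ext_cong_qspace[OF r]) (auto intro: linear_part_eq_0)
      moreover have "real_ext (derivation_part v p k) r = real_ext (\<lambda>_. 0) r" if "k \<noteq> 1"
        by (rule real_ext_cong_qspace[OF r]) (use that in \<open>auto simp: derivation_part_def\<close>)
      ultimately show ?thesis using assms(2)[OF that] by (auto simp: real_ext_def)
    qed
    moreover have "lie_identities X \<subseteq> free_nonassoc X"
      by (auto simp: lie_identities_def intro!: nprod_in_free_nonassoc qvs.subspace_add[OF subspace_free_nonassoc])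
    moreover have "real_ext (linear_part v) r = 0" if "r \<in> lie_identities X" for r
      using that by (auto simp: lie_identities_def linear_part_nprod real_ext_add)
    ultimately show "lie_identities X \<union> R \<subseteq> ?J"
      using derivation_part_lie_identities by blast
    show "nonassoc_ideal X ?J"
      unfolding nonassoc_ideal_def
    proof (intro conjI ballI)
      show "qvs.subspace ?J"
        using subspace_free_nonassoc by (auto simp: qvs.subspace_def real_ext_add real_ext_scale)
    next
      fix f j assume f: "f \<in> free_nonassoc X" and j: "j \<in> ?J"
      have "real_ext (derivation_part v p k) (nprod f j) = 0 \<and>
        real_ext (derivation_part v p k) (nprod j f) = 0" for k
        using j by (cases k) (auto simp: derivation_part_nprod_0 derivation_part_nprod)
      then show "nprod f j \<in> ?J" "nprod j f \<in> ?J"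
        using f j by (auto simp: linear_part_nprod intro: nprod_in_free_nonassoc)
    qed auto
  qed
  then show "real_ext (derivation_part v p k) f = 0" "real_ext (linear_part v) f = 0"
    using assms(3) by auto
qed

text \<open>Trees with at least \<open>n\<close> leaves do not contribute to a coefficient that
  counts \<open>k + 1 < n\<close> leaves.\<close>

lemma derivation_part_presented_filt:
  assumes "R \<subseteq> qspace {t. set_magma t \<subseteq> X \<and> leaves t = 2}"
    and "\<And>r. r \<in> R \<Longrightarrow> real_ext (derivation_part v p 1) r = 0"
    and "f \<in> presented_filt X R n" "Suc k < n"
  shows "real_ext (derivation_part v p k) f = 0"
proof -
  obtain a b where f: "f = a + b" "a \<in> relation_ideal X R"
    and b: "b \<in> qspace {t. set_magma t \<subseteq> X \<and> n \<le> leaves t}"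
    using assms(3) by (auto simp: presented_filt_def set_plus_def)
  have "real_ext (derivation_part v p k) b = real_ext (\<lambda>_. 0) b"
    by (rule real_ext_cong_qspace[OF b]) (use assms(4) in \<open>auto simp: derivation_part_def\<close>)
  then show ?thesis
    using derivation_part_relation_ideal[OF assms(1,2) f(2)] f(1)
    by (simp add: real_ext_add) (simp add: real_ext_def)
qed

text \<open>\<open>linear_part p\<close> is the translation part of degree 0, and with the zero
  character in place of \<open>v\<close> the condition on relators holds trivially.\<close>

lemma linear_part_presented_filt:
  assumes "R \<subseteq> qspace {t. set_magma t \<subseteq> X \<and> leaves t = 2}"
    and "f \<in> presented_filt X R n" "1 < n"
  shows "real_ext (linear_part p) f = 0"
proof -
  have "real_ext (derivation_part (\<lambda>_. 0) p 1) r = 0" if "r \<in> R" for r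
  proof -
    have "r \<in> qspace {t. set_magma t \<subseteq> X \<and> leaves t = 2}" using assms(1) that by auto
    then have "real_ext (derivation_part (\<lambda>_. 0) p 1) r = real_ext (\<lambda>_. 0) r"
    proof (rule real_ext_cong_qspace)
      fix t :: "'a magma"
      show "derivation_part (\<lambda>_. 0) p 1 t = 0"
      proof (cases t)
        case (Node a b)
        have "linear_part (\<lambda>_. 0) a = 0" "linear_part (\<lambda>_. 0) b = 0" by (cases a; simp) (cases b; simp)
        with Node show ?thesis by (simp add: derivation_part_def)
      qed (simp add: derivation_part_def)
    qed
    then show ?thesis by (simp add: real_ext_def)
  qed
  from derivation_part_presented_filt[OF assms(1) this assms(2), of 0] assms(3) show ?thesis
    by (simp add: derivation_part_0)
qed

lemma subspace_relation_ideal: "qvs.subspace (relation_ideal X R)"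
  unfolding relation_ideal_def hull_def by (rule qvs.subspace_Inter) (auto simp: nonassoc_ideal_def)

lemma subspace_presented_filt: "qvs.subspace (presented_filt X R n)"
  unfolding presented_filt_def set_plus_def
  using qvs.subspace_sums[OF subspace_relation_ideal subspace_qspace]
  by (rule back_subst[of qvs.subspace]) auto

lemma relators_in_presented_filt:
  assumes "r \<in> R" shows "r \<in> presented_filt X R n"
proof -
  have "r \<in> relation_ideal X R"
    unfolding relation_ideal_def by (rule subsetD[OF hull_subset]) (use assms in auto)
  then show ?thesis
    unfolding presented_filt_def
    using set_plus_intro[OF _ qvs.subspace_0[OF subspace_qspace]] by fastforce
qed

interpretation presented: qfiltration "free_nonassoc X" "presented_filt X R"
proof
  show "presented_filt X R (Suc n) \<subseteq> presented_filt X R n" for n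
    unfolding presented_filt_def by (rule set_plus_mono2) (auto simp: qspace_def)
qed (simp_all add: subspace_presented_filt subspace_free_nonassoc)

lemma presented_filt_subset:
  assumes "R \<subseteq> free_nonassoc X" shows "presented_filt X R n \<subseteq> free_nonassoc X"
proof -
  have "relation_ideal X R \<subseteq> free_nonassoc X"
    unfolding relation_ideal_def
  proof (rule hull_minimal)
    show "lie_identities X \<union> R \<subseteq> free_nonassoc X"
      using assms by (auto simp: lie_identities_def intro!: nprod_in_free_nonassoc
          qvs.subspace_add[OF subspace_free_nonassoc])
    show "nonassoc_ideal X (free_nonassoc X)"
      by (auto simp: nonassoc_ideal_def subspace_free_nonassoc nprod_in_free_nonassoc)
  qed
  moreover have "qspace {t. set_magma t \<subseteq> X \<and> n \<le> leaves t} \<subseteq> free_nonassoc X"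
    by (auto simp: free_nonassoc_def qspace_def)
  ultimately show ?thesis
    unfolding presented_filt_def
    by (auto simp: set_plus_def intro!: qvs.subspace_add[OF subspace_free_nonassoc])
qed

lemma completed1_memI:
  assumes "f \<in> x n" "\<And>n. 0 \<in> F n" shows "t f \<in> completed1 F t x n"
  using assms by (auto simp: completed1_def mem_coset_iff intro!: bexI[of _ f])

lemma completed2_memI:
  assumes "f \<in> x n" "g \<in> y n" "\<And>n. 0 \<in> F n" shows "t f g \<in> completed2 F t x y n"
  using assms by (auto simp: completed2_def mem_coset_iff intro!: bexI[of _ f] bexI[of _ g])

lemma completed_presented_lie_simps:
  "lie_carrier (completed_presented_lie X R) = completion (free_nonassoc X) (presented_filt X R)"
  "lie_add (completed_presented_lie X R) = completed2 (presented_filt X R) (+)"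
  "lie_scale (completed_presented_lie X R) c = completed1 (presented_filt X R) (qscale c)"
  "lie_bracket (completed_presented_lie X R) = completed2 (presented_filt X R) nprod"
  "lie_filt (completed_presented_lie X R) n =
    {x \<in> completion (free_nonassoc X) (presented_filt X R). x n = presented_filt X R n}"
  by (simp_all add: completed_presented_lie_def completed_lie_def)

section \<open>Linear and quadratic functions on powers of the augmentation ideal\<close>

context group
begin

lemma hom_conv:
  assumes "\<And>g h. g \<in> carrier G \<Longrightarrow> h \<in> carrier G \<Longrightarrow> \<chi> (g \<otimes> h) = \<chi> g + \<chi> h"
    and "f \<in> group_algebra G" "k \<in> group_algebra G"
  shows "real_ext \<chi> (conv G f k) = real_ext \<chi> f * real_ext (\<lambda>_. 1) k + real_ext (\<lambda>_. 1) f * real_ext \<chi> k"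
  using assms(2)
proof (induction f rule: qspace_induct)
  case (single s a)
  then have s: "s \<in> carrier G" .
  from assms(3) show ?case
    by (induction k rule: qspace_induct)
       (simp_all add: bilin_ext_add_right real_ext_add assms(1) s of_rat_mult algebra_simps)
qed (simp_all add: bilin_ext_add_left real_ext_add algebra_simps)

lemma hom_vanishes_on_power_2:
  assumes "\<And>g h. g \<in> carrier G \<Longrightarrow> h \<in> carrier G \<Longrightarrow> \<chi> (g \<otimes> h) = \<chi> g + \<chi> h"
    and "f \<in> augmentation_power G 2"
  shows "real_ext \<chi> f = 0"
proof (rule real_ext_zero_on_span)
  show "f \<in> qvs.span {conv G f h | f h. f \<in> augmentation_ideal G \<and> h \<in> augmentation_power G 1}"
    using assms(2) by (simp add: numeral_2_eq_2 augmentation_power.simps(2))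
  show "real_ext \<chi> x = 0"
    if "x \<in> {conv G f h | f h. f \<in> augmentation_ideal G \<and> h \<in> augmentation_power G 1}" for x
    using that by (auto simp: augmentation_power_1 augmentation_ideal_eq hom_conv[of \<chi>, OF assms(1)])
qed

lemma quadratic_conv:
  assumes "\<And>g h. g \<in> carrier G \<Longrightarrow> h \<in> carrier G \<Longrightarrow> u (g \<otimes> h) = u g + u h + v g * w h"
    and "f \<in> group_algebra G" "k \<in> group_algebra G"
  shows "real_ext u (conv G f k) = real_ext u f * real_ext (\<lambda>_. 1) k +
    real_ext (\<lambda>_. 1) f * real_ext u k + real_ext v f * real_ext w k"
  using assms(2)
proof (induction f rule: qspace_induct)
  case (single s a)
  then have s: "s \<in> carrier G" .
  from assms(3) show ?case
    by (induction k rule: qspace_induct)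
       (simp_all add: bilin_ext_add_right real_ext_add assms(1) s of_rat_mult algebra_simps)
qed (simp_all add: bilin_ext_add_left real_ext_add algebra_simps)

text \<open>On a product of an element \<open>k\<close> of the ideal and an element \<open>h\<close>
  of its square, \<open>u\<close> reduces to \<open>v k * w h\<close>, and \<open>w\<close> vanishes
  on the square.\<close>

lemma quadratic_vanishes_on_power_3:
  assumes "\<And>g h. g \<in> carrier G \<Longrightarrow> h \<in> carrier G \<Longrightarrow> u (g \<otimes> h) = u g + u h + v g * w h"
    and "\<And>g h. g \<in> carrier G \<Longrightarrow> h \<in> carrier G \<Longrightarrow> w (g \<otimes> h) = w g + w h"
    and "f \<in> augmentation_power G 3"
  shows "real_ext u f = 0"
proof (rule real_ext_zero_on_span)
  show "f \<in> qvs.span {conv G f h | f h. f \<in> augmentation_ideal G \<and> h \<in> augmentation_power G 2}"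
    using assms(3) by (simp add: eval_nat_numeral augmentation_power.simps(2))
  fix x assume "x \<in> {conv G f h | f h. f \<in> augmentation_ideal G \<and> h \<in> augmentation_power G 2}"
  then obtain k h where x: "x = conv G k h" "k \<in> augmentation_ideal G" "h \<in> augmentation_power G 2"
    by auto
  then have "h \<in> augmentation_ideal G"
    using augmentation_power_antimono[of 1 2] by (auto simp: augmentation_power_1)
  then show "real_ext u x = 0"
    using x hom_vanishes_on_power_2[of w, OF assms(2) x(3)]
    by (simp add: augmentation_ideal_eq quadratic_conv[of u v w, OF assms(1)])
qed

end

section \<open>Transport along a quadratic presentation\<close>

locale quadratic_presentation = group G for G :: "('a, 'm) monoid_scheme" (structure) +
  fixes X :: "'x set" and R and \<phi>
  assumes quadratic: "R \<subseteq> qspace {t. set_magma t \<subseteq> X \<and> leaves t = 2}"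
    and iso: "filtered_lie_iso (malcev_lie G) (completed_presented_lie X R) \<phi>"
begin

text \<open>The isomorphism acts on whole sequences of cosets; here one combination of trees is
  taken out of the n-th coset. It is determined modulo \<open>presented_filt X R n\<close>.\<close>

definition represents :: "nat \<Rightarrow> ('x magma \<Rightarrow>\<^sub>0 rat) \<Rightarrow> (nat \<Rightarrow> ('a \<Rightarrow>\<^sub>0 rat)) \<Rightarrow> bool" where
  "represents n h f \<longleftrightarrow> h \<in> \<phi> (malcev_of f) n"

lemma zero_in_presented_filt: "0 \<in> presented_filt X R n"
  by (rule qvs.subspace_0[OF subspace_presented_filt])

lemma relators_subset: "R \<subseteq> free_nonassoc X"
  using quadratic by (auto simp: free_nonassoc_def qspace_def)

lemma malcev_of_carrier: "f \<in> primitive_seqs G \<Longrightarrow> malcev_of f \<in> lie_carrier (malcev_lie G)"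
  by (simp add: malcev_lie_simps primitives_eq)

lemma phi_completion:
  assumes "f \<in> primitive_seqs G"
  shows "\<phi> (malcev_of f) \<in> completion (free_nonassoc X) (presented_filt X R)"
  using iso malcev_of_carrier[OF assms]
  by (auto simp: filtered_lie_iso_def bij_betw_def completed_presented_lie_simps)

lemma represents_ex:
  assumes "f \<in> primitive_seqs G"
  obtains h where "h \<in> free_nonassoc X" "represents n h f"
proof -
  obtain k where "coherent (free_nonassoc X) (presented_filt X R) k"
    "\<phi> (malcev_of f) = coset_seq (presented_filt X R) k"
    using presented.completion_obtain[OF phi_completion[OF assms]] by blast
  then show thesis
    using that[of "k n"] zero_in_presented_filt
    by (simp add: represents_def coherent_def coset_seq_def mem_coset_iff)
qed

lemma represents_diff_mem:
  assumes "f \<in> primitive_seqs G" "represents n h f" "represents n h' f"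
  shows "h - h' \<in> presented_filt X R n"
proof -
  obtain k where "\<phi> (malcev_of f) = coset_seq (presented_filt X R) k"
    using presented.completion_obtain[OF phi_completion[OF assms(1)]] by blast
  then have "h - k n \<in> presented_filt X R n" "h' - k n \<in> presented_filt X R n"
    using assms by (simp_all add: represents_def coset_seq_def mem_coset_iff)
  from qvs.subspace_diff[OF subspace_presented_filt this] show ?thesis by simp
qed

lemma represents_antimono:
  "f \<in> primitive_seqs G \<Longrightarrow> represents n h f \<Longrightarrow> m \<le> n \<Longrightarrow> represents m h f"
  using presented.completion_mem_antimono[OF phi_completion] by (auto simp: represents_def)

lemma represents_free:
  assumes "f \<in> primitive_seqs G" "represents n h f" shows "h \<in> free_nonassoc X"
proof -
  obtain k where k: "k \<in> free_nonassoc X" "represents n k f"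
    using represents_ex[OF assms(1)] by blast
  have "h = k + (h - k)" by simp
  then show ?thesis
    using represents_diff_mem[OF assms k(2)] presented_filt_subset[OF relators_subset, of n] k(1)
    by (metis qvs.subspace_add[OF subspace_free_nonassoc] subsetD)
qed

lemma represents_add:
  assumes "f \<in> primitive_seqs G" "f' \<in> primitive_seqs G" "represents n h f" "represents n h' f'"
  shows "represents n (h + h') (\<lambda>n. f n + f' n)"
proof -
  have "\<phi> (malcev_of (\<lambda>n. f n + f' n)) = completed2 (presented_filt X R) (+) (\<phi> (malcev_of f)) (\<phi> (malcev_of f'))"
    using iso malcev_of_carrier[OF assms(1)] malcev_of_carrier[OF assms(2)]
    by (simp add: filtered_lie_iso_def malcev_add[symmetric] completed_presented_lie_simps)
  then show ?thesis
    using assms zero_in_presented_filt by (simp add: represents_def completed2_memI)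
qed

lemma represents_scale:
  assumes "f \<in> primitive_seqs G" "represents n h f"
  shows "represents n (qscale c h) (\<lambda>n. qscale c (f n))"
proof -
  have "\<phi> (malcev_of (\<lambda>n. qscale c (f n))) = completed1 (presented_filt X R) (qscale c) (\<phi> (malcev_of f))"
    using iso malcev_of_carrier[OF assms(1)]
    by (simp add: filtered_lie_iso_def malcev_scale[symmetric] completed_presented_lie_simps)
  then show ?thesis
    using assms zero_in_presented_filt by (simp add: represents_def completed1_memI)
qed

lemma represents_bracket:
  assumes "f \<in> primitive_seqs G" "f' \<in> primitive_seqs G" "represents n h f" "represents n h' f'"
  shows "represents n (nprod h h') (\<lambda>n. conv_comm G (f n) (f' n))"
proof -
  have "\<phi> (malcev_of (\<lambda>n. conv_comm G (f n) (f' n))) =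
      completed2 (presented_filt X R) nprod (\<phi> (malcev_of f)) (\<phi> (malcev_of f'))"
    using iso malcev_of_carrier[OF assms(1)] malcev_of_carrier[OF assms(2)]
    by (simp add: filtered_lie_iso_def completed_presented_lie_simps flip: malcev_bracket[OF assms(1,2)])
  then show ?thesis
    using assms zero_in_presented_filt by (simp add: represents_def completed2_memI)
qed

lemma primitive_seqs_zero: "(\<lambda>n. 0) \<in> primitive_seqs G"
  using primitive_seqs_lincomb[of "{}" undefined G undefined] by simp

lemma represents_lincomb:
  assumes "\<And>i. i \<in> I \<Longrightarrow> f i \<in> primitive_seqs G" "\<And>i. i \<in> I \<Longrightarrow> represents n (h i) (f i)" "finite I"
  shows "represents n (\<Sum>i\<in>I. qscale (c i) (h i)) (\<lambda>n. \<Sum>i\<in>I. qscale (c i) (f i n))"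
  using assms(3,1,2)
proof (induction I rule: finite_induct)
  case empty
  \<comment> \<open>The zero sequence is treated as 0 times itself, so that the scaling rule yields
    the representative 0.\<close>
  obtain h where "represents n h (\<lambda>n. 0)" using represents_ex[OF primitive_seqs_zero] by blast
  from represents_scale[OF primitive_seqs_zero this, of 0] show ?case by simp
next
  case (insert i I)
  then show ?case
    using represents_add[OF primitive_seqs_scale[of "f i" G "c i"] primitive_seqs_lincomb[of I f G c]
        represents_scale[of "f i" n "h i" "c i"], of "\<Sum>i\<in>I. qscale (c i) (h i)"]
    by simp
qed

text \<open>The point where the isomorphism being filtered enters: degree on the tree side is
  converted into powers of the augmentation ideal, in both directions.\<close>

lemma represents_filt_iff:
  assumes "f \<in> primitive_seqs G" "represents n h f"
  shows "h \<in> presented_filt X R n \<longleftrightarrow> f n \<in> augmentation_power G n"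
proof -
  obtain k where k: "\<phi> (malcev_of f) = coset_seq (presented_filt X R) k"
    using presented.completion_obtain[OF phi_completion[OF assms(1)]] by blast
  have hk: "h - k n \<in> presented_filt X R n"
    using assms(2) k by (simp add: represents_def coset_seq_def mem_coset_iff)
  then have "k n +o presented_filt X R n = h +o presented_filt X R n"
    using coset_eq_iff[OF subspace_presented_filt] by metis
  then have "\<phi> (malcev_of f) \<in> lie_filt (completed_presented_lie X R) n \<longleftrightarrow> h \<in> presented_filt X R n"
    using coset_eq_iff[OF subspace_presented_filt, of h X R n 0] phi_completion[OF assms(1)] k
    by (simp add: completed_presented_lie_simps coset_seq_def)
  moreover have "\<phi> (malcev_of f) \<in> lie_filt (completed_presented_lie X R) n \<longleftrightarrow>
      malcev_of f \<in> lie_filt (malcev_lie G) n"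
  proof -
    have "lie_filt (completed_presented_lie X R) n = \<phi> ` lie_filt (malcev_lie G) n"
      and "inj_on \<phi> (lie_carrier (malcev_lie G))"
      using iso by (auto simp: filtered_lie_iso_def bij_betw_def)
    moreover have "lie_filt (malcev_lie G) n \<subseteq> lie_carrier (malcev_lie G)"
      by (auto simp: malcev_lie_simps)
    ultimately show ?thesis
      using malcev_of_carrier[OF assms(1)] by (simp add: inj_on_image_mem_iff)
  qed
  ultimately show ?thesis using malcev_filt_iff[OF assms(1)] by simp
qed

text \<open>A primitive sequence for the preimage of the generator \<open>x\<close>; the same
  sequence represents it at all levels.\<close>

definition gen_seq :: "'x \<Rightarrow> nat \<Rightarrow> ('a \<Rightarrow>\<^sub>0 rat)" where
  "gen_seq x = (SOME f. f \<in> primitive_seqs G \<and> (\<forall>n. represents n (Poly_Mapping.single (Gen x) 1) f))"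

lemma gen_seq:
  assumes "x \<in> X"
  shows "gen_seq x \<in> primitive_seqs G" "represents n (Poly_Mapping.single (Gen x) 1) (gen_seq x)"
proof -
  let ?g = "Poly_Mapping.single (Gen x) (1::rat)"
  have "coherent (free_nonassoc X) (presented_filt X R) (\<lambda>_. ?g)"
    using assms by (auto simp: coherent_def free_nonassoc_def zero_in_presented_filt)
  then have "coset_seq (presented_filt X R) (\<lambda>_. ?g) \<in> lie_carrier (completed_presented_lie X R)"
    by (simp add: completed_presented_lie_simps presented.coset_seq_in_completion)
  also have "lie_carrier (completed_presented_lie X R) = \<phi> ` primitives G"
    using iso by (simp add: filtered_lie_iso_def bij_betw_def malcev_lie_simps)
  finally obtain z where "z \<in> primitives G" "\<phi> z = coset_seq (presented_filt X R) (\<lambda>_. ?g)"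
    by (metis imageE)
  then obtain f where "f \<in> primitive_seqs G" "\<phi> (malcev_of f) = coset_seq (presented_filt X R) (\<lambda>_. ?g)"
    by (auto simp: primitives_eq)
  then have "\<exists>f. f \<in> primitive_seqs G \<and> (\<forall>n. represents n ?g f)"
    by (auto simp: represents_def coset_seq_def mem_coset_iff zero_in_presented_filt)
  from someI_ex[OF this] show "gen_seq x \<in> primitive_seqs G" "represents n ?g (gen_seq x)"
    by (simp_all add: gen_seq_def)
qed

text \<open>Level 2 suffices because characters vanish on the square of the augmentation
  ideal.\<close>

definition gen_val :: "('a \<Rightarrow> real) \<Rightarrow> 'x \<Rightarrow> real" where
  "gen_val \<chi> x = real_ext \<chi> (gen_seq x 2)"

text \<open>Characters see only degree one on both sides. Removing the generators from
  \<open>h\<close> leaves trees with at least two leaves, and the filtered isomorphism carries these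
  into the square of the augmentation ideal.\<close>

lemma hom_eq_linear_part:
  assumes \<chi>: "\<And>g h. g \<in> carrier G \<Longrightarrow> h \<in> carrier G \<Longrightarrow> \<chi> (g \<otimes> h) = \<chi> g + \<chi> h"
    and f: "f \<in> primitive_seqs G" "represents 2 h f"
  shows "real_ext \<chi> (f 2) = real_ext (linear_part (gen_val \<chi>)) h"
proof -
  let ?K = "{t \<in> Poly_Mapping.keys h. leaves t = 1}"
  define gen :: "'x magma \<Rightarrow> 'x" where "gen t = (THE x. t = Gen x)" for t
  have gen: "t = Gen (gen t) \<and> gen t \<in> X" if "t \<in> ?K" for t
    using that represents_free[OF f] by (auto simp: leaves_eq_1_iff gen_def free_nonassoc_def qspace_def)
  let ?c = "Poly_Mapping.lookup h"
  \<comment> \<open>\<open>k\<close> is the degree one part of \<open>h\<close>, and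
    \<open>l\<close> the combination of generator preimages that it represents.\<close>
  define k where "k = (\<Sum>t\<in>?K. qscale (?c t) (Poly_Mapping.single (Gen (gen t)) 1))"
  define l where "l = (\<lambda>n. \<Sum>t\<in>?K. qscale (?c t) (gen_seq (gen t) n))"
  have l: "l \<in> primitive_seqs G" "represents 2 k l"
    unfolding l_def k_def
  proof -
    show "(\<lambda>n. \<Sum>t\<in>?K. qscale (?c t) (gen_seq (gen t) n)) \<in> primitive_seqs G"
      by (rule primitive_seqs_lincomb) (use gen gen_seq in simp)
    show "represents 2 (\<Sum>t\<in>?K. qscale (?c t) (Poly_Mapping.single (Gen (gen t)) 1))
        (\<lambda>n. \<Sum>t\<in>?K. qscale (?c t) (gen_seq (gen t) n))"
    proof (rule represents_lincomb)
      fix t assume "t \<in> ?K"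
      then have "gen t \<in> X" using gen by blast
      then show "gen_seq (gen t) \<in> primitive_seqs G"
        "represents 2 (Poly_Mapping.single (Gen (gen t)) 1) (gen_seq (gen t))"
        by (rule gen_seq)+
    qed simp
  qed
  have k_lookup: "k = (\<Sum>t\<in>?K. Poly_Mapping.single t (?c t))"
    unfolding k_def by (rule sum.cong) (use gen in auto)
  have "h = (\<Sum>t\<in>Poly_Mapping.keys h. Poly_Mapping.single t (?c t))"
    using poly_mapping_sum_single[of h] by simp
  also have "\<dots> = k + (\<Sum>t\<in>Poly_Mapping.keys h - ?K. Poly_Mapping.single t (?c t))"
    unfolding k_lookup by (subst sum.subset_diff[of ?K "Poly_Mapping.keys h"]) (auto simp: add.commute)
  finally have hk: "h - k = (\<Sum>t\<in>Poly_Mapping.keys h - ?K. Poly_Mapping.single t (?c t))"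
    by (simp add: algebra_simps)
  have "(\<Sum>t\<in>Poly_Mapping.keys h - ?K. Poly_Mapping.single t (?c t)) \<in>
      qspace {t. set_magma t \<subseteq> X \<and> 2 \<le> leaves t}"
  proof (rule qvs.subspace_sum[OF subspace_qspace], rule single_in_qspace)
    fix t assume "t \<in> Poly_Mapping.keys h - ?K"
    moreover have "leaves t \<noteq> 0" by simp
    ultimately show "t \<in> {t. set_magma t \<subseteq> X \<and> 2 \<le> leaves t}"
      using represents_free[OF f] by (auto simp: free_nonassoc_def qspace_def simp del: leaves_neq_0)
  qed
  then have hk2: "h - k \<in> presented_filt X R 2"
    unfolding hk presented_filt_def
    using set_plus_intro[OF qvs.subspace_0[OF subspace_relation_ideal]] by fastforce
  have "represents 2 (h - k) (\<lambda>n. f n - l n)"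
    using represents_add[OF f(1) primitive_seqs_scale[OF l(1)] f(2) represents_scale[OF l, of "-1"]]
    by simp
  with represents_filt_iff[OF primitive_seqs_diff[OF f(1) l(1)] this] hk2
  have "f 2 - l 2 \<in> augmentation_power G 2" by simp
  then have "real_ext \<chi> (f 2) = real_ext \<chi> (l 2)"
    using hom_vanishes_on_power_2[of \<chi> "f 2 - l 2", OF \<chi>] by (simp add: real_ext_diff)
  also have "\<dots> = real_ext (linear_part (gen_val \<chi>)) k"
    unfolding l_def k_def by (simp add: real_ext_sum real_ext_scale gen_val_def)
  also have "\<dots> = real_ext (linear_part (gen_val \<chi>)) h"
    using linear_part_presented_filt[OF quadratic hk2] by (simp add: real_ext_diff)
  finally show ?thesis .
qed

text \<open>A relator is zero in the presented Lie algebra, so the same combination of commutators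
  of generator preimages lies in the third power of the augmentation ideal, where \<open>u\<close>
  vanishes. On the commutator for \<open>x\<close> and \<open>y\<close> the value of
  \<open>u\<close> is \<open>v(x) w(y) - v(y) w(x)\<close>.\<close>

lemma derivation_kills_relators:
  assumes v: "\<And>g h. g \<in> carrier G \<Longrightarrow> h \<in> carrier G \<Longrightarrow> v (g \<otimes> h) = v g + v h"
    and w: "\<And>g h. g \<in> carrier G \<Longrightarrow> h \<in> carrier G \<Longrightarrow> w (g \<otimes> h) = w g + w h"
    and u: "\<And>g h. g \<in> carrier G \<Longrightarrow> h \<in> carrier G \<Longrightarrow> u (g \<otimes> h) = u g + u h + v g * w h"
    and r: "r \<in> R"
  shows "real_ext (derivation_part (gen_val v) (gen_val w) 1) r = 0"
proof -
  let ?c = "Poly_Mapping.lookup r" and ?K = "Poly_Mapping.keys r"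
  have "\<exists>x y. t = Node (Gen x) (Gen y) \<and> x \<in> X \<and> y \<in> X" if "t \<in> ?K" for t
  proof -
    have "leaves t = 2" "set_magma t \<subseteq> X" using that r quadratic by (auto simp: qspace_def)
    then show ?thesis
    proof (cases t)
      case (Node s s')
      then have "leaves s + leaves s' = 2" using \<open>leaves t = 2\<close> by simp
      moreover have "leaves s > 0" "leaves s' > 0" using leaves_neq_0 by (metis not_gr_zero)+
      ultimately have "leaves s = Suc 0" "leaves s' = Suc 0" by linarith+
      then show ?thesis using Node \<open>set_magma t \<subseteq> X\<close> by (auto simp: leaves_eq_1_iff)
    qed simp
  qed
  then obtain x y where xy: "\<And>t. t \<in> ?K \<Longrightarrow> t = Node (Gen (x t)) (Gen (y t)) \<and> x t \<in> X \<and> y t \<in> X"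
    by metis
  let ?f = "\<lambda>t n. conv_comm G (gen_seq (x t) n) (gen_seq (y t) n)"
  have f: "?f t \<in> primitive_seqs G" "represents 3 (Poly_Mapping.single t 1) (?f t)" if "t \<in> ?K" for t
  proof -
    have X: "x t \<in> X" "y t \<in> X" and t: "t = Node (Gen (x t)) (Gen (y t))" using xy[OF that] by auto
    show "?f t \<in> primitive_seqs G" by (intro primitive_seqs_bracket gen_seq X)
    have "represents 3 (nprod (Poly_Mapping.single (Gen (x t)) 1) (Poly_Mapping.single (Gen (y t)) 1)) (?f t)"
      by (intro represents_bracket gen_seq X)
    then show "represents 3 (Poly_Mapping.single t 1) (?f t)" using t by simp
  qed
  let ?s = "\<lambda>n. \<Sum>t\<in>?K. qscale (?c t) (?f t n)"
  have s: "?s \<in> primitive_seqs G" by (rule primitive_seqs_lincomb) (rule f)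
  have "represents 3 (\<Sum>t\<in>?K. qscale (?c t) (Poly_Mapping.single t 1)) ?s"
    by (rule represents_lincomb) (auto intro: f)
  then have "represents 3 r ?s" using poly_mapping_sum_single[of r] by simp
  with represents_filt_iff[OF s this] have "?s 3 \<in> augmentation_power G 3"
    using relators_in_presented_filt[OF r] by blast
  then have "0 = real_ext u (?s 3)"
    using quadratic_vanishes_on_power_3[of u v w, OF u w] by simp
  also have "\<dots> = (\<Sum>t\<in>?K. of_rat (?c t) * real_ext u (?f t 3))"
    by (simp add: real_ext_sum real_ext_scale)
  also have "\<dots> = (\<Sum>t\<in>?K. of_rat (?c t) * derivation_part (gen_val v) (gen_val w) 1 t)"
  proof (rule sum.cong[OF refl])
    fix t assume t: "t \<in> ?K"
    have X: "x t \<in> X" "y t \<in> X" and t': "t = Node (Gen (x t)) (Gen (y t))" using xy[OF t] by auto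
    have a: "gen_seq z 3 \<in> augmentation_ideal G" if "z \<in> X" for z
      by (rule primitive_seqs_augmentation[OF gen_seq(1)[OF that]]) simp
    \<comment> \<open>Levels 3 and 2 differ by an element of the square of the ideal, which
      characters do not see.\<close>
    have lev: "real_ext \<chi> (gen_seq z 3) = gen_val \<chi> z"
      if "z \<in> X" "\<And>g h. g \<in> carrier G \<Longrightarrow> h \<in> carrier G \<Longrightarrow> \<chi> (g \<otimes> h) = \<chi> g + \<chi> h" for \<chi> z
      using hom_vanishes_on_power_2[of \<chi>, OF that(2)
          primitive_seqs_level[OF gen_seq(1)[OF that(1)], of 2 3]]
      by (simp add: real_ext_diff gen_val_def)
    have q: "real_ext u (conv G f k) = real_ext v f * real_ext w k"
      if "f \<in> augmentation_ideal G" "k \<in> augmentation_ideal G" for f k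
      using that quadratic_conv[of u v w, OF u] by (simp add: augmentation_ideal_eq)
    have "real_ext u (?f t 3) = gen_val v (x t) * gen_val w (y t) - gen_val v (y t) * gen_val w (x t)"
      using X by (simp add: real_ext_diff q a lev v w)
    also have "\<dots> = derivation_part (gen_val v) (gen_val w) 1 t"
      by (subst t') (simp add: derivation_part_def)
    finally show "of_rat (?c t) * real_ext u (?f t 3) =
      of_rat (?c t) * derivation_part (gen_val v) (gen_val w) 1 t" by simp
  qed
  finally show ?thesis by (simp add: real_ext_def)
qed

end

text \<open>\<open>- u\<close> is a cochain bounding the cup product of \<open>v\<close> and
  \<open>w\<close>; \<open>w\<close> will be the constant coefficient of the cocycle.\<close>

locale massey_pair = quadratic_presentation +
  fixes v w u :: "'a \<Rightarrow> real"
  assumes v: "g \<in> carrier G \<Longrightarrow> h \<in> carrier G \<Longrightarrow> v (g \<otimes> h) = v g + v h"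
    and w: "g \<in> carrier G \<Longrightarrow> h \<in> carrier G \<Longrightarrow> w (g \<otimes> h) = w g + w h"
    and u: "g \<in> carrier G \<Longrightarrow> h \<in> carrier G \<Longrightarrow> u (g \<otimes> h) = u g + u h + v g * w h"
begin

abbreviation
  "part k \<equiv> real_ext (derivation_part (gen_val v) (gen_val w) k)"

text \<open>The translation part of the homomorphism to the affine Lie algebra over formal power
  series; its linear part is \<open>fps_X\<close> times \<open>v\<close>.\<close>

definition affine :: "(nat \<Rightarrow> ('a \<Rightarrow>\<^sub>0 rat)) \<Rightarrow> real fps" where
  "affine f = Abs_fps (\<lambda>k. part k (SOME h. represents (k + 2) h f))"

lemma part_filt: "f \<in> presented_filt X R n \<Longrightarrow> Suc k < n \<Longrightarrow> part k f = 0"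
  by (rule derivation_part_presented_filt[OF quadratic derivation_kills_relators[OF v w u]])

text \<open>Trees with \<open>k + 1\<close> leaves are still seen modulo
  \<open>presented_filt X R n\<close> once \<open>k + 1 < n\<close>, so every such level yields the
  same coefficient; \<open>n = k + 2\<close> is the first.\<close>

lemma affine_nth:
  assumes "f \<in> primitive_seqs G" "represents n h f" "Suc k < n"
  shows "fps_nth (affine f) k = part k h"
proof -
  have rep: "represents (k + 2) h f" using represents_antimono[OF assms(1,2)] assms(3) by simp
  then have "represents (k + 2) (SOME h. represents (k + 2) h f) f" by (rule someI)
  from represents_diff_mem[OF assms(1) this rep]
  have "part k ((SOME h. represents (k + 2) h f) - h) = 0" by (rule part_filt) simp
  then show ?thesis by (simp add: affine_def real_ext_diff)
qed

lemma affine_lincomb: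
  assumes "finite I" "\<And>i. i \<in> I \<Longrightarrow> f i \<in> primitive_seqs G"
  shows "affine (\<lambda>n. \<Sum>i\<in>I. qscale (c i) (f i n)) = (\<Sum>i\<in>I. fps_const (of_rat (c i)) * affine (f i))"
proof (rule fps_ext)
  fix k
  have "\<forall>i\<in>I. \<exists>h. represents (k + 2) h (f i)" using represents_ex assms(2) by blast
  then obtain h where h: "\<And>i. i \<in> I \<Longrightarrow> represents (k + 2) (h i) (f i)" by metis
  have "fps_nth (affine (\<lambda>n. \<Sum>i\<in>I. qscale (c i) (f i n))) k = part k (\<Sum>i\<in>I. qscale (c i) (h i))"
    by (rule affine_nth[OF primitive_seqs_lincomb represents_lincomb]) (use assms h in auto)
  also have "\<dots> = (\<Sum>i\<in>I. of_rat (c i) * fps_nth (affine (f i)) k)"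
    using affine_nth[OF assms(2) h] by (simp add: real_ext_sum real_ext_scale)
  finally show "fps_nth (affine (\<lambda>n. \<Sum>i\<in>I. qscale (c i) (f i n))) k =
    fps_nth (\<Sum>i\<in>I. fps_const (of_rat (c i)) * affine (f i)) k"
    by (simp add: fps_sum_nth)
qed

lemma affine_diff:
  assumes "f \<in> primitive_seqs G" "h \<in> primitive_seqs G"
  shows "affine (\<lambda>n. f n - h n) = affine f - affine h"
  using affine_lincomb[of "UNIV :: bool set" "\<lambda>b. if b then f else h" "\<lambda>b. if b then 1 else -1"] assms
  by (simp add: UNIV_bool add.commute flip: fps_const_neg)

lemma affine_filt:
  assumes "f \<in> primitive_seqs G" "f n \<in> augmentation_power G n" "Suc k < n"
  shows "fps_nth (affine f) k = 0"
proof -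
  obtain h where h: "represents n h f" using represents_ex[OF assms(1)] by blast
  then have "h \<in> presented_filt X R n" using represents_filt_iff[OF assms(1) h] assms(2) by simp
  then show ?thesis using affine_nth[OF assms(1) h assms(3)] part_filt assms(3) by simp
qed

lemma affine_cong:
  assumes "f \<in> primitive_seqs G" "h \<in> primitive_seqs G" "f n - h n \<in> augmentation_power G n" "Suc k < n"
  shows "fps_nth (affine f) k = fps_nth (affine h) k"
  using affine_filt[OF primitive_seqs_diff[OF assms(1,2)] _ assms(4)] assms
  by (simp add: affine_diff)

lemma affine_0:
  assumes "f \<in> primitive_seqs G" shows "fps_nth (affine f) 0 = real_ext w (f 2)"
proof -
  obtain h where h: "represents 2 h f" using represents_ex[OF assms] by blast
  show ?thesis
    using affine_nth[OF assms h, of 0] hom_eq_linear_part[of w, OF w assms h]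
    by (simp add: derivation_part_0)
qed

lemma affine_bracket:
  assumes "f \<in> primitive_seqs G" "h \<in> primitive_seqs G"
  shows "affine (\<lambda>n. conv_comm G (f n) (h n)) =
    fps_X * (fps_const (real_ext v (f 2)) * affine h - fps_const (real_ext v (h 2)) * affine f)"
proof (rule fps_ext)
  fix k
  obtain a where a: "represents (k + 2) a f" using represents_ex[OF assms(1)] by blast
  obtain b where b: "represents (k + 2) b h" using represents_ex[OF assms(2)] by blast
  have "fps_nth (affine (\<lambda>n. conv_comm G (f n) (h n))) k = part k (nprod a b)"
    by (rule affine_nth[OF primitive_seqs_bracket[OF assms] represents_bracket[OF assms a b]]) simp
  also have "\<dots> = fps_nth (fps_X * (fps_const (real_ext v (f 2)) * affine h -
      fps_const (real_ext v (h 2)) * affine f)) k"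
  proof (cases k)
    case 0
    then show ?thesis by (simp add: derivation_part_nprod_0)
  next
    case (Suc j)
    have "represents 2 a f" "represents 2 b h"
      using represents_antimono[OF assms(1) a, of 2] represents_antimono[OF assms(2) b, of 2] by simp_all
    then have "real_ext v (f 2) = real_ext (linear_part (gen_val v)) a"
      "real_ext v (h 2) = real_ext (linear_part (gen_val v)) b"
      using hom_eq_linear_part[of v, OF v] assms by blast+
    then show ?thesis
      using affine_nth[OF assms(1) a, of j] affine_nth[OF assms(2) b, of j] Suc
      by (simp add: derivation_part_nprod fps_X_mult_nth)
  qed
  finally show "fps_nth (affine (\<lambda>n. conv_comm G (f n) (h n))) k = \<dots>" .
qed

end

section \<open>The cocycle attached to two characters with trivial cup product\<close>

text \<open>The weights are characterised by rational polynomials; checking monomials carries the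
  identity over to real ones.\<close>

lemma real_coeff_weight:
  fixes p :: "real poly"
  assumes "degree p < N"
  shows "(\<Sum>m<N. of_rat (coeff_weight N k m) * poly p (of_nat m)) = coeff p k"
proof -
  have "(\<Sum>m<N. of_rat (coeff_weight N k m) * (of_nat m) ^ s) = (if s = k then 1 else 0 :: real)"
    if "s < N" for s
  proof -
    have "(\<Sum>m<N. coeff_weight N k m * poly (monom 1 s) (of_nat m)) = coeff (monom 1 s) k"
      by (rule coeff_weight) (use that in \<open>simp add: degree_monom_eq\<close>)
    then have "of_rat (\<Sum>m<N. coeff_weight N k m * of_nat m ^ s) = (of_rat (if s = k then 1 else 0) :: real)"
      by (simp add: poly_monom)
    then show ?thesis by (simp add: of_rat_sum of_rat_mult of_rat_power)
  qed
  moreover have "poly p x = (\<Sum>s<N. coeff p s * x ^ s)" for x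
    unfolding poly_altdef by (rule sum.mono_neutral_left) (use assms in \<open>auto simp: coeff_eq_0\<close>)
  ultimately have "(\<Sum>m<N. of_rat (coeff_weight N k m) * poly p (of_nat m)) =
    (\<Sum>s<N. coeff p s * (if s = k then 1 else 0))"
    by (simp add: sum_distrib_left, subst sum.swap)
       (simp add: mult.left_commute flip: sum_distrib_left)
  also have "\<dots> = coeff p k" using assms by (auto simp: coeff_eq_0 if_distrib cong: if_cong)
  finally show ?thesis .
qed

lemma real_poly_eqI_nat:
  fixes p q :: "real poly"
  assumes "\<And>m. poly p (of_nat m) = poly q (of_nat m)"
  shows "p = q"
proof (rule ccontr)
  assume "p \<noteq> q"
  then have "finite {x. poly (p - q) x = 0}" by (intro poly_roots_finite) simp
  moreover have "range of_nat \<subseteq> {x. poly (p - q) x = 0}" using assms by auto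
  ultimately have "finite (range (of_nat :: nat \<Rightarrow> real))" by (rule finite_subset[rotated])
  then have "finite (UNIV :: nat set)" by (rule finite_imageD) (simp add: inj_on_def)
  then show False by simp
qed

text \<open>The series (exp (a t) - 1) / (a t), given by its coefficients so that
  \<open>a = 0\<close> is included.\<close>

definition exp_quotient :: "real \<Rightarrow> real fps" where
  "exp_quotient a = Abs_fps (\<lambda>k. a ^ k / fact (Suc k))"

context massey_pair
begin

lemma real_ext_v_conj_seq:
  assumes "g \<in> carrier G" "f \<in> primitive_seqs G"
  shows "real_ext v (conj_seq G g f 2) = real_ext v (f 2)"
proof -
  have f: "f 2 \<in> group_algebra G" "real_ext (\<lambda>_. 1) (f 2) = 0"
    using primitive_seqs_augmentation[OF assms(2), of 2] by (auto simp: augmentation_ideal_eq)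
  have "real_ext v (conv G (f 2) (delta (inv g))) = real_ext v (f 2)"
    using hom_conv[of v "f 2" "delta (inv g)", OF v f(1)] f assms by simp
  moreover have "conv G (f 2) (delta (inv g)) \<in> group_algebra G"
    using f assms by (simp add: conv_closed)
  ultimately show ?thesis
    unfolding conj_seq_def
    using hom_conv[of v "delta g" "conv G (f 2) (delta (inv g))", OF v] f assms
    by (simp add: real_ext_one_bilin_ext)
qed

lemma real_ext_hom_log_seq:
  assumes g: "g \<in> carrier G"
    and \<chi>: "\<And>g h. g \<in> carrier G \<Longrightarrow> h \<in> carrier G \<Longrightarrow> \<chi> (g \<otimes> h) = \<chi> g + \<chi> h"
  shows "real_ext \<chi> (log_seq G g 2) = \<chi> g"
proof -
  have one: "\<chi> \<one> = 0" using \<chi>[of \<one> \<one>] by simp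
  have "\<chi> (g [^] m) = of_nat m * \<chi> g" for m :: nat
    by (induction m) (simp_all add: one g \<chi> algebra_simps)
  then have "real_ext \<chi> (log_seq G g 2) =
      of_rat (\<Sum>m<4. coeff_weight 4 (Suc 0) m * of_nat m) * \<chi> g"
    by (simp add: log_seq_def real_ext_sum of_rat_sum of_rat_mult sum_distrib_right mult.assoc)
  then show ?thesis using coeff_weight_sum_1[of 4] by simp
qed

text \<open>The j-th coefficient depends only on the level \<open>j + 2\<close>, where conjugation
  by \<open>g ^ m\<close> is polynomial of degree below \<open>j + 2\<close> in \<open>m\<close>.
  Hence the polynomial interpolating the first \<open>j + 2\<close> values is correct at every
  \<open>m\<close>.\<close>

lemma affine_conj_poly:
  assumes g: "g \<in> carrier G" and f: "f \<in> primitive_seqs G"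
  obtains p where "degree p < j + 2"
    "\<And>m. poly p (of_nat m) = fps_nth (affine (conj_seq G (g [^] m) f)) j"
proof -
  let ?n = "j + 2"
  let ?a = "\<lambda>m::nat. affine (conj_seq G (g [^] m) f)"
  define p where "p = (\<Sum>s<?n. monom (\<Sum>l<?n. of_rat (coeff_weight ?n s l) * fps_nth (?a l) j) s)"
  have "degree p < ?n"
    unfolding p_def by (intro degree_sum_less) (auto intro: le_less_trans[OF degree_monom_le])
  moreover have "poly p (of_nat m) = fps_nth (?a m) j" for m
  proof -
    let ?M = "{..<?n + Suc m}"
    \<comment> \<open>This is the value at \<open>m\<close> of the l-th Lagrange polynomial, so
      \<open>\<mu>\<close> is evaluation at \<open>m\<close> minus interpolation and annihilates
      polynomials of degree below \<open>j + 2\<close>.\<close>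
    define \<nu> where "\<nu> l = (\<Sum>s<?n. of_nat m ^ s * coeff_weight ?n s l)" for l
    define \<mu> where "\<mu> l = (if l = m then 1 else 0) - (if l < ?n then \<nu> l else 0)" for l
    \<comment> \<open>Stated over an arbitrary commutative ring because it is applied to the
      rational weights and to their real images.\<close>
    have split: "(\<Sum>l\<in>?M. \<mu>' l * x l) = x m - (\<Sum>l<?n. \<nu>' l * x l)"
      if "\<And>l. \<mu>' l = (if l = m then 1 else 0) - (if l < ?n then \<nu>' l else 0)"
      for x \<mu>' \<nu>' :: "nat \<Rightarrow> 'z::comm_ring_1"
    proof -
      have "(\<Sum>l\<in>?M. \<mu>' l * x l) =
          (\<Sum>l\<in>?M. if l = m then x m else 0) - (\<Sum>l\<in>?M. if l < ?n then \<nu>' l * x l else 0)"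
        unfolding sum_subtractf[symmetric] that by (intro sum.cong refl) (auto simp: left_diff_distrib)
      also have "(\<Sum>l\<in>?M. if l < ?n then \<nu>' l * x l else 0) = (\<Sum>l<?n. \<nu>' l * x l)"
        by (rule sum.mono_neutral_cong_right) auto
      finally show ?thesis by simp
    qed
    have "(\<Sum>l\<in>?M. \<mu> l * poly r (of_nat l)) = 0" if r: "degree r < ?n" for r :: "rat poly"
    proof -
      have "(\<Sum>l<?n. \<nu> l * poly r (of_nat l)) =
          (\<Sum>s<?n. of_nat m ^ s * (\<Sum>l<?n. coeff_weight ?n s l * poly r (of_nat l)))"
        unfolding \<nu>_def sum_distrib_left sum_distrib_right
        by (subst sum.swap) (simp add: mult.assoc)
      also have "\<dots> = (\<Sum>s<?n. of_nat m ^ s * coeff r s)"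
        by (simp only: coeff_weight[OF r])
      also have "\<dots> = poly r (of_nat m)"
        unfolding poly_altdef
        by (rule sum.mono_neutral_cong_right) (use r in \<open>auto simp: coeff_eq_0\<close>)
      finally show ?thesis using split[of \<mu> \<nu> "\<lambda>l. poly r (of_nat l)"] by (simp add: \<mu>_def)
    qed
    then have "(\<Sum>l\<in>?M. qscale (\<mu> l) (conj_seq G (g [^] l) f ?n)) \<in> augmentation_power G ?n"
      by (intro conj_seq_moment g f) auto
    then have "fps_nth (affine (\<lambda>n. \<Sum>l\<in>?M. qscale (\<mu> l) (conj_seq G (g [^] l) f n))) j = 0"
      by (intro affine_filt[of _ ?n] primitive_seqs_lincomb conj_seq_primitive f) (auto simp: g)
    then have "0 = (\<Sum>l\<in>?M. of_rat (\<mu> l) * fps_nth (?a l) j)"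
      by (subst (asm) affine_lincomb) (auto simp: fps_sum_nth g f conj_seq_primitive)
    also have "\<dots> = fps_nth (?a m) j - (\<Sum>l<?n. of_rat (\<nu> l) * fps_nth (?a l) j)"
      by (rule split) (auto simp: \<mu>_def of_rat_diff)
    also have "(\<Sum>l<?n. of_rat (\<nu> l) * fps_nth (?a l) j) = poly p (of_nat m)"
      unfolding \<nu>_def p_def poly_sum poly_monom of_rat_sum of_rat_mult of_rat_power of_rat_of_nat_eq
        sum_distrib_right
      by (subst sum.swap) (simp add: mult_ac)
    finally show ?thesis by simp
  qed
  ultimately show thesis by (rule that)
qed

text \<open>The action of exp (ad (log g)) on translation parts. The coefficients of conjugation by
  \<open>g ^ m\<close> are polynomials \<open>P j\<close> in \<open>m\<close>; bracketing with
  \<open>log g\<close> differentiates them, which gives a triangular system of differential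
  equations with known values at \<open>m = 0\<close>. Its solution is evaluated at
  \<open>m = 1\<close>.\<close>

lemma affine_conj:
  assumes g: "g \<in> carrier G" and f: "f \<in> primitive_seqs G"
  shows "affine (conj_seq G g f) = fps_exp (v g) * affine f -
    fps_const (real_ext v (f 2)) * (fps_X * (exp_quotient (v g) * affine (log_seq G g)))"
proof -
  let ?a = "v g" and ?y = "real_ext v (f 2)" and ?l = "log_seq G g"
  let ?b = "\<lambda>j. fps_nth (affine f) j" and ?B = "\<lambda>j. fps_nth (affine ?l) j"
  let ?c = "\<lambda>m::nat. conj_seq G (g [^] m) f"
  have "\<forall>j. \<exists>p. degree p < j + 2 \<and> (\<forall>m. poly p (of_nat m) = fps_nth (affine (?c m)) j)"
    using affine_conj_poly[OF g f] by metis
  then obtain P where P: "\<And>j. degree (P j) < j + 2"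
    "\<And>j m. poly (P j) (of_nat m) = fps_nth (affine (?c m)) j" by metis
  have l: "?l \<in> primitive_seqs G" by (rule log_seq_primitive[OF g])
  have c: "?c m \<in> primitive_seqs G" for m by (rule conj_seq_primitive[OF _ f]) (simp add: g)
  \<comment> \<open>Conjugation by \<open>g ^ (m + i)\<close> is conjugation by \<open>g ^ i\<close>
    after that by \<open>g ^ m\<close>, so the derivative at \<open>i = 0\<close> is the derivative
    of \<open>P j\<close> at \<open>m\<close>. The value of \<open>v\<close> on the conjugates stays
    constant, which keeps the equation linear with constant coefficients.\<close>
  have ode: "fps_nth (fps_X * (fps_const ?a * affine (?c m) - fps_const ?y * affine ?l)) j =
      poly (pderiv (P j)) (of_nat m)" for j m
  proof -
    let ?n = "j + 2"
    let ?N = "?n + 2"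
    have cc: "conj_seq G (g [^] i) (?c m) = ?c (m + i)" for i
      using conj_seq_mult[of "g [^] i" "g [^] m" f] g f by (simp add: nat_pow_mult add.commute)
    have "affine (\<lambda>n. conv_comm G (?l n) (?c m n)) =
        fps_X * (fps_const ?a * affine (?c m) - fps_const ?y * affine ?l)"
      using affine_bracket[OF l c] real_ext_hom_log_seq[OF g v] real_ext_v_conj_seq[OF _ f] g by simp
    moreover have "fps_nth (affine (\<lambda>n. conv_comm G (?l n) (?c m n))) j =
        fps_nth (affine (\<lambda>n. \<Sum>i<?N. qscale (coeff_weight ?N (Suc 0) i) (?c (m + i) n))) j"
    proof (rule affine_cong)
      show "conv_comm G (?l ?n) (?c m ?n) -
          (\<Sum>i<?N. qscale (coeff_weight ?N (Suc 0) i) (?c (m + i) ?n)) \<in> augmentation_power G ?n"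
        using log_seq_bracket[OF g c, of ?n m] by (simp add: cc)
      show "(\<lambda>n. conv_comm G (?l n) (?c m n)) \<in> primitive_seqs G"
        by (rule primitive_seqs_bracket[OF l c])
      show "(\<lambda>n. \<Sum>i<?N. qscale (coeff_weight ?N (Suc 0) i) (?c (m + i) n)) \<in> primitive_seqs G"
        by (rule primitive_seqs_lincomb[OF c])
    qed simp
    moreover have "fps_nth (affine (\<lambda>n. \<Sum>i<?N. qscale (coeff_weight ?N (Suc 0) i) (?c (m + i) n))) j =
        (\<Sum>i<?N. of_rat (coeff_weight ?N (Suc 0) i) * poly (pcompose (P j) [:of_nat m, 1:]) (of_nat i))"
      using P(2)[of j] by (subst affine_lincomb) (auto simp: c fps_sum_nth poly_pcompose simp flip: of_nat_add)
    moreover have "\<dots> = coeff (pcompose (P j) [:of_nat m, 1:]) (Suc 0)"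
      by (rule real_coeff_weight) (use P(1)[of j] in \<open>simp add: degree_pcompose\<close>)
    moreover have "\<dots> = poly (pderiv (P j)) (of_nat m)"
    proof -
      have "coeff q (Suc 0) = poly (pderiv q) 0" for q :: "real poly"
        by (simp add: poly_0_coeff_0 coeff_pderiv)
      then show ?thesis by (simp add: pderiv_pcompose poly_pcompose pderiv_pCons)
    qed
    ultimately show ?thesis by simp
  qed
  have P0: "pderiv (P 0) = 0"
    by (rule real_poly_eqI_nat) (simp flip: ode)
  have PS: "pderiv (P (Suc j)) = smult ?a (P j) - [:?y * ?B j:]" for j
    by (rule real_poly_eqI_nat) (simp add: P(2) flip: ode)
  have co0: "coeff (P j) 0 = ?b j" for j
  proof -
    have "coeff (P j) 0 = poly (P j) (of_nat 0)" by (simp add: poly_0_coeff_0)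
    also have "?c 0 = f"
      by (rule ext) (simp add: conj_seq_def conv_one_left conv_one_right primitive_seqs_carrier[OF f])
    then have "poly (P j) (of_nat 0) = ?b j" unfolding P(2) by simp
    finally show ?thesis .
  qed
  \<comment> \<open>Repeated integration of \<open>PS\<close>. All coefficients beyond degree
    \<open>j\<close> vanish, one degree better than the bound from interpolation.\<close>
  have co: "coeff (P j) (Suc k) = (if k < j then
      ?a ^ Suc k / fact (Suc k) * ?b (j - Suc k) - ?y * (?a ^ k / fact (Suc k) * ?B (j - Suc k)) else 0)"
    for j k
  proof (induction k arbitrary: j)
    case 0
    show ?case
    proof (cases j)
      case 0
      then show ?thesis using arg_cong[OF P0, of "\<lambda>p. coeff p 0"] by (simp add: coeff_pderiv)
    next
      case (Suc i)
      then show ?thesis using arg_cong[OF PS[of i], of "\<lambda>p. coeff p 0"]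
        by (simp add: coeff_pderiv co0)
    qed
  next
    case (Suc k)
    show ?case
    proof (cases j)
      case 0
      then show ?thesis using arg_cong[OF P0, of "\<lambda>p. coeff p (Suc k)"] by (simp add: coeff_pderiv)
    next
      case j: (Suc i)
      have "of_nat (Suc (Suc k)) * coeff (P j) (Suc (Suc k)) = ?a * coeff (P i) (Suc k)"
        using arg_cong[OF PS[of i], of "\<lambda>p. coeff p (Suc k)"]
        unfolding j by (simp add: coeff_pderiv del: of_nat_Suc)
      then have "coeff (P j) (Suc (Suc k)) = ?a * coeff (P i) (Suc k) / of_nat (Suc (Suc k))"
        by (simp add: nonzero_eq_divide_eq mult.commute del: of_nat_Suc)
      then show ?thesis
        unfolding Suc.IH j fact_Suc[of "Suc k"]
        by (cases "k < i") (simp_all add: field_simps del: of_nat_Suc fact_Suc)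
    qed
  qed
  show ?thesis
  proof (rule fps_ext)
    fix j
    have "fps_nth (affine (conj_seq G g f)) j = poly (P j) (of_nat 1)"
      unfolding P(2) using g by simp
    also have "\<dots> = (\<Sum>k\<le>j. coeff (P j) k)"
    proof -
      have "coeff (P j) k = 0" if "k > j" for k using co[of j "k - 1"] that by (cases k) auto
      then have "degree (P j) \<le> j" by (simp add: degree_le)
      then show ?thesis
        unfolding poly_altdef by (simp, intro sum.mono_neutral_left) (auto simp: coeff_eq_0)
    qed
    also have "\<dots> = ?b j + (\<Sum>k<j. coeff (P j) (Suc k))"
      by (simp add: sum.atMost_shift co0)
    also have "(\<Sum>k<j. coeff (P j) (Suc k)) = (\<Sum>k<j. ?a ^ Suc k / fact (Suc k) * ?b (j - Suc k)) -
        ?y * (\<Sum>k<j. ?a ^ k / fact (Suc k) * ?B (j - Suc k))"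
      by (simp add: co sum_subtractf sum_distrib_left)
    also have "?b j + ((\<Sum>k<j. ?a ^ Suc k / fact (Suc k) * ?b (j - Suc k)) -
        ?y * (\<Sum>k<j. ?a ^ k / fact (Suc k) * ?B (j - Suc k))) =
      (\<Sum>k\<le>j. ?a ^ k / fact k * ?b (j - k)) - ?y * (\<Sum>k<j. ?a ^ k / fact (Suc k) * ?B (j - Suc k))"
      by (simp add: sum.atMost_shift)
    also have "(\<Sum>k\<le>j. ?a ^ k / fact k * ?b (j - k)) = fps_nth (fps_exp ?a * affine f) j"
      by (simp add: fps_mult_nth atLeast0AtMost)
    also have "(\<Sum>k<j. ?a ^ k / fact (Suc k) * ?B (j - Suc k)) =
        fps_nth (fps_X * (exp_quotient ?a * affine ?l)) j"
    proof (cases j)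
      case (Suc i)
      have "fps_nth (fps_X * (exp_quotient ?a * affine ?l)) j = fps_nth (exp_quotient ?a * affine ?l) i"
        using Suc by (simp add: fps_X_mult_nth)
      then show ?thesis
        using Suc by (simp add: fps_mult_nth exp_quotient_def atLeast0AtMost lessThan_Suc_atMost)
    qed simp
    finally show "fps_nth (affine (conj_seq G g f)) j = fps_nth (fps_exp ?a * affine f -
        fps_const ?y * (fps_X * (exp_quotient ?a * affine ?l))) j"
      by simp
  qed
qed

text \<open>Conjugation of \<open>log s\<close> by \<open>g \<otimes> h\<close> is computed at once
  and in two steps. The terms with \<open>affine (log_seq G s)\<close> agree and cancel; what
  remains is the cocycle identity times \<open>t v(s)\<close>, which is not a zero divisor.\<close>

theorem exponential_cocycle:
  assumes s: "s \<in> carrier G" "v s \<noteq> 0"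
  obtains c where
    "\<And>g h. g \<in> carrier G \<Longrightarrow> h \<in> carrier G \<Longrightarrow> c (g \<otimes> h) = c g + fps_exp (v g) * c h"
    "\<And>g. g \<in> carrier G \<Longrightarrow> fps_nth (c g) 0 = w g"
proof
  define c where "c g = exp_quotient (v g) * affine (log_seq G g)" for g
  fix g assume g: "g \<in> carrier G"
  show "fps_nth (exp_quotient (v g) * affine (log_seq G g)) 0 = w g"
    using affine_0[OF log_seq_primitive[OF g]] real_ext_hom_log_seq[OF g w]
    by (simp add: exp_quotient_def)
  fix h assume h: "h \<in> carrier G"
  let ?f = "log_seq G s"
  have f: "?f \<in> primitive_seqs G" by (rule log_seq_primitive[OF s(1)])
  have y: "real_ext v (?f 2) = v s" by (rule real_ext_hom_log_seq[OF s(1) v])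
  have "fps_exp (v g + v h) * affine ?f - fps_const (v s) * (fps_X * c (g \<otimes> h)) =
      affine (conj_seq G (g \<otimes> h) ?f)"
    using affine_conj[OF _ f, of "g \<otimes> h"] g h y by (simp add: c_def v)
  also have "\<dots> = fps_exp (v g) * affine (conj_seq G h ?f) - fps_const (v s) * (fps_X * c g)"
    unfolding conj_seq_mult[OF g h f]
    using affine_conj[OF g conj_seq_primitive[OF h f]] real_ext_v_conj_seq[OF h f] y by (simp add: c_def)
  also have "affine (conj_seq G h ?f) = fps_exp (v h) * affine ?f - fps_const (v s) * (fps_X * c h)"
    using affine_conj[OF h f] y by (simp add: c_def)
  finally have "(fps_const (v s) * fps_X) * c (g \<otimes> h) = (fps_const (v s) * fps_X) * (c g + fps_exp (v g) * c h)"
    by (simp add: fps_exp_add_mult algebra_simps)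
  moreover have "fps_const (v s) * fps_X \<noteq> 0" using s by simp
  ultimately show "exp_quotient (v (g \<otimes> h)) * affine (log_seq G (g \<otimes> h)) =
      exp_quotient (v g) * affine (log_seq G g) +
      fps_exp (v g) * (exp_quotient (v h) * affine (log_seq G h))"
    unfolding c_def mult_cancel_left by blast
qed

end

section \<open>Exponential cocycles and their determinantal equations\<close>

text \<open>A nonsingular matrix whose first \<open>m\<close> rows belong to the family is improved row by row:
  the cofactors along row \<open>m\<close> form a common kernel vector unless some row of the family can
  replace row \<open>m\<close>.\<close>

lemma common_kernel_vector:
  fixes rows :: "(nat \<Rightarrow> 'k::idom) set"
  shows "(\<exists>x. (\<exists>i<n. x i \<noteq> 0) \<and> (\<forall>r\<in>rows. (\<Sum>i<n. r i * x i) = 0)) \<longleftrightarrow>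
    (\<forall>\<rho>. (\<forall>k<n. \<rho> k \<in> rows) \<longrightarrow> det (mat n n (\<lambda>(k, i). \<rho> k i)) = 0)"
proof safe
  fix x i \<rho> assume x: "i < n" "x i \<noteq> 0" "\<forall>r\<in>rows. (\<Sum>i<n. r i * x i) = 0" and \<rho>: "\<forall>k<n. \<rho> k \<in> rows"
  let ?M = "mat n n (\<lambda>(k, i). \<rho> k i)"
  have "vec n x \<noteq> 0\<^sub>v n" using x by (auto simp: vec_eq_iff)
  moreover have "?M *\<^sub>v vec n x = 0\<^sub>v n"
    using x \<rho> by (intro eq_vecI) (auto simp: scalar_prod_def atLeast0LessThan)
  ultimately show "det ?M = 0"
    using det_0_iff_vec_prod_zero[of ?M n] by (auto intro!: exI[of _ "vec n x"])
next
  assume *: "\<forall>\<rho>. (\<forall>k<n. \<rho> k \<in> rows) \<longrightarrow> det (mat n n (\<lambda>(k, i). \<rho> k i)) = 0"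
  let ?E = "\<exists>x. (\<exists>i<n. x i \<noteq> 0) \<and> (\<forall>r\<in>rows. (\<Sum>i<n. r i * x i) = 0)"
  have "?E \<or> (\<exists>\<rho>. (\<forall>k<m. \<rho> k \<in> rows) \<and> det (mat n n (\<lambda>(k, i). \<rho> k i)) \<noteq> 0)" if "m \<le> n" for m
    using that
  proof (induction m)
    case 0
    have "mat n n (\<lambda>(k, i). if k = i then 1 else 0) = (1\<^sub>m n :: 'k mat)"
      by (rule eq_matI) auto
    then have "det (mat n n (\<lambda>(k, i). if k = i then 1 else 0) :: 'k mat) \<noteq> 0" by simp
    then show ?case by (intro disjI2 exI[of _ "\<lambda>k i. if k = i then 1 else 0"]) simp
  next
    case (Suc m)
    then have "?E \<or> (\<exists>\<rho>. (\<forall>k<m. \<rho> k \<in> rows) \<and> det (mat n n (\<lambda>(k, i). \<rho> k i)) \<noteq> 0)"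
      by simp
    then show ?case
    proof (elim disjE[of ?E] exE[of "\<lambda>\<rho>. (\<forall>k<m. \<rho> k \<in> rows) \<and> det (mat n n (\<lambda>(k, i). \<rho> k i)) \<noteq> 0"] conjE)
      fix \<rho> assume \<rho>: "\<forall>k<m. \<rho> k \<in> rows" "det (mat n n (\<lambda>(k, i). \<rho> k i)) \<noteq> 0"
      let ?M = "\<lambda>\<rho>. mat n n (\<lambda>(k, i). \<rho> k i)"
      define x where "x i = cofactor (?M \<rho>) m i" for i
      have expand: "det (?M (\<rho>(m := r))) = (\<Sum>i<n. r i * x i)" for r
      proof -
        have "mat_delete (?M (\<rho>(m := r))) m i = mat_delete (?M \<rho>) m i" for i
          by (rule eq_matI) (auto simp: mat_delete_def)
        moreover have "det (?M (\<rho>(m := r))) =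
            (\<Sum>i<n. ?M (\<rho>(m := r)) $$ (m, i) * cofactor (?M (\<rho>(m := r))) m i)"
          by (rule laplace_expansion_row) (use Suc.prems in auto)
        ultimately show ?thesis
          using Suc.prems by (simp add: x_def cofactor_def)
      qed
      show ?thesis
      proof (cases "\<forall>r\<in>rows. (\<Sum>i<n. r i * x i) = 0")
        case True
        \<comment> \<open>Pairing the cofactors with the old row \<open>m\<close> returns the
          nonzero determinant, so the cofactor vector is not zero.\<close>
        have "(\<Sum>i<n. \<rho> m i * x i) \<noteq> 0" using expand[of "\<rho> m"] \<rho>(2) by simp
        then obtain i where "i < n" "x i \<noteq> 0" by (metis (no_types, lifting) lessThan_iff mult_zero_right sum.neutral)
        with True show ?thesis by (intro disjI1 exI[of _ x]) auto
      next
        case False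
        then obtain r where r: "r \<in> rows" "(\<Sum>i<n. r i * x i) \<noteq> 0" by blast
        then have "det (?M (\<rho>(m := r))) \<noteq> 0" using expand by simp
        moreover have "\<forall>k<Suc m. (\<rho>(m := r)) k \<in> rows" using \<rho>(1) r by (simp add: less_Suc_eq)
        ultimately show ?thesis by (intro disjI2 exI conjI)
      qed
    qed simp
  qed
  then show ?E
  proof (rule disjE[OF _ _ exE])
    fix \<rho> assume "(\<forall>k<n. \<rho> k \<in> rows) \<and> det (mat n n (\<lambda>(k, i). \<rho> k i)) \<noteq> 0"
    with *[rule_format, of \<rho>] show ?E by simp
  qed simp_all
qed

text \<open>The k-th coefficients give the power sums of the exponents, hence arbitrary polynomial
  test functions; the polynomial vanishing at all other exponents isolates
  \<open>a l\<close>.\<close>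

lemma fps_exp_linear_independent:
  fixes a :: "real \<Rightarrow> real"
  assumes "finite \<Lambda>" "(\<Sum>l\<in>\<Lambda>. fps_const (a l) * fps_exp l) = 0" "l \<in> \<Lambda>"
  shows "a l = 0"
proof -
  have "(\<Sum>l\<in>\<Lambda>. a l * l ^ k) = 0" for k
  proof -
    have "(\<Sum>l\<in>\<Lambda>. a l * l ^ k / fact k) = 0"
      using arg_cong[OF assms(2), of "\<lambda>f. fps_nth f k"] by (simp add: fps_sum_nth)
    then have "(\<Sum>l\<in>\<Lambda>. a l * l ^ k) / fact k = 0" by (simp add: sum_divide_distrib)
    then show ?thesis by simp
  qed
  then have poly0: "(\<Sum>l\<in>\<Lambda>. a l * poly p l) = 0" for p
    unfolding poly_altdef sum_distrib_left
    by (subst sum.swap) (simp add: mult.left_commute[of "a _"] flip: sum_distrib_left)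
  define p where "p = (\<Prod>m\<in>\<Lambda> - {l}. [:- m, 1:])"
  have "poly p m = 0" if "m \<in> \<Lambda>" "m \<noteq> l" for m
    using that assms(1) by (auto simp: p_def poly_prod)
  then have "(\<Sum>m\<in>\<Lambda>. a m * poly p m) = (\<Sum>m\<in>{l}. a m * poly p m)"
    by (intro sum.mono_neutral_right) (use assms in auto)
  moreover have "poly p l \<noteq> 0" using assms(1) by (auto simp: p_def poly_prod)
  ultimately show ?thesis using poly0[of p] by simp
qed

section \<open>Exponential polynomials in a variable character\<close>

lemma fps_const_sum: "fps_const (\<Sum>i\<in>I. a i) = (\<Sum>i\<in>I. fps_const (a i))"
  by (induction I rule: infinite_finite_induct) (simp_all flip: fps_const_add)

definition exp_cocycle :: "('a, 'm) monoid_scheme \<Rightarrow> ('a \<Rightarrow> real) \<Rightarrow> ('a \<Rightarrow> real fps) \<Rightarrow> bool" where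
  "exp_cocycle G v c \<longleftrightarrow>
    (\<forall>g\<in>carrier G. \<forall>h\<in>carrier G. c (g \<otimes>\<^bsub>G\<^esub> h) = c g + fps_exp (v g) * c h)"

text \<open>Generated by closure rules rather than given as combinations, so that Fox derivatives
  and determinants belong to it by construction; explicit combinations return on characters
  only.\<close>

inductive_set exp_polys :: "('a, 'm) monoid_scheme \<Rightarrow> (('a \<Rightarrow> real) \<Rightarrow> real fps) set"
  for G :: "('a, 'm) monoid_scheme" where
  exp: "g \<in> carrier G \<Longrightarrow> (\<lambda>v. fps_exp (v g)) \<in> exp_polys G"
| const: "(\<lambda>v. fps_const a) \<in> exp_polys G"
| add: "F \<in> exp_polys G \<Longrightarrow> F' \<in> exp_polys G \<Longrightarrow> (\<lambda>v. F v + F' v) \<in> exp_polys G"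
| mult: "F \<in> exp_polys G \<Longrightarrow> F' \<in> exp_polys G \<Longrightarrow> (\<lambda>v. F v * F' v) \<in> exp_polys G"

lemma exp_polys_0: "(\<lambda>v. 0) \<in> exp_polys G" and exp_polys_1: "(\<lambda>v. 1) \<in> exp_polys G"
  using exp_polys.const[of 0 G] exp_polys.const[of 1 G] by simp_all

lemma exp_polys_uminus: "F \<in> exp_polys G \<Longrightarrow> (\<lambda>v. - F v) \<in> exp_polys G"
  using exp_polys.mult[OF exp_polys.const[of "-1"]] by (simp flip: fps_const_neg)

lemma exp_polys_diff: "F \<in> exp_polys G \<Longrightarrow> F' \<in> exp_polys G \<Longrightarrow> (\<lambda>v. F v - F' v) \<in> exp_polys G"
  using exp_polys.add[OF _ exp_polys_uminus, of F G F'] by simp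

lemma exp_polys_sum:
  "(\<And>i. i \<in> I \<Longrightarrow> F i \<in> exp_polys G) \<Longrightarrow> (\<lambda>v. \<Sum>i\<in>I. F i v) \<in> exp_polys G"
  by (induction I rule: infinite_finite_induct) (auto intro: exp_polys_0 exp_polys.add)

lemma exp_polys_prod:
  "(\<And>i. i \<in> I \<Longrightarrow> F i \<in> exp_polys G) \<Longrightarrow> (\<lambda>v. \<Prod>i\<in>I. F i v) \<in> exp_polys G"
  by (induction I rule: infinite_finite_induct) (auto intro: exp_polys_1 exp_polys.mult)

lemma exp_polys_det:
  assumes "\<And>k i. k < n \<Longrightarrow> i < n \<Longrightarrow> F k i \<in> exp_polys G"
  shows "(\<lambda>v. det (mat n n (\<lambda>(k, i). F k i v))) \<in> exp_polys G"
proof -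
  have "(\<lambda>v. \<Sum>p | p permutes {0..<n}. signof p * (\<Prod>i = 0..<n. F i (p i) v)) \<in> exp_polys G"
  proof (intro exp_polys_sum exp_polys.mult exp_polys_prod)
    fix p
    show "(\<lambda>v. signof p) \<in> exp_polys G"
      using exp_polys_uminus[OF exp_polys_1] exp_polys_1 by (auto simp: sign_def)
  next
    fix p i assume "p \<in> {p. p permutes {0..<n}}" "i \<in> {0..<n}"
    then show "F i (p i) \<in> exp_polys G"
      using permutes_in_image[of p "{0..<n}" i] by (intro assms) auto
  qed
  also have "(\<lambda>v. \<Sum>p | p permutes {0..<n}. signof p * (\<Prod>i = 0..<n. F i (p i) v)) =
      (\<lambda>v. det (mat n n (\<lambda>(k, i). F k i v)))"
    unfolding det_def by (intro ext) (auto intro!: sum.cong prod.cong dest: permutes_in_image)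
  finally show ?thesis .
qed

context group
begin

lemma H1_mult: "v \<in> H1 G \<Longrightarrow> g \<in> carrier G \<Longrightarrow> h \<in> carrier G \<Longrightarrow> v (g \<otimes> h) = v g + v h"
  by (auto simp: H1_def hom_def real_add_group_def)

lemma H1_one: "v \<in> H1 G \<Longrightarrow> v \<one> = 0"
  using H1_mult[of v \<one> \<one>] by simp

lemma H1_inv: "v \<in> H1 G \<Longrightarrow> g \<in> carrier G \<Longrightarrow> v (inv g) = - v g"
  using H1_mult[of v g "inv g"] by (simp add: H1_one)

text \<open>For a character, the exponentials of \<open>v g\<close> and \<open>v h\<close> multiply
  to that of \<open>v (g \<otimes> h)\<close>, so products of combinations are combinations. The
  elements and coefficients do not depend on \<open>v\<close>, which makes the zero set
  accessible.\<close>

lemma exp_polys_normal_form: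
  assumes "F \<in> exp_polys G"
  shows "\<exists>A a. finite A \<and> A \<subseteq> carrier G \<and>
    (\<forall>v\<in>H1 G. F v = (\<Sum>g\<in>A. fps_const (a g) * fps_exp (v g)))"
proof -
  \<comment> \<open>Several products may be the same group element; their coefficients are added
    up.\<close>
  have collect: "\<exists>A a. finite A \<and> A \<subseteq> carrier G \<and>
      (\<forall>v. (\<Sum>i\<in>I. fps_const (b i) * fps_exp (v (e i))) = (\<Sum>g\<in>A. fps_const (a g) * fps_exp (v g)))"
    if "finite I" "e ` I \<subseteq> carrier G" for I :: "('a \<times> 'a) set" and b :: "'a \<times> 'a \<Rightarrow> real" and e
  proof (intro exI conjI allI)
    fix v :: "'a \<Rightarrow> real"
    have "(\<Sum>i\<in>I. fps_const (b i) * fps_exp (v (e i))) =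
        (\<Sum>g\<in>e ` I. \<Sum>i | i \<in> I \<and> e i = g. fps_const (b i) * fps_exp (v (e i)))"
      by (rule sum.image_gen[OF that(1)])
    also have "\<dots> = (\<Sum>g\<in>e ` I. fps_const (\<Sum>i | i \<in> I \<and> e i = g. b i) * fps_exp (v g))"
      by (intro sum.cong refl) (simp add: sum_distrib_right fps_const_sum)
    finally show "(\<Sum>i\<in>I. fps_const (b i) * fps_exp (v (e i))) =
      (\<Sum>g\<in>e ` I. fps_const ((\<lambda>g. \<Sum>i | i \<in> I \<and> e i = g. b i) g) * fps_exp (v g))" .
  qed (use that in auto)
  show ?thesis
    using assms
  proof (induction rule: exp_polys.induct)
    case (exp g)
    then show ?case by (intro exI[of _ "{g}"] exI[of _ "\<lambda>_. 1"]) simp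
  next
    case (const a)
    then show ?case by (intro exI[of _ "{\<one>}"] exI[of _ "\<lambda>_. a"]) (simp add: H1_one)
  next
    case (add F F')
    from add.IH(1) obtain A a where A: "finite A" "A \<subseteq> carrier G"
      "\<And>v. v \<in> H1 G \<Longrightarrow> F v = (\<Sum>g\<in>A. fps_const (a g) * fps_exp (v g))"
      by (elim exE conjE) simp
    from add.IH(2) obtain B b where B: "finite B" "B \<subseteq> carrier G"
      "\<And>v. v \<in> H1 G \<Longrightarrow> F' v = (\<Sum>g\<in>B. fps_const (b g) * fps_exp (v g))"
      by (elim exE conjE) simp
    note * = A(1,2) B(1,2) A(3) B(3)
    have ext: "(\<Sum>g\<in>A. fps_const (a g) * fps_exp (v g)) =
        (\<Sum>g\<in>A \<union> B. fps_const (if g \<in> A then a g else 0) * fps_exp (v g))"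
      "(\<Sum>g\<in>B. fps_const (b g) * fps_exp (v g)) =
        (\<Sum>g\<in>A \<union> B. fps_const (if g \<in> B then b g else 0) * fps_exp (v g))" for v :: "'a \<Rightarrow> real"
      by (rule sum.mono_neutral_cong_left; use * in auto)+
    show ?case
    proof (intro exI[of _ "A \<union> B"] exI[of _ "\<lambda>g. (if g \<in> A then a g else 0) + (if g \<in> B then b g else 0)"]
        conjI ballI)
      fix v assume "v \<in> H1 G"
      then have "F v + F' v = (\<Sum>g\<in>A \<union> B. fps_const (if g \<in> A then a g else 0) * fps_exp (v g)) +
          (\<Sum>g\<in>A \<union> B. fps_const (if g \<in> B then b g else 0) * fps_exp (v g))"
        by (simp only: A(3) B(3) flip: ext)
      then show "F v + F' v = (\<Sum>g\<in>A \<union> B. fps_const ((if g \<in> A then a g else 0) +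
          (if g \<in> B then b g else 0)) * fps_exp (v g))"
        by (simp only: sum.distrib distrib_right fps_const_add[symmetric])
    qed (use * in auto)
  next
    case (mult F F')
    from mult.IH(1) obtain A a where A: "finite A" "A \<subseteq> carrier G"
      "\<And>v. v \<in> H1 G \<Longrightarrow> F v = (\<Sum>g\<in>A. fps_const (a g) * fps_exp (v g))"
      by (elim exE conjE) simp
    from mult.IH(2) obtain B b where B: "finite B" "B \<subseteq> carrier G"
      "\<And>v. v \<in> H1 G \<Longrightarrow> F' v = (\<Sum>g\<in>B. fps_const (b g) * fps_exp (v g))"
      by (elim exE conjE) simp
    note * = A(1,2) B(1,2) A(3) B(3)
    obtain C c where C: "finite C" "C \<subseteq> carrier G"
      "\<And>v. (\<Sum>i\<in>A \<times> B. fps_const ((\<lambda>(g, h). a g * b h) i) * fps_exp (v ((\<lambda>(g, h). g \<otimes> h) i))) =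
        (\<Sum>g\<in>C. fps_const (c g) * fps_exp (v g))"
    proof -
      have "finite (A \<times> B)" "(\<lambda>(g, h). g \<otimes> h) ` (A \<times> B) \<subseteq> carrier G" using * by auto
      from collect[OF this, of "\<lambda>(g, h). a g * b h"] show thesis
        using that by (elim exE conjE) simp
    qed
    have "F v * F' v = (\<Sum>g\<in>C. fps_const (c g) * fps_exp (v g))" if "v \<in> H1 G" for v
    proof -
      have "F v * F' v = (\<Sum>(g, h)\<in>A \<times> B. (fps_const (a g) * fps_exp (v g)) * (fps_const (b h) * fps_exp (v h)))"
        using *(5,6) that by (simp add: sum_product sum.cartesian_product)
      also have "\<dots> = (\<Sum>i\<in>A \<times> B. fps_const ((\<lambda>(g, h). a g * b h) i) * fps_exp (v ((\<lambda>(g, h). g \<otimes> h) i)))"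
      proof (rule sum.cong[OF refl], clarify)
        fix g h assume "g \<in> A" "h \<in> B"
        then have "v (g \<otimes> h) = v g + v h" using * that by (auto intro: H1_mult)
        then show "(fps_const (a g) * fps_exp (v g)) * (fps_const (b h) * fps_exp (v h)) =
          fps_const (a g * b h) * fps_exp (v (g \<otimes> h))"
          by (simp add: fps_exp_add_mult mult_ac flip: fps_const_mult)
      qed
      finally show ?thesis by (simp add: C(3))
    qed
    with C show ?case by (intro exI[of _ C] exI[of _ c]) simp
  qed
qed

section \<open>Cocycles determined by their values on generators\<close>

lemma exp_cocycle_one: "exp_cocycle G v c \<Longrightarrow> v \<in> H1 G \<Longrightarrow> c \<one> = 0"
  unfolding exp_cocycle_def using H1_one[of v] by (metis add_cancel_right_right fps_exp_0 mult_1 one_closed r_one)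

lemma exp_cocycle_mult:
  "exp_cocycle G v c \<Longrightarrow> g \<in> carrier G \<Longrightarrow> h \<in> carrier G \<Longrightarrow> c (g \<otimes> h) = c g + fps_exp (v g) * c h"
  by (simp add: exp_cocycle_def)

lemma exp_cocycle_inv:
  assumes "exp_cocycle G v c" "v \<in> H1 G" "g \<in> carrier G"
  shows "c (inv g) = - (fps_exp (v (inv g)) * c g)"
  using exp_cocycle_mult[OF assms(1), of "inv g" g] exp_cocycle_one[OF assms(1,2)] assms(3)
  by (simp add: eq_neg_iff_add_eq_0)

text \<open>\<open>D\<close> evaluates the Fox derivatives of a word for \<open>g\<close> at the character \<open>exp (t v)\<close>.\<close>

lemma exp_cocycle_fox_derivatives:
  assumes "set ss \<subseteq> carrier G" "g \<in> generate G (set ss)"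
  shows "\<exists>D. (\<forall>i<length ss. D i \<in> exp_polys G) \<and>
    (\<forall>v\<in>H1 G. \<forall>c. exp_cocycle G v c \<longrightarrow> c g = (\<Sum>i<length ss. D i v * c (ss ! i)))"
  using assms(2)
proof (induction rule: generate.induct)
  case one
  show ?case
    by (rule exI[of _ "\<lambda>_ _. 0"]) (auto simp: exp_polys_0 dest: exp_cocycle_one)
next
  case (incl s)
  then obtain j where j: "j < length ss" "ss ! j = s" by (auto simp: in_set_conv_nth)
  have "(\<Sum>i<length ss. (if i = j then 1 else 0) * c (ss ! i)) = c s" for c :: "'a \<Rightarrow> real fps"
    using j by (simp add: if_distrib[of "\<lambda>x. x * _"] cong: if_cong)
  then show ?case
    by (intro exI[of _ "\<lambda>i v. if i = j then 1 else 0"]) (auto simp: exp_polys_0 exp_polys_1)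
next
  case (inv s)
  then obtain j where j: "j < length ss" "ss ! j = s" by (auto simp: in_set_conv_nth)
  have s: "s \<in> carrier G" using inv assms by auto
  have "(\<Sum>i<length ss. (if i = j then - fps_exp (v (inv s)) else 0) * c (ss ! i)) =
      - (fps_exp (v (inv s)) * c s)" for c :: "'a \<Rightarrow> real fps" and v :: "'a \<Rightarrow> real"
    using j by (simp add: if_distrib[of "\<lambda>x. x * _"] cong: if_cong)
  moreover have "(\<lambda>v. if i = j then - fps_exp (v (inv s)) else 0) \<in> exp_polys G" for i
    using s by (cases "i = j") (auto intro: exp_polys_0 exp_polys_uminus[OF exp_polys.exp[of "inv s"]])
  ultimately show ?case
    using s by (intro exI[of _ "\<lambda>i v. if i = j then - fps_exp (v (inv s)) else 0"])
      (auto simp: exp_cocycle_inv)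
next
  case (eng g h)
  have gh: "g \<in> carrier G" "h \<in> carrier G"
    using eng.hyps generate_in_carrier[OF assms(1)] by auto
  from eng.IH(1) obtain D where D: "\<forall>i<length ss. D i \<in> exp_polys G"
    "\<And>v c. v \<in> H1 G \<Longrightarrow> exp_cocycle G v c \<Longrightarrow> c g = (\<Sum>i<length ss. D i v * c (ss ! i))"
    by (elim exE conjE) simp
  from eng.IH(2) obtain D' where D': "\<forall>i<length ss. D' i \<in> exp_polys G"
    "\<And>v c. v \<in> H1 G \<Longrightarrow> exp_cocycle G v c \<Longrightarrow> c h = (\<Sum>i<length ss. D' i v * c (ss ! i))"
    by (elim exE conjE) simp
  show ?case
  proof (intro exI[of _ "\<lambda>i v. D i v + fps_exp (v g) * D' i v"] conjI allI ballI impI)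
    fix i assume "i < length ss"
    then show "(\<lambda>v. D i v + fps_exp (v g) * D' i v) \<in> exp_polys G"
      using D(1) D'(1) gh by (intro exp_polys.add exp_polys.mult exp_polys.exp) auto
  next
    fix v c assume v: "v \<in> H1 G" and c: "exp_cocycle G v c"
    show "c (g \<otimes> h) = (\<Sum>i<length ss. (D i v + fps_exp (v g) * D' i v) * c (ss ! i))"
      unfolding exp_cocycle_mult[OF c gh] D(2)[OF v c] D'(2)[OF v c]
      by (simp add: distrib_right sum.distrib sum_distrib_left mult.assoc)
  qed
qed

text \<open>The unknowns are the values of a cocycle on the generators. There is one equation for
  each pair of group elements, possibly infinitely many, and still a nonzero solution is detected by
  square determinants.\<close>

lemma exp_cocycle_determinantal:
  assumes ss: "set ss \<subseteq> carrier G" "generate G (set ss) = carrier G" and s0: "s0 \<in> set ss"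
  obtains Z where "Z \<subseteq> exp_polys G"
    "\<And>v. v \<in> H1 G \<Longrightarrow> (\<exists>c. exp_cocycle G v c \<and> (\<exists>g\<in>carrier G. c g \<noteq> 0) \<and> c s0 = 0) \<longleftrightarrow>
      (\<forall>F\<in>Z. F v = 0)"
proof -
  let ?n = "length ss"
  obtain j0 where j0: "j0 < ?n" "ss ! j0 = s0" using s0 by (auto simp: in_set_conv_nth)
  have "\<forall>g\<in>carrier G. \<exists>D. (\<forall>i<?n. D i \<in> exp_polys G) \<and>
    (\<forall>v\<in>H1 G. \<forall>c. exp_cocycle G v c \<longrightarrow> c g = (\<Sum>i<?n. D i v * c (ss ! i)))"
    using exp_cocycle_fox_derivatives[OF ss(1)] ss(2) by blast
  from bchoice[OF this] obtain D where "\<forall>g\<in>carrier G. (\<forall>i<?n. D g i \<in> exp_polys G) \<and>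
    (\<forall>v\<in>H1 G. \<forall>c. exp_cocycle G v c \<longrightarrow> c g = (\<Sum>i<?n. D g i v * c (ss ! i)))"
    by (elim exE)
  then have D: "\<And>g i. g \<in> carrier G \<Longrightarrow> i < ?n \<Longrightarrow> D g i \<in> exp_polys G"
    "\<And>g v c. g \<in> carrier G \<Longrightarrow> v \<in> H1 G \<Longrightarrow> exp_cocycle G v c \<Longrightarrow> c g = (\<Sum>i<?n. D g i v * c (ss ! i))"
    by simp_all
  \<comment> \<open>In turn: the cocycle identity; the requirement that the chosen expansion
    \<open>D\<close> of a generator reproduces its unknown, so that a nonzero solution gives a
    nonzero cocycle; and the normalisation at \<open>s0\<close>.\<close>
  define rows :: "(nat \<Rightarrow> ('a \<Rightarrow> real) \<Rightarrow> real fps) set" where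
    "rows = {\<lambda>i v. D (g \<otimes> h) i v - (D g i v + fps_exp (v g) * D h i v) | g h.
        g \<in> carrier G \<and> h \<in> carrier G} \<union>
      {\<lambda>i v. D (ss ! j) i v - (if i = j then 1 else 0) | j. j < ?n} \<union>
      {\<lambda>i v. if i = j0 then 1 else 0}"
  have ind: "(\<lambda>v. if P then 1 else 0) \<in> exp_polys G" for P
    by (cases P) (auto intro: exp_polys_0 exp_polys_1)
  have mem: "ss ! j \<in> carrier G" if "j < ?n" for j using ss(1) that by auto
  have rows: "r i \<in> exp_polys G" if "r \<in> rows" "i < ?n" for r i
    using that unfolding rows_def
    by (auto intro!: exp_polys_diff exp_polys.add exp_polys.mult exp_polys.exp D(1) ind mem)
  let ?Z = "{\<lambda>v. det (mat ?n ?n (\<lambda>(k, i). \<rho> k i v)) | \<rho>. \<forall>k<?n. \<rho> k \<in> rows}"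
  have pick: "(\<Sum>i<?n. (if i = j then 1 else 0) * x i) = (x j :: real fps)" if "j < ?n" for x j
    using that by (simp add: if_distrib[of "\<lambda>x. x * _"] cong: if_cong)
  show thesis
  proof (rule that[of ?Z])
    show "?Z \<subseteq> exp_polys G" by (auto intro!: exp_polys_det rows)
    fix v assume v: "v \<in> H1 G"
    have "(\<exists>c. exp_cocycle G v c \<and> (\<exists>g\<in>carrier G. c g \<noteq> 0) \<and> c s0 = 0) \<longleftrightarrow>
      (\<exists>x. (\<exists>i<?n. x i \<noteq> 0) \<and> (\<forall>r\<in>rows. (\<Sum>i<?n. r i v * x i) = 0))"
    proof safe
      fix c g assume c: "exp_cocycle G v c" "g \<in> carrier G" "c g \<noteq> 0" "c s0 = 0"
      let ?x = "\<lambda>i. c (ss ! i)"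
      have "\<exists>i<?n. ?x i \<noteq> 0"
      proof (rule ccontr)
        assume "\<not> (\<exists>i<?n. ?x i \<noteq> 0)"
        then have "c g = 0" using D(2)[OF c(2) v c(1)] by simp
        with c show False by simp
      qed
      moreover have "(\<Sum>i<?n. r i v * ?x i) = 0" if "r \<in> rows" for r
        using that unfolding rows_def
      proof (elim UnE CollectE exE conjE singletonE; hypsubst)
        fix g h assume gh: "g \<in> carrier G" "h \<in> carrier G"
        have "(\<Sum>i<?n. (D (g \<otimes> h) i v - (D g i v + fps_exp (v g) * D h i v)) * ?x i) =
            c (g \<otimes> h) - (c g + fps_exp (v g) * c h)"
          using gh D(2)[OF _ v c(1)]
          by (simp add: algebra_simps sum.distrib sum_subtractf sum_distrib_left)
        then show "(\<Sum>i<?n. (D (g \<otimes> h) i v - (D g i v + fps_exp (v g) * D h i v)) * ?x i) = 0"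
          using gh exp_cocycle_mult[OF c(1)] by simp
      next
        fix j assume j: "j < ?n"
        then show "(\<Sum>i<?n. (D (ss ! j) i v - (if i = j then 1 else 0)) * ?x i) = 0"
          using D(2)[OF mem[OF j] v c(1)] by (simp add: left_diff_distrib sum_subtractf pick)
      next
        show "(\<Sum>i<?n. (if i = j0 then 1 else 0) * ?x i) = 0" using c j0 by (simp add: pick)
      qed
      ultimately show "\<exists>x. (\<exists>i<?n. x i \<noteq> 0) \<and> (\<forall>r\<in>rows. (\<Sum>i<?n. r i v * x i) = 0)"
        by (intro exI[of _ ?x]) simp
    next
      fix x j assume x: "j < ?n" "x j \<noteq> 0" "\<forall>r\<in>rows. (\<Sum>i<?n. r i v * x i) = 0"
      define c where "c g = (\<Sum>i<?n. D g i v * x i)" for g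
      have "exp_cocycle G v c"
        unfolding exp_cocycle_def
      proof (intro ballI)
        fix g h assume "g \<in> carrier G" "h \<in> carrier G"
        then have "(\<lambda>i v. D (g \<otimes> h) i v - (D g i v + fps_exp (v g) * D h i v)) \<in> rows"
          unfolding rows_def by blast
        from bspec[OF x(3) this] have "(\<Sum>i<?n. (D (g \<otimes> h) i v - (D g i v + fps_exp (v g) * D h i v)) * x i) = 0" by simp
        then show "c (g \<otimes> h) = c g + fps_exp (v g) * c h"
          by (simp add: c_def algebra_simps sum.distrib sum_subtractf sum_distrib_left)
      qed
      moreover have cj: "c (ss ! k) = x k" if "k < ?n" for k
      proof -
        have "(\<lambda>i v. D (ss ! k) i v - (if i = k then 1 else 0)) \<in> rows"
          unfolding rows_def using that by blast
        from bspec[OF x(3) this] have "(\<Sum>i<?n. (D (ss ! k) i v - (if i = k then 1 else 0)) * x i) = 0" by simp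
        then show ?thesis using that by (simp add: c_def left_diff_distrib sum_subtractf pick)
      qed
      moreover have "x j0 = 0"
      proof -
        have "(\<lambda>i v. if i = j0 then 1 else 0) \<in> rows" unfolding rows_def by blast
        from bspec[OF x(3) this] have "(\<Sum>i<?n. (if i = j0 then 1 else 0) * x i) = 0" by simp
        then show ?thesis using j0 by (simp add: pick)
      qed
      ultimately show "\<exists>c. exp_cocycle G v c \<and> (\<exists>g\<in>carrier G. c g \<noteq> 0) \<and> c s0 = 0"
        using x(1,2) j0 mem[OF x(1)] cj by (intro exI[of _ c] conjI bexI[of _ "ss ! j"]) auto
    qed
    also have "\<dots> \<longleftrightarrow> (\<exists>x. (\<exists>i<?n. x i \<noteq> 0) \<and> (\<forall>r\<in>(\<lambda>r i. r i v) ` rows. (\<Sum>i<?n. r i * x i) = 0))"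
      by simp
    also have "\<dots> \<longleftrightarrow> (\<forall>F\<in>?Z. F v = 0)"
      unfolding common_kernel_vector
    proof safe
      fix \<rho> assume *: "\<forall>\<rho>. (\<forall>k<?n. \<rho> k \<in> (\<lambda>r i. r i v) ` rows) \<longrightarrow> det (mat ?n ?n (\<lambda>(k, i). \<rho> k i)) = 0"
        and "\<forall>k<?n. \<rho> k \<in> rows"
      then show "det (mat ?n ?n (\<lambda>(k, i). \<rho> k i v)) = 0"
        using *[rule_format, of "\<lambda>k i. \<rho> k i v"] by auto
    next
      fix \<rho> assume *: "\<forall>F\<in>?Z. F v = 0" and "\<forall>k<?n. \<rho> k \<in> (\<lambda>r i. r i v) ` rows"
      then have "\<forall>k\<in>{..<?n}. \<exists>r. r \<in> rows \<and> \<rho> k = (\<lambda>i. r i v)" by auto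
      from bchoice[OF this] obtain \<sigma> where "\<forall>k\<in>{..<?n}. \<sigma> k \<in> rows \<and> \<rho> k = (\<lambda>i. \<sigma> k i v)"
        by (elim exE)
      then have \<sigma>: "\<And>k. k < ?n \<Longrightarrow> \<sigma> k \<in> rows \<and> \<rho> k = (\<lambda>i. \<sigma> k i v)" by simp
      then have "mat ?n ?n (\<lambda>(k, i). \<rho> k i) = mat ?n ?n (\<lambda>(k, i). \<sigma> k i v)"
        by (intro eq_matI) auto
      moreover have "(\<lambda>v. det (mat ?n ?n (\<lambda>(k, i). \<sigma> k i v))) \<in> ?Z" using \<sigma> by blast
      ultimately show "det (mat ?n ?n (\<lambda>(k, i). \<rho> k i)) = 0" using * by auto
    qed
    finally show "(\<exists>c. exp_cocycle G v c \<and> (\<exists>g\<in>carrier G. c g \<noteq> 0) \<and> c s0 = 0) \<longleftrightarrow> (\<forall>F\<in>?Z. F v = 0)" .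
  qed
qed

end

section \<open>Rational subspaces of characters\<close>

abbreviation rfun_scale :: "real \<Rightarrow> ('b \<Rightarrow> real) \<Rightarrow> 'b \<Rightarrow> real" where
  "rfun_scale c f \<equiv> (\<lambda>x. c * f x)"

lemma sum_fun_apply: "(\<Sum>i\<in>I. f i) x = (\<Sum>i\<in>I. f i x)"
  by (induction I rule: infinite_finite_induct) simp_all

text \<open>Subspaces are recorded by their equations. Equations of this form have integer
  coefficients, so the subspaces will be rational, and intersecting them means uniting sets of
  pairs.\<close>

definition equalizer :: "('a, 'm) monoid_scheme \<Rightarrow> ('a \<times> 'a) set \<Rightarrow> ('a \<Rightarrow> real) set" where
  "equalizer G P = {\<chi> \<in> H1 G. \<forall>(g, h)\<in>P. \<chi> g = \<chi> h}"

lemma equalizer_Un: "equalizer G (P \<union> Q) = equalizer G P \<inter> equalizer G Q"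
  by (auto simp: equalizer_def)

context group
begin

lemma H1_iff:
  "\<chi> \<in> H1 G \<longleftrightarrow> (\<forall>g\<in>carrier G. \<forall>h\<in>carrier G. \<chi> (g \<otimes> h) = \<chi> g + \<chi> h) \<and>
    (\<forall>g. g \<notin> carrier G \<longrightarrow> \<chi> g = 0)"
  by (auto simp: H1_def hom_def real_add_group_def)

lemma subspace_equalizer: "rfun.subspace (equalizer G P)"
  by (auto simp: rfun.subspace_def equalizer_def H1_iff distrib_left split: prod.splits)

lemma H1_eq_0:
  assumes "\<chi> \<in> H1 G" "S \<subseteq> carrier G" "\<And>s. s \<in> S \<Longrightarrow> \<chi> s = 0" "g \<in> generate G S"
  shows "\<chi> g = 0"
  using assms(4)
proof (induction rule: generate.induct)
  case (eng g h)
  then show ?case using H1_mult[OF assms(1)] generate_in_carrier[OF assms(2)] by simp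
next
  case (inv s)
  then show ?case using H1_inv[OF assms(1), of s] assms(2,3) by auto
qed (simp_all add: H1_one assms)

text \<open>Expanding the values of a character in a rational basis of the reals splits it into
  rational characters satisfying the same equations.\<close>

lemma rational_subspace_equalizer:
  assumes "finite S" "S \<subseteq> carrier G" "generate G S = carrier G"
  shows "rational_subspace G (equalizer G P)"
proof -
  interpret Q: vector_space "\<lambda>(q::rat) (x::real). of_rat q * x"
    by standard (simp_all add: algebra_simps of_rat_add of_rat_mult)
  define B where "B = Q.extend_basis {}"
  have B: "Q.independent B" "Q.span B = UNIV"
    unfolding B_def by (simp_all add: Q.independent_extend_basis Q.independent_empty)
  let ?L = "{\<chi> \<in> equalizer G P. \<forall>g. \<chi> g \<in> \<rat>}"
  have "\<chi> \<in> rfun.span ?L" if \<chi>: "\<chi> \<in> equalizer G P" for \<chi>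
  proof -
    have H: "\<chi> \<in> H1 G" using \<chi> by (simp add: equalizer_def)
    define r where "r b g = (of_rat (Q.representation B (\<chi> g) b) :: real)" for b g
    have "r b (g \<otimes> h) = r b g + r b h" if "g \<in> carrier G" "h \<in> carrier G" for b g h
      using that H1_mult[OF H that] B by (simp add: r_def Q.representation_add of_rat_add)
    moreover have "r b g = 0" if "g \<notin> carrier G" for b g
      using that H by (simp add: r_def H1_iff Q.representation_zero)
    ultimately have r_H1: "r b \<in> H1 G" for b by (simp add: H1_iff)
    then have r: "r b \<in> ?L" for b
      using \<chi> by (auto simp: equalizer_def r_def Rats_def)
    \<comment> \<open>Only finitely many basis elements matter: a coordinate character that vanishes
      on the generators is zero.\<close>
    define B' where "B' = (\<Union>s\<in>S. {b. Q.representation B (\<chi> s) b \<noteq> 0})"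
    have fin: "finite B'" unfolding B'_def using assms(1) Q.finite_representation by blast
    have zero: "r b g = 0" if "b \<notin> B'" for b g
    proof (cases "g \<in> carrier G")
      case True
      show ?thesis
        by (rule H1_eq_0[OF r_H1 assms(2)]) (use that True assms(3) in \<open>auto simp: B'_def r_def\<close>)
    qed (use r_H1 in \<open>simp add: H1_iff\<close>)
    have "\<chi> g = (\<Sum>b\<in>B'. b * r b g)" for g
    proof -
      have "\<chi> g = (\<Sum>b | Q.representation B (\<chi> g) b \<noteq> 0. of_rat (Q.representation B (\<chi> g) b) * b)"
        by (rule Q.sum_nonzero_representation_eq[symmetric]) (simp_all add: B)
      also have "\<dots> = (\<Sum>b\<in>B'. of_rat (Q.representation B (\<chi> g) b) * b)"
        by (rule sum.mono_neutral_left[OF fin]) (use zero in \<open>auto simp: r_def\<close>)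
      finally show ?thesis by (simp add: r_def mult.commute)
    qed
    then have "\<chi> = (\<Sum>b\<in>B'. rfun_scale b (r b))"
      by (auto simp: fun_eq_iff sum_fun_apply)
    also have "\<dots> \<in> rfun.span ?L"
      by (intro rfun.span_sum rfun.span_scale rfun.span_base r)
    finally show ?thesis .
  qed
  moreover have "rfun.span ?L \<subseteq> equalizer G P"
    by (rule rfun.span_minimal[OF _ subspace_equalizer]) auto
  ultimately show ?thesis
    unfolding rational_subspace_def using subspace_equalizer by (auto simp: equalizer_def)
qed

text \<open>Restriction to \<open>S\<close> embeds the characters into the functions supported on
  \<open>S\<close>, so independent characters remain independent in a finite-dimensional
  space.\<close>

lemma H1_finite_dimensional:
  assumes "finite S" "S \<subseteq> carrier G" "generate G S = carrier G"
  obtains T where "finite T" "H1 G \<subseteq> rfun.span T"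
proof -
  interpret pair: vector_space_pair "rfun_scale :: real \<Rightarrow> ('a \<Rightarrow> real) \<Rightarrow> 'a \<Rightarrow> real"
    "rfun_scale :: real \<Rightarrow> ('a \<Rightarrow> real) \<Rightarrow> 'a \<Rightarrow> real"
    by unfold_locales
  define \<rho> where "\<rho> f = (\<lambda>s. if s \<in> S then f s else 0)" for f :: "'a \<Rightarrow> real"
  have lin: "Vector_Spaces.linear rfun_scale rfun_scale \<rho>"
    by (auto simp: Vector_Spaces.linear_iff rfun.vector_space_axioms \<rho>_def fun_eq_iff)
  obtain B where B: "B \<subseteq> H1 G" "rfun.independent B" "H1 G \<subseteq> rfun.span B"
    using rfun.maximal_independent_subset by blast
  have "H1 G = equalizer G {}" by (simp add: equalizer_def)
  then have H1: "rfun.subspace (H1 G)" using subspace_equalizer[of "{}"] by simp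
  have "inj_on \<rho> (H1 G)"
  proof (rule inj_onI)
    fix \<chi> \<psi> assume *: "\<chi> \<in> H1 G" "\<psi> \<in> H1 G" "\<rho> \<chi> = \<rho> \<psi>"
    have d: "\<chi> - \<psi> \<in> H1 G" by (rule rfun.subspace_diff[OF H1 *(1,2)])
    have "\<chi> s = \<psi> s" if "s \<in> S" for s using fun_cong[OF *(3), of s] that by (simp add: \<rho>_def)
    then have "(\<chi> - \<psi>) g = 0" if "g \<in> carrier G" for g
      using H1_eq_0[OF d assms(2)] that assms(3) by simp
    moreover have "(\<chi> - \<psi>) g = 0" if "g \<notin> carrier G" for g using d that by (simp add: H1_iff)
    ultimately show "\<chi> = \<psi>" by (auto simp: fun_eq_iff)
  qed
  moreover have span: "rfun.span B \<subseteq> H1 G" by (rule rfun.span_minimal[OF B(1) H1])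
  ultimately have inj: "inj_on \<rho> (rfun.span B)" by (rule inj_on_subset)
  have ind: "rfun.independent (\<rho> ` B)"
    by (rule pair.linear_independent_injective_image[OF lin B(2) inj])
  have "\<rho> ` B \<subseteq> rfun.span ((\<lambda>s x. if x = s then 1 else 0) ` S)"
  proof clarify
    fix f
    have "\<rho> f = (\<Sum>s\<in>S. rfun_scale (f s) (\<lambda>x. if x = s then 1 else 0))"
      using assms(1) by (auto simp: fun_eq_iff sum_fun_apply \<rho>_def if_distrib cong: if_cong)
    also have "\<dots> \<in> rfun.span ((\<lambda>s x. if x = s then 1 else 0) ` S)"
      by (intro rfun.span_sum rfun.span_scale rfun.span_base) auto
    finally show "\<rho> f \<in> rfun.span ((\<lambda>s x. if x = s then 1 else 0) ` S)" .
  qed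
  then have "finite (\<rho> ` B)" using rfun.independent_span_bound[OF _ ind] assms(1) by blast
  moreover have "inj_on \<rho> B" by (rule inj_on_subset[OF inj rfun.span_superset])
  ultimately have "finite B" by (rule finite_imageD)
  with B(3) show thesis by (rule that[rotated])
qed

text \<open>The ambient function space may have infinite dimension; the finite set \<open>T\<close>
  bounds all bases, and a vector outside the smaller space extends its basis.\<close>

lemma dim_equalizer_less:
  assumes "finite T" "H1 G \<subseteq> rfun.span T" and "equalizer G P \<subset> equalizer G Q"
  shows "rfun.dim (equalizer G P) < rfun.dim (equalizer G Q)"
proof -
  have sub: "equalizer G R \<subseteq> rfun.span T" for R using assms(2) by (auto simp: equalizer_def)
  obtain B where B: "B \<subseteq> equalizer G P" "rfun.independent B" "equalizer G P \<subseteq> rfun.span B"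
    "card B = rfun.dim (equalizer G P)" by (rule rfun.basis_exists)
  obtain C where C: "C \<subseteq> equalizer G Q" "rfun.independent C" "equalizer G Q \<subseteq> rfun.span C"
    "card C = rfun.dim (equalizer G Q)" by (rule rfun.basis_exists)
  have fC: "finite C" using rfun.independent_span_bound[OF assms(1) C(2)] C(1) sub by blast
  obtain w where w: "w \<in> equalizer G Q" "w \<notin> equalizer G P" using assms(3) by blast
  have "rfun.span B \<subseteq> equalizer G P" by (rule rfun.span_minimal[OF B(1) subspace_equalizer])
  then have "w \<notin> rfun.span B" using w by blast
  then have ind: "rfun.independent (insert w B)" using B(2) by (rule rfun.independent_insertI)
  have "insert w B \<subseteq> rfun.span C" using w B(1) C(3) assms(3) by blast
  from rfun.independent_span_bound[OF fC ind this]
  have "finite (insert w B)" "card (insert w B) \<le> card C" by auto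
  moreover have "w \<notin> B" using w B(1) by blast
  ultimately show ?thesis using B(4) C(4) by simp
qed

definition arrangement :: "('a \<Rightarrow> real) set \<Rightarrow> bool" where
  "arrangement Y \<longleftrightarrow> (\<exists>\<P>. finite \<P> \<and> Y = (\<Union>P\<in>\<P>. equalizer G P))"

text \<open>By linear independence, \<open>F v = 0\<close> forces the coefficients to sum to 0 over
  each class of elements of \<open>A\<close> with equal value under \<open>v\<close>. So
  \<open>F\<close> vanishes on the whole subspace cut out by the coincidences of \<open>v\<close>,
  and only finitely many patterns of coincidences exist on \<open>A\<close>.\<close>

lemma arrangement_exp_poly:
  assumes "F \<in> exp_polys G" shows "arrangement {v \<in> H1 G. F v = 0}"
proof -
  obtain A a where A: "finite A" "A \<subseteq> carrier G"
    "\<And>v. v \<in> H1 G \<Longrightarrow> F v = (\<Sum>g\<in>A. fps_const (a g) * fps_exp (v g))"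
    using exp_polys_normal_form[OF assms] by (elim exE conjE) simp
  \<comment> \<open>Groups the terms by the values of \<open>v\<close>. It applies to
    \<open>v\<close> itself, with \<open>u\<close> the identity, and to any \<open>w\<close> that is
    constant on the classes of \<open>v\<close>, even if it identifies more elements.\<close>
  have collect: "F w = (\<Sum>l\<in>v ` A. fps_const (\<Sum>g | g \<in> A \<and> v g = l. a g) * fps_exp (u l))"
    if "w \<in> H1 G" "\<And>g. g \<in> A \<Longrightarrow> w g = u (v g)" for w v u
  proof -
    have "F w = (\<Sum>l\<in>v ` A. \<Sum>g | g \<in> A \<and> v g = l. fps_const (a g) * fps_exp (w g))"
      unfolding A(3)[OF that(1)] by (rule sum.image_gen[OF A(1)])
    also have "\<dots> = (\<Sum>l\<in>v ` A. \<Sum>g | g \<in> A \<and> v g = l. fps_const (a g) * fps_exp (u l))"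
      by (intro sum.cong refl) (auto simp: that(2))
    finally show ?thesis by (simp add: fps_const_sum sum_distrib_right)
  qed
  let ?\<P> = "{P. P \<subseteq> A \<times> A \<and> (\<forall>w\<in>equalizer G P. F w = 0)}"
  have "v \<in> (\<Union>P\<in>?\<P>. equalizer G P)" if v: "v \<in> H1 G" "F v = 0" for v
  proof -
    let ?P = "{(g, h) \<in> A \<times> A. v g = v h}"
    have "F w = 0" if w: "w \<in> equalizer G ?P" for w
    proof -
      have "(\<Sum>l\<in>v ` A. fps_const (\<Sum>g | g \<in> A \<and> v g = l. a g) * fps_exp l) = 0"
        using collect[OF v(1), of "\<lambda>l. l" v] v(2) by simp
      then have z: "(\<Sum>g | g \<in> A \<and> v g = l. a g) = 0" if "l \<in> v ` A" for l
        by (rule fps_exp_linear_independent[rotated, OF _ that]) (use A(1) in simp)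
      define u where "u l = w (SOME g. g \<in> A \<and> v g = l)" for l
      have "w g = u (v g)" if "g \<in> A" for g
      proof -
        define h where "h = (SOME h. h \<in> A \<and> v h = v g)"
        have "h \<in> A \<and> v h = v g"
          unfolding h_def by (rule someI[of "\<lambda>h. h \<in> A \<and> v h = v g" g]) (use that in simp)
        then have "(g, h) \<in> ?P" using that by simp
        moreover have "\<forall>(g, h)\<in>?P. w g = w h" using w by (simp add: equalizer_def)
        ultimately have "w g = w h" by blast
        then show ?thesis by (simp add: u_def h_def)
      qed
      moreover have "w \<in> H1 G" using w by (simp add: equalizer_def)
      ultimately have "F w = (\<Sum>l\<in>v ` A. fps_const (\<Sum>g | g \<in> A \<and> v g = l. a g) * fps_exp (u l))"
        by (intro collect)
      also have "\<dots> = 0" by (rule sum.neutral) (simp add: z)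
      finally show "F w = 0" .
    qed
    moreover have "v \<in> equalizer G ?P" using v(1) by (auto simp: equalizer_def)
    ultimately show ?thesis by (intro UN_I[of ?P]) auto
  qed
  moreover have "finite ?\<P>" using A(1) by simp
  ultimately show ?thesis
    unfolding arrangement_def by (intro exI[of _ ?\<P>]) (auto simp: equalizer_def)
qed

text \<open>Subspaces satisfy the descending chain condition, so infinite intersections are harmless.\<close>

lemma arrangement_Inter:
  assumes gen: "finite S" "S \<subseteq> carrier G" "generate G S = carrier G"
    and Y: "\<And>Y. Y \<in> \<Y> \<Longrightarrow> arrangement Y"
  shows "arrangement (H1 G \<inter> \<Inter>\<Y>)"
proof -
  obtain T where T: "finite T" "H1 G \<subseteq> rfun.span T" using H1_finite_dimensional[OF gen] .
  have "arrangement (equalizer G P \<inter> \<Inter>\<Y>)" for P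
  proof (induction "rfun.dim (equalizer G P)" arbitrary: P rule: less_induct)
    case less
    show ?case
    proof (cases "equalizer G P \<subseteq> \<Inter>\<Y>")
      case True
      then have "equalizer G P \<inter> \<Inter>\<Y> = (\<Union>P\<in>{P}. equalizer G P)" by auto
      then show ?thesis unfolding arrangement_def by blast
    next
      case False
      then obtain Y where Y': "Y \<in> \<Y>" "\<not> equalizer G P \<subseteq> Y" by blast
      obtain \<P> where \<P>: "finite \<P>" "Y = (\<Union>P\<in>\<P>. equalizer G P)"
        using Y[OF Y'(1)] unfolding arrangement_def by blast
      \<comment> \<open>Each component of \<open>Y\<close> meets the current subspace in a proper
        subspace, as the latter is not contained in \<open>Y\<close>; so the dimension
        drops.\<close>
      have "\<forall>Q\<in>\<P>. \<exists>\<Q>. finite \<Q> \<and> equalizer G (P \<union> Q) \<inter> \<Inter>\<Y> = (\<Union>R\<in>\<Q>. equalizer G R)"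
      proof
        fix Q assume "Q \<in> \<P>"
        then have "equalizer G (P \<union> Q) \<subset> equalizer G P"
          using Y'(2) \<P>(2) unfolding equalizer_Un by blast
        from less[OF dim_equalizer_less[OF T this]]
        show "\<exists>\<Q>. finite \<Q> \<and> equalizer G (P \<union> Q) \<inter> \<Inter>\<Y> = (\<Union>R\<in>\<Q>. equalizer G R)"
          by (simp only: arrangement_def)
      qed
      from bchoice[OF this] obtain \<Q> where \<Q>: "\<forall>Q\<in>\<P>. finite (\<Q> Q) \<and>
          equalizer G (P \<union> Q) \<inter> \<Inter>\<Y> = (\<Union>R\<in>\<Q> Q. equalizer G R)"
        by (elim exE)
      have "equalizer G P \<inter> \<Inter>\<Y> = (\<Union>Q\<in>\<P>. equalizer G (P \<union> Q) \<inter> \<Inter>\<Y>)"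
        using Y'(1) \<P>(2) unfolding equalizer_Un by blast
      also have "\<dots> = (\<Union>R\<in>(\<Union>Q\<in>\<P>. \<Q> Q). equalizer G R)" using \<Q> by simp
      finally show ?thesis
        unfolding arrangement_def using \<P>(1) \<Q> by (intro exI[of _ "\<Union>Q\<in>\<P>. \<Q> Q"]) auto
    qed
  qed
  from this[of "{}"] show ?thesis by (simp add: equalizer_def)
qed

end

section \<open>The Bieri-Neumann-Strebel invariant\<close>

text \<open>Exponents are tracked by the set \<open>L\<close>, because every
  \<open>fps_exp l\<close> has constant coefficient 1 and the order of a power series does not
  reveal whether exponents are positive.\<close>

definition exp_span :: "real set \<Rightarrow> real fps set" where
  "exp_span L = {F. \<exists>\<Lambda> a. finite \<Lambda> \<and> \<Lambda> \<subseteq> L \<and> F = (\<Sum>l\<in>\<Lambda>. fps_const (a l) * fps_exp l)}"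

lemma exp_span_exp: "l \<in> L \<Longrightarrow> fps_exp l \<in> exp_span L"
  unfolding exp_span_def by (intro CollectI exI[of _ "{l}"] exI[of _ "\<lambda>_. 1"]) simp

lemma exp_span_0: "0 \<in> exp_span L"
  unfolding exp_span_def by (intro CollectI exI[of _ "{}"]) simp

lemma exp_span_add:
  assumes "F \<in> exp_span L" "F' \<in> exp_span L" shows "F + F' \<in> exp_span L"
proof -
  obtain A a where A: "finite A" "A \<subseteq> L" "F = (\<Sum>l\<in>A. fps_const (a l) * fps_exp l)"
    using assms(1) by (auto simp: exp_span_def)
  obtain B b where B: "finite B" "B \<subseteq> L" "F' = (\<Sum>l\<in>B. fps_const (b l) * fps_exp l)"
    using assms(2) by (auto simp: exp_span_def)
  have "F = (\<Sum>l\<in>A \<union> B. fps_const (if l \<in> A then a l else 0) * fps_exp l)"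
    unfolding A(3) by (rule sum.mono_neutral_cong_left) (use A B in auto)
  moreover have "F' = (\<Sum>l\<in>A \<union> B. fps_const (if l \<in> B then b l else 0) * fps_exp l)"
    unfolding B(3) by (rule sum.mono_neutral_cong_left) (use A B in auto)
  ultimately have "F + F' = (\<Sum>l\<in>A \<union> B. fps_const ((if l \<in> A then a l else 0) +
      (if l \<in> B then b l else 0)) * fps_exp l)"
    by (simp only: sum.distrib distrib_right fps_const_add[symmetric])
  then show ?thesis
    unfolding exp_span_def using A B
    by (intro CollectI exI[of _ "A \<union> B"] exI[of _ "\<lambda>l. (if l \<in> A then a l else 0) + (if l \<in> B then b l else 0)"]) simp
qed

lemma exp_span_sum: "(\<And>i. i \<in> I \<Longrightarrow> F i \<in> exp_span L) \<Longrightarrow> (\<Sum>i\<in>I. F i) \<in> exp_span L"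
  by (induction I rule: infinite_finite_induct) (auto intro: exp_span_0 exp_span_add)

lemma exp_span_const_mult_exp:
  assumes "l \<in> L" shows "fps_const a * fps_exp l \<in> exp_span L"
  unfolding exp_span_def using assms by (intro CollectI exI[of _ "{l}"] exI[of _ "\<lambda>_. a"]) simp

lemma exp_span_mult:
  assumes "F \<in> exp_span L" "F' \<in> exp_span L'" "\<And>l l'. l \<in> L \<Longrightarrow> l' \<in> L' \<Longrightarrow> l + l' \<in> L''"
  shows "F * F' \<in> exp_span L''"
proof -
  obtain A a where A: "finite A" "A \<subseteq> L" "F = (\<Sum>l\<in>A. fps_const (a l) * fps_exp l)"
    using assms(1) by (auto simp: exp_span_def)
  obtain B b where B: "finite B" "B \<subseteq> L'" "F' = (\<Sum>l\<in>B. fps_const (b l) * fps_exp l)"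
    using assms(2) by (auto simp: exp_span_def)
  have "F * F' = (\<Sum>l\<in>A. \<Sum>l'\<in>B. fps_const (a l * b l') * fps_exp (l + l'))"
    unfolding A(3) B(3) sum_product
    by (intro sum.cong refl) (simp add: fps_exp_add_mult mult_ac flip: fps_const_mult)
  also have "\<dots> \<in> exp_span L''"
    by (intro exp_span_sum exp_span_const_mult_exp) (use A B assms(3) in blast)
  finally show ?thesis .
qed

lemma exp_span_uminus: "F \<in> exp_span L \<Longrightarrow> - F \<in> exp_span L"
  using exp_span_mult[OF exp_span_const_mult_exp[of 0 "{0}" "-1"], of F L L] by (simp flip: fps_const_neg)

lemma exp_span_mono: "L \<subseteq> L' \<Longrightarrow> exp_span L \<subseteq> exp_span L'"
  unfolding exp_span_def by blast

lemma one_exp_span: "0 \<in> L \<Longrightarrow> 1 \<in> exp_span L"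
  using exp_span_exp[of 0 L] by simp

text \<open>The exponent 0 occurs in \<open>1 + F\<close> with coefficient 1, so linear independence
  applies.\<close>

lemma one_plus_exp_span_neq_0:
  assumes "F \<in> exp_span {0<..}" shows "1 + F \<noteq> 0"
proof
  assume F0: "1 + F = 0"
  obtain A a where A: "finite A" "A \<subseteq> {0<..}" "F = (\<Sum>l\<in>A. fps_const (a l) * fps_exp l)"
    using assms by (auto simp: exp_span_def)
  define a' where "a' l = (if l = 0 then 1 else a l)" for l
  have "0 \<notin> A" using A(2) by auto
  then have "(\<Sum>l\<in>insert 0 A. fps_const (a' l) * fps_exp l) = 1 + (\<Sum>l\<in>A. fps_const (a' l) * fps_exp l)"
    using A(1) by (simp add: a'_def)
  also have "(\<Sum>l\<in>A. fps_const (a' l) * fps_exp l) = F"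
    unfolding A(3) using \<open>0 \<notin> A\<close> by (intro sum.cong refl) (auto simp: a'_def)
  finally have "a' 0 = 0"
    using fps_exp_linear_independent[of "insert 0 A" a' 0] A(1) F0 by simp
  then show False by (simp add: a'_def)
qed

text \<open>Combinations of positive exponents absorb products with those of nonnegative exponents.
  In the permutation expansion the identity contributes 1 plus positive exponents; any other
  permutation meets an off-diagonal entry.\<close>

lemma det_one_plus_exp_span:
  fixes E :: "nat \<Rightarrow> nat \<Rightarrow> real fps"
  assumes E: "\<And>i j. i < n \<Longrightarrow> j < n \<Longrightarrow> E i j \<in> exp_span {0<..}"
  shows "det (mat n n (\<lambda>(i, j). (if i = j then 1 else 0) + E i j)) \<noteq> 0"
proof -
  let ?m = "\<lambda>i j. (if i = j then 1 else 0) + E i j"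
  have pos_sub: "exp_span {0<..} \<subseteq> exp_span {0..}" by (rule exp_span_mono) auto
  have ideal: "F * F' \<in> exp_span {0<..}" if "F \<in> exp_span {0<..}" "F' \<in> exp_span {0..}" for F F'
    by (rule exp_span_mult[OF that]) auto
  have entry: "?m i j \<in> exp_span {0..}" if "i < n" "j < n" for i j
    using E[OF that] pos_sub by (intro exp_span_add) (auto intro: one_exp_span exp_span_0)
  have prod: "(\<Prod>i\<in>I. F i) \<in> exp_span {0..}" if "\<And>i. i \<in> I \<Longrightarrow> F i \<in> exp_span {0..}"
    for I :: "nat set" and F
    using that
  proof (induction I rule: infinite_finite_induct)
    case (insert i I)
    have "F i * prod F I \<in> exp_span {0..}"
      by (rule exp_span_mult[where L = "{0..}" and L' = "{0..}"]) (use insert in auto)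
    then show ?case using insert by simp
  qed (auto intro: one_exp_span)
  have diag: "(\<Prod>i\<in>I. ?m i i) - 1 \<in> exp_span {0<..}" if "I \<subseteq> {0..<n}" for I
    using finite_subset[OF that finite_atLeastLessThan] that
  proof (induction I rule: finite_induct)
    case empty
    then show ?case by (simp add: exp_span_0)
  next
    case (insert i I)
    have "?m k k \<in> exp_span {0..}" if "k \<in> I" for k
      using entry[of k k] insert.prems that by auto
    then have "(\<Prod>i\<in>I. ?m i i) \<in> exp_span {0..}" by (rule prod)
    moreover have "E i i \<in> exp_span {0<..}" using insert.prems by (intro E) auto
    ultimately have "E i i * (\<Prod>i\<in>I. ?m i i) + ((\<Prod>i\<in>I. ?m i i) - 1) \<in> exp_span {0<..}"
      using insert by (intro exp_span_add ideal) auto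
    also have "E i i * (\<Prod>i\<in>I. ?m i i) + ((\<Prod>i\<in>I. ?m i i) - 1) = (\<Prod>i\<in>insert i I. ?m i i) - 1"
      using insert(1,2) by (simp add: algebra_simps)
    finally show ?case .
  qed
  let ?P = "{p. p permutes {0..<n}}"
  have off: "signof p * (\<Prod>i = 0..<n. ?m i (p i)) \<in> exp_span {0<..}" if p: "p \<in> ?P - {id}" for p
  proof -
    have lt: "p i < n" if "i < n" for i using p that permutes_in_image[of p "{0..<n}" i] by auto
    obtain i where i: "p i \<noteq> i" using p by (auto simp: fun_eq_iff)
    then have "i < n" using p by (auto simp: permutes_def)
    then have "(\<Prod>i = 0..<n. ?m i (p i)) = ?m i (p i) * (\<Prod>i\<in>{0..<n} - {i}. ?m i (p i))"
      by (intro prod.remove) auto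
    also have "\<dots> \<in> exp_span {0<..}"
    proof (rule ideal)
      show "?m i (p i) \<in> exp_span {0<..}" using i E[OF \<open>i < n\<close> lt[OF \<open>i < n\<close>]] by simp
      show "(\<Prod>k\<in>{0..<n} - {i}. ?m k (p k)) \<in> exp_span {0..}"
        by (rule prod, rule entry) (use lt in auto)
    qed
    finally show ?thesis by (auto simp: sign_def intro: exp_span_uminus)
  qed
  have "det (mat n n (\<lambda>(i, j). ?m i j)) = (\<Sum>p\<in>?P. signof p * (\<Prod>i = 0..<n. ?m i (p i)))"
    unfolding det_def by (auto intro!: sum.cong prod.cong dest: permutes_in_image)
  also have "\<dots> = signof id * (\<Prod>i = 0..<n. ?m i (id i)) +
      (\<Sum>p\<in>?P - {id}. signof p * (\<Prod>i = 0..<n. ?m i (p i)))"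
    by (rule sum.remove) (auto simp: finite_permutations permutes_id)
  also have "\<dots> = 1 + (((\<Prod>i = 0..<n. ?m i i) - 1) +
      (\<Sum>p\<in>?P - {id}. signof p * (\<Prod>i = 0..<n. ?m i (p i))))"
    by simp
  also have "\<dots> \<noteq> 0"
    by (rule one_plus_exp_span_neq_0) (intro exp_span_add exp_span_sum diag off order.refl)
  finally show ?thesis .
qed

section \<open>Vanishing of cocycles along paths in a half space\<close>

context group
begin

lemma exp_cocycle_nat_pow:
  assumes "exp_cocycle G v c" "v \<in> H1 G" "g \<in> carrier G" "c g = 0"
  shows "c (g [^] (n::nat)) = 0"
  by (induction n) (use assms in \<open>auto simp: exp_cocycle_one exp_cocycle_mult\<close>)

lemma H1_nat_pow: "v \<in> H1 G \<Longrightarrow> g \<in> carrier G \<Longrightarrow> v (g [^] (n::nat)) = of_nat n * v g"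
  by (induction n) (auto simp: H1_one H1_mult algebra_simps)

text \<open>Along a path from the unit to \<open>g\<close> inside the half space, every edge adds
  plus or minus \<open>fps_exp (v h) * c s\<close>, where \<open>h\<close> is the tail of the edge
  in the Cayley graph, a vertex with \<open>0 \<le> v h\<close>.\<close>

lemma BNS_exp_cocycle_span:
  assumes v: "v \<in> BNS G S" and fin: "finite S" and S: "S \<subseteq> carrier G" and c: "exp_cocycle G v c"
    and g: "g \<in> carrier G" "0 \<le> v g"
  shows "\<exists>F. (\<forall>s\<in>S. F s \<in> exp_span {0..}) \<and> c g = (\<Sum>s\<in>S. F s * c s)"
proof -
  let ?V = "{g \<in> carrier G. 0 \<le> v g}"
  let ?\<Gamma> = "cayley_graph G S \<restriction> ?V"
  have H: "v \<in> H1 G" using v by (simp add: BNS_def)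
  let ?Q = "\<lambda>g. \<exists>F. (\<forall>s\<in>S. F s \<in> exp_span {0..}) \<and> c g = (\<Sum>s\<in>S. F s * c s)"
  have verts: "verts ?\<Gamma> = ?V" by (simp add: cayley_graph_def)
  have "connected ?\<Gamma>" using v by (simp add: BNS_def)
  then have "(\<one>, g) \<in> rtrancl_on ?V ((arcs_ends ?\<Gamma>)\<^sup>s)"
    unfolding connected_conv verts using g H by (simp add: H1_one)
  then show "?Q g"
  proof (induction rule: rtrancl_on_induct)
    case base
    show ?case by (rule exI[of _ "\<lambda>_. 0"]) (simp add: exp_span_0 exp_cocycle_one[OF c H])
  next
    case (step h k)
    then obtain F where F: "\<forall>s\<in>S. F s \<in> exp_span {0..}" "c h = (\<Sum>s\<in>S. F s * c s)" by blast
    have "\<exists>s\<in>S. k = h \<otimes> s \<or> h = k \<otimes> s"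
      using step(2) by (auto simp: symcl_def arcs_ends_def arc_to_ends_def cayley_graph_def)
    then obtain s where s: "s \<in> S" "k = h \<otimes> s \<or> h = k \<otimes> s" by blast
    have sc: "s \<in> carrier G" using s S by blast
    obtain a where a: "a \<in> exp_span {0..}" "c k = c h + a * c s"
    proof (cases "k = h \<otimes> s")
      case True
      show thesis
        by (rule that[of "fps_exp (v h)"])
           (use step(3) True sc exp_cocycle_mult[OF c] in \<open>auto intro: exp_span_exp\<close>)
    next
      \<comment> \<open>The edge is traversed backwards; its tail is then \<open>k\<close>, which
        lies in the half space as well.\<close>
      case False
      then have "c h = c k + fps_exp (v k) * c s"
        using s(2) step(4) sc exp_cocycle_mult[OF c] by auto
      then show thesis
        by (intro that[of "- fps_exp (v k)"])
           (use step(4) in \<open>auto intro: exp_span_exp exp_span_uminus\<close>)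
    qed
    show ?case
    proof (intro exI[of _ "\<lambda>r. F r + (if r = s then a else 0)"] conjI ballI)
      show "F r + (if r = s then a else 0) \<in> exp_span {0..}" if "r \<in> S" for r
        using F(1) that a(1) by (auto intro: exp_span_add)
      show "c k = (\<Sum>r\<in>S. (F r + (if r = s then a else 0)) * c r)"
        using a(2) F(2) s(1) fin
        by (simp add: distrib_right sum.distrib if_distrib[of "\<lambda>x. x * _"] cong: if_cong)
    qed
  qed
qed

text \<open>Right multiplication by powers of \<open>r\<close>, where the cocycle vanishes, moves a
  generator far into the half space without changing its cocycle value. Splitting off one
  \<open>r\<close> on the left then supplies the strictly positive exponent
  \<open>v r\<close>.\<close>

theorem BNS_exp_cocycle_zero:
  assumes v: "v \<in> BNS G S" and S: "finite S" "S \<subseteq> carrier G" "generate G S = carrier G"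
    and c: "exp_cocycle G v c" and s0: "s0 \<in> S" "v s0 \<noteq> 0" "c s0 = 0" and g: "g \<in> carrier G"
  shows "c g = 0"
proof -
  have H: "v \<in> H1 G" using v by (simp add: BNS_def)
  have s0c: "s0 \<in> carrier G" using s0 S by blast
  define r where "r = (if v s0 > 0 then s0 else inv s0)"
  have r: "r \<in> carrier G" "v r > 0" "c r = 0"
    using s0 s0c H1_inv[OF H s0c] exp_cocycle_inv[OF c H s0c] by (auto simp: r_def)
  have "\<exists>E. (\<forall>s'\<in>S. E s' \<in> exp_span {0<..}) \<and> c s = (\<Sum>s'\<in>S. E s' * c s')" if "s \<in> S" for s
  proof -
    have s: "s \<in> carrier G" using that S by blast
    \<comment> \<open>Chosen so that \<open>inv r \<otimes> (s \<otimes> r [^] n)\<close> lies in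
      the half space.\<close>
    obtain n :: nat where n: "of_nat n * v r > v r - v s"
      using reals_Archimedean3[OF r(2)] by blast
    let ?t = "r [^] n"
    let ?w = "inv r \<otimes> (s \<otimes> ?t)"
    have t: "?t \<in> carrier G" "c ?t = 0" "v ?t = of_nat n * v r"
      using r H1_nat_pow[OF H r(1)] exp_cocycle_nat_pow[OF c H r(1,3)] by simp_all
    have w: "?w \<in> carrier G" "0 \<le> v ?w"
      using r s t n by (simp_all add: H1_mult[OF H] H1_inv[OF H])
    have "c s = c (s \<otimes> ?t)" using exp_cocycle_mult[OF c s t(1)] t(2) by simp
    also have "s \<otimes> ?t = r \<otimes> ?w" using r s t by (simp add: m_assoc[symmetric])
    also have "c (r \<otimes> ?w) = fps_exp (v r) * c ?w" using exp_cocycle_mult[OF c r(1) w(1)] r(3) by simp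
    finally have cs: "c s = fps_exp (v r) * c ?w" .
    obtain F where F: "\<forall>s\<in>S. F s \<in> exp_span {0..}" "c ?w = (\<Sum>s\<in>S. F s * c s)"
      using BNS_exp_cocycle_span[OF v S(1,2) c w] by blast
    have "fps_exp (v r) * F s' \<in> exp_span {0<..}" if "s' \<in> S" for s'
      by (rule exp_span_mult[of _ "{v r}" _ "{0..}"]) (use F(1) that r(2) in \<open>auto intro: exp_span_exp\<close>)
    moreover have "c s = (\<Sum>s'\<in>S. fps_exp (v r) * F s' * c s')"
      unfolding cs F(2) by (simp add: sum_distrib_left mult.assoc)
    ultimately show ?thesis by (intro exI[of _ "\<lambda>s'. fps_exp (v r) * F s'"]) blast
  qed
  then have "\<forall>s\<in>S. \<exists>E. (\<forall>s'\<in>S. E s' \<in> exp_span {0<..}) \<and> c s = (\<Sum>s'\<in>S. E s' * c s')" by blast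
  from bchoice[OF this] obtain E where
    E: "\<forall>s\<in>S. (\<forall>s'\<in>S. E s s' \<in> exp_span {0<..}) \<and> c s = (\<Sum>s'\<in>S. E s s' * c s')"
    by (elim exE)
  obtain ss where ss: "set ss = S" "distinct ss" using finite_distinct_list[OF S(1)] by blast
  let ?n = "length ss"
  let ?M = "mat ?n ?n (\<lambda>(i, j). (if i = j then 1 else 0) + - E (ss ! i) (ss ! j))"
  have "det ?M \<noteq> 0"
    by (rule det_one_plus_exp_span) (use E ss in \<open>auto intro!: exp_span_uminus\<close>)
  moreover have "?M *\<^sub>v vec ?n (\<lambda>i. c (ss ! i)) = 0\<^sub>v ?n"
  proof (rule eq_vecI)
    fix i assume "i < dim_vec (0\<^sub>v ?n :: real fps vec)"
    then have i: "i < ?n" by simp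
    then have "ss ! i \<in> S" using ss by auto
    then have ci: "c (ss ! i) = (\<Sum>s'\<in>S. E (ss ! i) s' * c s')" using E by blast
    have "(\<Sum>s'\<in>S. E (ss ! i) s' * c s') = (\<Sum>j<?n. E (ss ! i) (ss ! j) * c (ss ! j))"
      by (rule sum.reindex_bij_betw[OF bij_betw_nth[OF ss(2) refl ss(1)[symmetric]], symmetric])
    then have "(\<Sum>j<?n. ((if i = j then 1 else 0) + - E (ss ! i) (ss ! j)) * c (ss ! j)) = 0"
      using ci i by (simp add: distrib_right left_diff_distrib sum.distrib sum_subtractf
          if_distrib[of "\<lambda>x. x * _"] cong: if_cong)
    then show "(?M *\<^sub>v vec ?n (\<lambda>i. c (ss ! i))) $ i = 0\<^sub>v ?n $ i"
      using i by (simp add: scalar_prod_def atLeast0LessThan)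
  qed simp
  ultimately have "vec ?n (\<lambda>i. c (ss ! i)) = 0\<^sub>v ?n"
    using iffD2[OF det_0_iff_vec_prod_zero[of ?M ?n], OF _ exI[of _ "vec ?n (\<lambda>i. c (ss ! i))"]]
    by fastforce
  then have zero: "c (ss ! i) = 0" if "i < ?n" for i
    using that by (simp add: vec_eq_iff)
  obtain D where "\<forall>v\<in>H1 G. \<forall>c. exp_cocycle G v c \<longrightarrow> c g = (\<Sum>i<length ss. D i v * c (ss ! i))"
    using exp_cocycle_fox_derivatives[of ss g] g ss S by auto
  then have "c g = (\<Sum>i<length ss. D i v * c (ss ! i))" using H c by simp
  then show "c g = 0" using zero by simp
qed

end

section \<open>Resonance\<close>

context group
begin

definition cup_trivial :: "('a \<Rightarrow> real) \<Rightarrow> ('a \<Rightarrow> real) \<Rightarrow> bool" where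
  "cup_trivial \<chi> \<psi> \<longleftrightarrow> (\<exists>u :: 'a \<Rightarrow> real. \<forall>g\<in>carrier G. \<forall>h\<in>carrier G. u (g \<otimes> h) = u g + u h + \<chi> g * \<psi> h)"

text \<open>Up to sign, the pointwise product of two characters bounds the sum of their two cup
  products: graded commutativity in degree one.\<close>

lemma cup_trivial_commute:
  assumes "\<chi> \<in> H1 G" "\<psi> \<in> H1 G" "cup_trivial \<chi> \<psi>" shows "cup_trivial \<psi> \<chi>"
proof -
  obtain u where "\<forall>g\<in>carrier G. \<forall>h\<in>carrier G. u (g \<otimes> h) = u g + u h + \<chi> g * \<psi> h"
    using assms(3) by (auto simp: cup_trivial_def)
  then show ?thesis
    unfolding cup_trivial_def using H1_mult[OF assms(1)] H1_mult[OF assms(2)]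
    by (intro exI[of _ "\<lambda>g. \<chi> g * \<psi> g - u g"]) (simp add: algebra_simps)
qed

lemma cup_trivial_scale:
  assumes "\<chi> \<in> H1 G" shows "cup_trivial (\<lambda>g. r * \<chi> g) \<chi>"
  unfolding cup_trivial_def using H1_mult[OF assms]
  by (intro exI[of _ "\<lambda>g. r / 2 * \<chi> g ^ 2"]) (simp add: power2_eq_square algebra_simps)

lemma cobd_1:
  "g \<in> carrier G \<Longrightarrow> h \<in> carrier G \<Longrightarrow> cobd G 1 f [g, h] = f [h] - f [g \<otimes> h] + f [g]"
  by (simp add: cobd_def tuples_def merge_at_def)

lemma tuples_2_cases:
  assumes "w \<in> tuples G 2" obtains g h where "w = [g, h]" "g \<in> carrier G" "h \<in> carrier G"
  using assms by (auto simp: tuples_def numeral_2_eq_2 length_Suc_conv)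

lemma cochain_2_eqI:
  assumes "f \<in> cochains G 2" "f' \<in> cochains G 2"
    and "\<And>g h. g \<in> carrier G \<Longrightarrow> h \<in> carrier G \<Longrightarrow> f [g, h] = f' [g, h]"
  shows "f = f'"
proof
  fix w show "f w = f' w"
  proof (cases "w \<in> tuples G 2")
    case True
    then show ?thesis by (rule tuples_2_cases) (use assms(3) in auto)
  qed (use assms in \<open>auto simp: cochains_def\<close>)
qed

lemma cobd_cochain: "cobd G 1 f \<in> cochains G 2"
  by (auto simp: cochains_def cobd_def numeral_2_eq_2)

lemma H1_class_eq: "H1_class G \<chi> = {\<lambda>w. if w \<in> tuples G 1 then \<chi> (hd w) else 0}"
  unfolding H1_class_def coboundaries_1 by (simp add: elt_set_plus_def)

lemma coboundaries_2: "coboundaries G 2 = cobd G 1 ` cochains G 1"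
  by (simp add: numeral_2_eq_2)

lemma cup_H1_class_trivial_iff:
  "cup G 1 1 (H1_class G \<psi>) (H1_class G \<chi>) = coboundaries G 2 \<longleftrightarrow> cup_trivial \<psi> \<chi>"
proof -
  let ?c = "\<lambda>\<chi> w. if w \<in> tuples G 1 then \<chi> (hd w) else (0::real)"
  let ?k = "cup_cochain G 1 1 (?c \<psi>) (?c \<chi>)"
  have k: "?k \<in> cochains G 2" "\<And>g h. g \<in> carrier G \<Longrightarrow> h \<in> carrier G \<Longrightarrow> ?k [g, h] = \<psi> g * \<chi> h"
    by (auto simp: cochains_def cup_cochain_def numeral_2_eq_2 tuples_def)
  have "cup G 1 1 (H1_class G \<psi>) (H1_class G \<chi>) = ?k +o coboundaries G 2"
    unfolding cup_def H1_class_eq by (simp add: numeral_2_eq_2)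
  moreover have "?k +o coboundaries G 2 = coboundaries G 2 \<longleftrightarrow> ?k \<in> coboundaries G 2"
  proof
    have "cobd G 1 0 = 0" by (auto simp: cobd_def fun_eq_iff)
    moreover have "0 \<in> cochains G 1" by (simp add: cochains_def)
    ultimately have "0 \<in> coboundaries G 2" unfolding coboundaries_2 by (metis imageI)
    then have "?k + 0 \<in> ?k +o coboundaries G 2" by (rule set_plus_intro2)
    then show "?k \<in> coboundaries G 2" if "?k +o coboundaries G 2 = coboundaries G 2"
      using that by simp
  next
    assume "?k \<in> coboundaries G 2"
    then obtain f where f: "?k = cobd G 1 f" "f \<in> cochains G 1" unfolding coboundaries_2 by blast
    have add: "cobd G 1 (a + b) = cobd G 1 a + cobd G 1 b" "cobd G 1 (a - b) = cobd G 1 a - cobd G 1 b" for a b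
      by (auto simp: cobd_def fun_eq_iff)
    have sub: "a + b \<in> cochains G 1" "a - b \<in> cochains G 1" if "a \<in> cochains G 1" "b \<in> cochains G 1" for a b
      using that by (auto simp: cochains_def)
    show "?k +o coboundaries G 2 = coboundaries G 2"
      unfolding coboundaries_2 f(1) elt_set_plus_def
    proof safe
      fix a assume "a \<in> cochains G 1"
      then show "cobd G 1 f + cobd G 1 a \<in> cobd G 1 ` cochains G 1"
        using f(2) sub add by (metis imageI)
    next
      fix a assume a: "a \<in> cochains G 1"
      have "cobd G 1 a = cobd G 1 f + cobd G 1 (a - f)" unfolding add by simp
      then show "\<exists>b\<in>cobd G 1 ` cochains G 1. cobd G 1 a = cobd G 1 f + b"
        using a f(2) sub by blast
    qed
  qed
  moreover have "?k \<in> coboundaries G 2 \<longleftrightarrow> cup_trivial \<psi> \<chi>"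
  proof
    assume "?k \<in> coboundaries G 2"
    then obtain f where f: "?k = cobd G 1 f" unfolding coboundaries_2 by blast
    have "f [h] - f [g \<otimes> h] + f [g] = \<psi> g * \<chi> h" if "g \<in> carrier G" "h \<in> carrier G" for g h
      using k(2)[OF that] cobd_1[OF that, of f] f by simp
    then show "cup_trivial \<psi> \<chi>"
      unfolding cup_trivial_def by (intro exI[of _ "\<lambda>g. - f [g]"]) (simp add: algebra_simps)
  next
    assume "cup_trivial \<psi> \<chi>"
    then obtain u where u: "\<And>g h. g \<in> carrier G \<Longrightarrow> h \<in> carrier G \<Longrightarrow> u (g \<otimes> h) = u g + u h + \<psi> g * \<chi> h"
      by (auto simp: cup_trivial_def)
    let ?f = "\<lambda>w. if w \<in> tuples G 1 then - u (hd w) else 0"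
    have "?k = cobd G 1 ?f"
      by (rule cochain_2_eqI[OF k(1) cobd_cochain])
         (unfold k(2) cobd_1, simp add: tuples_def u)
    moreover have "?f \<in> cochains G 1" by (simp add: cochains_def)
    ultimately show "?k \<in> coboundaries G 2" unfolding coboundaries_2 by blast
  qed
  ultimately show ?thesis by simp
qed

text \<open>A cochain of degree 0 is a number, its value at the empty tuple, and all of them are
  cocycles.\<close>

lemma aomoto_coboundaries_eq:
  "aomoto_coboundaries G (H1_class G \<chi>) = range (\<lambda>r. H1_class G (\<lambda>g. r * \<chi> g))"
proof -
  let ?c = "\<lambda>\<chi> w. if w \<in> tuples G 1 then \<chi> (hd w) else (0::real)"
  have cup: "cup G 0 1 {f} (H1_class G \<chi>) = H1_class G (\<lambda>g. f [] * \<chi> g)" for f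
  proof -
    have "cup_cochain G 0 1 f (?c \<chi>) = ?c (\<lambda>g. f [] * \<chi> g)"
      by (auto simp: cup_cochain_def fun_eq_iff)
    then show ?thesis
      unfolding cup_def H1_class_eq by (simp add: coboundaries_1[unfolded One_nat_def] elt_set_plus_def del: coboundaries.simps)
  qed
  have coh: "cohomology G 0 = (\<lambda>f. {f}) ` cochains G 0"
  proof -
    have "cobd G 0 f = 0" for f by (auto simp: cobd_def tuples_def fun_eq_iff length_Suc_conv)
    then show ?thesis by (auto simp: cohomology_def cocycles_def elt_set_plus_def)
  qed
  have "r \<in> (\<lambda>f. f []) ` cochains G 0" for r
    by (rule image_eqI[of _ _ "\<lambda>w. if w = [] then r else 0"]) (auto simp: cochains_def tuples_def)
  then have "(\<lambda>f. f []) ` cochains G 0 = UNIV" by blast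
  then have "range (\<lambda>r. H1_class G (\<lambda>g. r * \<chi> g)) =
      (\<lambda>r. H1_class G (\<lambda>g. r * \<chi> g)) ` (\<lambda>f. f []) ` cochains G 0" by simp
  then show ?thesis
    unfolding aomoto_coboundaries_def coh image_image cup by simp
qed

text \<open>Passes from classes to characters and, by commutativity, puts \<open>\<chi>\<close> on
  the left of the cup product, the side on which the exponential acts in a cocycle.\<close>

lemma resonance1_iff:
  "\<chi> \<in> resonance1 G \<longleftrightarrow> \<chi> \<in> H1 G \<and>
    (\<exists>\<psi>\<in>H1 G. (\<forall>r. \<psi> \<noteq> (\<lambda>g. r * \<chi> g)) \<and> cup_trivial \<chi> \<psi>)"
proof (cases "\<chi> \<in> H1 G")
  case True
  let ?a = "H1_class G \<chi>"
  note bij = bij_betw_H1_class[OF group_axioms]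
  have scale: "(\<lambda>g. r * \<chi> g) \<in> H1 G" for r
    using True by (auto simp: H1_def hom_def real_add_group_def distrib_left)
  have cocycles: "H1_class G \<psi> \<in> aomoto_cocycles G ?a \<longleftrightarrow> cup_trivial \<psi> \<chi>" if "\<psi> \<in> H1 G" for \<psi>
    using bij_betwE[OF bij] that cup_H1_class_trivial_iff by (auto simp: aomoto_cocycles_def)
  have "aomoto_coboundaries G ?a \<subseteq> aomoto_cocycles G ?a"
    unfolding aomoto_coboundaries_eq using cocycles scale cup_trivial_scale[OF True] by auto
  then have "\<chi> \<in> resonance1 G \<longleftrightarrow> (\<exists>b\<in>aomoto_cocycles G ?a. b \<notin> aomoto_coboundaries G ?a)"
    using True by (auto simp: resonance1_def)
  also have "\<dots> \<longleftrightarrow> (\<exists>\<psi>\<in>H1 G. H1_class G \<psi> \<in> aomoto_cocycles G ?a \<and> H1_class G \<psi> \<notin> aomoto_coboundaries G ?a)"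
  proof -
    have "aomoto_cocycles G ?a \<subseteq> H1_class G ` H1 G"
      using bij_betw_imp_surj_on[OF bij] by (auto simp: aomoto_cocycles_def)
    then show ?thesis by blast
  qed
  also have "\<dots> \<longleftrightarrow> (\<exists>\<psi>\<in>H1 G. (\<forall>r. \<psi> \<noteq> (\<lambda>g. r * \<chi> g)) \<and> cup_trivial \<chi> \<psi>)"
  proof (rule bex_cong[OF refl])
    fix \<psi> assume \<psi>: "\<psi> \<in> H1 G"
    have "H1_class G \<psi> \<in> aomoto_coboundaries G ?a \<longleftrightarrow> (\<exists>r. \<psi> = (\<lambda>g. r * \<chi> g))"
      unfolding aomoto_coboundaries_eq
      using inj_on_eq_iff[OF bij_betw_imp_inj_on[OF bij] \<psi> scale] by auto
    then show "(H1_class G \<psi> \<in> aomoto_cocycles G ?a \<and> H1_class G \<psi> \<notin> aomoto_coboundaries G ?a) \<longleftrightarrow>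
      ((\<forall>r. \<psi> \<noteq> (\<lambda>g. r * \<chi> g)) \<and> cup_trivial \<chi> \<psi>)"
      using cocycles[OF \<psi>] cup_trivial_commute[OF True \<psi>] cup_trivial_commute[OF \<psi> True] by blast
  qed
  finally show ?thesis using True by simp
qed (simp add: resonance1_def)

text \<open>The leading coefficient of the cocycle pairs trivially with \<open>v\<close>, by the next coefficient.\<close>

lemma exp_cocycle_imp_resonance1:
  assumes v: "v \<in> H1 G" and c: "exp_cocycle G v c"
    and s: "s \<in> carrier G" "v s \<noteq> 0" "c s = 0" and nz: "g0 \<in> carrier G" "c g0 \<noteq> 0"
  shows "v \<in> resonance1 G"
proof -
  define k where "k = (LEAST k. \<exists>g\<in>carrier G. fps_nth (c g) k \<noteq> 0)"
  obtain j where "fps_nth (c g0) j \<noteq> 0" using nz(2) by (auto simp: fps_eq_iff)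
  then have "\<exists>k. \<exists>g\<in>carrier G. fps_nth (c g) k \<noteq> 0" using nz(1) by blast
  then have "\<exists>g\<in>carrier G. fps_nth (c g) k \<noteq> 0" unfolding k_def by (rule LeastI_ex)
  then obtain g1 where g1: "g1 \<in> carrier G" "fps_nth (c g1) k \<noteq> 0" by blast
  have low: "fps_nth (c g) i = 0" if "i < k" "g \<in> carrier G" for i g
    using not_less_Least[of i "\<lambda>k. \<exists>g\<in>carrier G. fps_nth (c g) k \<noteq> 0"] that by (auto simp: k_def)
  have nth: "fps_nth (c (g \<otimes> h)) n = fps_nth (c g) n + (\<Sum>i\<le>n. v g ^ i / fact i * fps_nth (c h) (n - i))"
    if "g \<in> carrier G" "h \<in> carrier G" for g h n
    unfolding exp_cocycle_mult[OF c that] by (simp add: fps_mult_nth atLeast0AtMost)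
  have k: "fps_nth (c (g \<otimes> h)) k = fps_nth (c g) k + fps_nth (c h) k"
    if "g \<in> carrier G" "h \<in> carrier G" for g h
  proof -
    have "(\<Sum>i\<le>k. v g ^ i / fact i * fps_nth (c h) (k - i)) = (\<Sum>i\<in>{0}. v g ^ i / fact i * fps_nth (c h) (k - i))"
      by (rule sum.mono_neutral_right) (use low that in auto)
    then show ?thesis using nth[OF that, of k] by simp
  qed
  have Sk: "fps_nth (c (g \<otimes> h)) (Suc k) = fps_nth (c g) (Suc k) + fps_nth (c h) (Suc k) + v g * fps_nth (c h) k"
    if "g \<in> carrier G" "h \<in> carrier G" for g h
  proof -
    have "(\<Sum>i\<le>Suc k. v g ^ i / fact i * fps_nth (c h) (Suc k - i)) =
        (\<Sum>i\<in>{0, 1}. v g ^ i / fact i * fps_nth (c h) (Suc k - i))"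
    proof (rule sum.mono_neutral_right)
      show "\<forall>i\<in>{..Suc k} - {0, 1}. v g ^ i / fact i * fps_nth (c h) (Suc k - i) = 0"
      proof
        fix i assume "i \<in> {..Suc k} - {0, 1}"
        then have "Suc k - i < k" by auto
        then show "v g ^ i / fact i * fps_nth (c h) (Suc k - i) = 0" using low that(2) by simp
      qed
    qed auto
    then show ?thesis using nth[OF that, of "Suc k"] by simp
  qed
  let ?\<psi> = "\<lambda>g. if g \<in> carrier G then fps_nth (c g) k else 0"
  have "?\<psi> \<in> H1 G" using k by (auto simp: H1_def hom_def real_add_group_def)
  \<comment> \<open>As \<open>?\<psi>\<close> vanishes at \<open>s\<close> and \<open>v\<close> does
    not, the factor would be 0, but a leading coefficient is not identically 0.\<close>
  moreover have "?\<psi> \<noteq> (\<lambda>g. r * v g)" for r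
  proof
    assume eq: "?\<psi> = (\<lambda>g. r * v g)"
    then have "r = 0" using fun_cong[OF eq, of s] s by simp
    then show False using fun_cong[OF eq, of g1] g1 by simp
  qed
  moreover have "cup_trivial v ?\<psi>"
    unfolding cup_trivial_def by (rule exI[of _ "\<lambda>g. fps_nth (c g) (Suc k)"]) (simp add: Sk)
  ultimately show ?thesis using v unfolding resonance1_iff by blast
qed

lemma fps_X_exp_quotient: "fps_X * (fps_const a * exp_quotient a) = fps_exp a - 1"
proof (rule fps_ext)
  fix n
  show "fps_nth (fps_X * (fps_const a * exp_quotient a)) n = fps_nth (fps_exp a - 1) n"
    by (cases n) (auto simp: exp_quotient_def field_simps)
qed

text \<open>The cocycle with constant coefficient \<open>\<psi>\<close> is normalised at
  \<open>s\<close> by a multiple of the principal one. The result \<open>c'\<close> has constant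
  coefficient \<open>v(s) \<psi>(g) - \<psi>(s) v(g)\<close>, which vanishes for all
  \<open>g\<close> only if \<open>\<psi>\<close> is a multiple of \<open>v\<close>.\<close>

lemma resonance1_imp_exp_cocycle:
  assumes "one_formal G" "v \<in> resonance1 G" and s: "s \<in> carrier G" "v s \<noteq> 0"
  shows "\<exists>c. exp_cocycle G v c \<and> (\<exists>g\<in>carrier G. c g \<noteq> 0) \<and> c s = 0"
proof -
  obtain X :: "nat set" and R \<phi> where pres: "R \<subseteq> qspace {t. set_magma t \<subseteq> X \<and> leaves t = 2}"
    "filtered_lie_iso (malcev_lie G) (completed_presented_lie X R) \<phi>"
    using assms(1) unfolding one_formal_def by blast
  obtain \<psi> u where vH: "v \<in> H1 G" and \<psi>: "\<psi> \<in> H1 G" "\<And>r. \<psi> \<noteq> (\<lambda>g. r * v g)"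
    and uH: "\<And>g h. g \<in> carrier G \<Longrightarrow> h \<in> carrier G \<Longrightarrow> u (g \<otimes> h) = u g + u h + v g * \<psi> h"
    using assms(2) unfolding resonance1_iff cup_trivial_def by blast
  interpret massey_pair G X R \<phi> v \<psi> u
    by unfold_locales (simp_all add: pres H1_mult vH \<psi>(1) uH)
  obtain c where c: "\<And>g h. g \<in> carrier G \<Longrightarrow> h \<in> carrier G \<Longrightarrow> c (g \<otimes> h) = c g + fps_exp (v g) * c h"
    "\<And>g. g \<in> carrier G \<Longrightarrow> fps_nth (c g) 0 = \<psi> g"
    using exponential_cocycle[OF s] by metis
  \<comment> \<open>The principal cocycle divided by \<open>t\<close>, so that its constant
    coefficient is \<open>v\<close>.\<close>
  define e where "e g = fps_const (v g) * exp_quotient (v g)" for g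
  have e: "e (g \<otimes> h) = e g + fps_exp (v g) * e h" if "g \<in> carrier G" "h \<in> carrier G" for g h
  proof -
    have "fps_X * e (g \<otimes> h) = fps_X * (e g + fps_exp (v g) * e h)"
      unfolding distrib_left mult.left_commute[of fps_X "fps_exp (v g)"] e_def fps_X_exp_quotient
      using v[OF that] by (simp add: fps_exp_add_mult algebra_simps)
    then show ?thesis by (simp add: mult_cancel_left)
  qed
  define c' where "c' g = e s * c g - c s * e g" for g
  have "exp_cocycle G v c'"
    unfolding exp_cocycle_def c'_def using c(1) e by (simp add: algebra_simps)
  moreover have "c' s = 0" by (simp add: c'_def)
  moreover have "\<exists>g\<in>carrier G. c' g \<noteq> 0"
  proof (rule ccontr)
    assume "\<not> (\<exists>g\<in>carrier G. c' g \<noteq> 0)"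
    then have "fps_nth (c' g) 0 = 0" if "g \<in> carrier G" for g using that by simp
    then have "v s * \<psi> g = \<psi> s * v g" if "g \<in> carrier G" for g
      using that c(2) s(1) by (simp add: c'_def e_def exp_quotient_def)
    then have "\<psi> g = \<psi> s / v s * v g" if "g \<in> carrier G" for g
      using that s(2) by (simp add: field_simps)
    moreover have "\<psi> g = \<psi> s / v s * v g" if "g \<notin> carrier G" for g
      using that vH \<psi>(1) by (simp add: H1_def)
    ultimately have "\<psi> = (\<lambda>g. \<psi> s / v s * v g)" by blast
    with \<psi>(2) show False by blast
  qed
  ultimately show ?thesis by blast
qed

end

lemma (in group) arrangement_cocycle_locus:
  assumes S: "finite S" "S \<subseteq> carrier G" "generate G S = carrier G"
  shows "arrangement {v \<in> H1 G. \<forall>s\<in>S.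
    \<exists>c. exp_cocycle G v c \<and> (\<exists>g\<in>carrier G. c g \<noteq> 0) \<and> c s = 0}"
proof -
  let ?E = "\<lambda>s v. \<exists>c. exp_cocycle G v c \<and> (\<exists>g\<in>carrier G. c g \<noteq> 0) \<and> c s = 0"
  obtain ss where ss: "set ss = S" using finite_list[OF S(1)] by blast
  have "\<forall>s\<in>S. \<exists>Z. Z \<subseteq> exp_polys G \<and> (\<forall>v\<in>H1 G. ?E s v \<longleftrightarrow> (\<forall>F\<in>Z. F v = 0))"
  proof
    fix s assume s: "s \<in> S"
    obtain Z where "Z \<subseteq> exp_polys G" "\<And>v. v \<in> H1 G \<Longrightarrow> ?E s v \<longleftrightarrow> (\<forall>F\<in>Z. F v = 0)"
      by (rule exp_cocycle_determinantal[of ss s]) (use ss S s in auto)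
    then show "\<exists>Z. Z \<subseteq> exp_polys G \<and> (\<forall>v\<in>H1 G. ?E s v \<longleftrightarrow> (\<forall>F\<in>Z. F v = 0))"
      by (intro exI[of _ Z]) simp
  qed
  from bchoice[OF this] obtain Z where
    Z: "\<forall>s\<in>S. Z s \<subseteq> exp_polys G \<and> (\<forall>v\<in>H1 G. ?E s v \<longleftrightarrow> (\<forall>F\<in>Z s. F v = 0))" by (elim exE)
  let ?\<Y> = "(\<lambda>F. {v \<in> H1 G. F v = 0}) ` (\<Union>s\<in>S. Z s)"
  have "arrangement (H1 G \<inter> \<Inter>?\<Y>)"
    by (rule arrangement_Inter[OF S]) (use Z in \<open>auto intro!: arrangement_exp_poly\<close>)
  also have "H1 G \<inter> \<Inter>?\<Y> = {v \<in> H1 G. \<forall>s\<in>S. ?E s v}"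
    using Z by auto
  finally show ?thesis .
qed

text \<open>The condition has content only at generators with \<open>v s \<noteq> 0\<close>, and one
  exists as \<open>v\<close> is not 0. At a generator with value 0 the principal cocycle fulfils it:
  it vanishes there but not everywhere.\<close>

lemma (in group) resonance1_iff_exp_cocycle:
  assumes "one_formal G" and S: "S \<subseteq> carrier G" "generate G S = carrier G"
    and v: "v \<in> H1 G" "v \<noteq> 0"
  shows "v \<in> resonance1 G \<longleftrightarrow>
    (\<forall>s\<in>S. \<exists>c. exp_cocycle G v c \<and> (\<exists>g\<in>carrier G. c g \<noteq> 0) \<and> c s = 0)"
proof -
  obtain s where s: "s \<in> S" "v s \<noteq> 0"
  proof -
    obtain g where g: "v g \<noteq> 0" using v(2) by (auto simp: fun_eq_iff)
    then have "g \<in> carrier G" using v(1) by (auto simp: H1_iff)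
    then show thesis using H1_eq_0[OF v(1) S(1), of g] g S(2) that by blast
  qed
  show ?thesis
  proof
    assume R: "v \<in> resonance1 G"
    show "\<forall>r\<in>S. \<exists>c. exp_cocycle G v c \<and> (\<exists>g\<in>carrier G. c g \<noteq> 0) \<and> c r = 0"
    proof
      fix r assume r: "r \<in> S"
      show "\<exists>c. exp_cocycle G v c \<and> (\<exists>g\<in>carrier G. c g \<noteq> 0) \<and> c r = 0"
      proof (cases "v r = 0")
        case True
        have "exp_cocycle G v (\<lambda>g. fps_exp (v g) - 1)"
          by (simp add: exp_cocycle_def H1_mult[OF v(1)] fps_exp_add_mult algebra_simps)
        moreover have "fps_exp (v s) - 1 \<noteq> 0"
        proof
          assume "fps_exp (v s) - 1 = 0"
          then have "fps_nth (fps_exp (v s) - 1) 1 = 0" by simp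
          then show False using s(2) by simp
        qed
        ultimately show ?thesis
          using True s(1) S(1) by (intro exI[of _ "\<lambda>g. fps_exp (v g) - 1"]) auto
      next
        case False
        then show ?thesis using resonance1_imp_exp_cocycle[OF assms(1) R] r S(1) by blast
      qed
    qed
  next
    assume "\<forall>r\<in>S. \<exists>c. exp_cocycle G v c \<and> (\<exists>g\<in>carrier G. c g \<noteq> 0) \<and> c r = 0"
    with s(1) obtain c g where "exp_cocycle G v c" "g \<in> carrier G" "c g \<noteq> 0" "c s = 0" by blast
    then show "v \<in> resonance1 G"
      using exp_cocycle_imp_resonance1[OF v(1)] s S(1) by blast
  qed
qed

text \<open>Multiplication by 0 is the zero differential, so the cohomology in question is all of
  \<open>H1 G\<close>.\<close>

lemma (in group) zero_in_resonance1_iff: "0 \<in> resonance1 G \<longleftrightarrow> H1 G \<noteq> {0}"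
proof -
  have 0: "0 \<in> H1 G" by (simp add: H1_iff)
  have "cup_trivial 0 \<psi>" for \<psi>
    unfolding cup_trivial_def by (rule exI[of _ "\<lambda>_. 0"]) simp
  then have "0 \<in> resonance1 G \<longleftrightarrow> (\<exists>\<psi>\<in>H1 G. \<psi> \<noteq> 0)"
    using 0 unfolding resonance1_iff by (auto simp: zero_fun_def)
  then show ?thesis using 0 by blast
qed

lemma (in group) equalizer_carrier: "equalizer G (carrier G \<times> carrier G) = {0}"
proof (intro equalityI subsetI)
  fix \<chi> assume "\<chi> \<in> equalizer G (carrier G \<times> carrier G)"
  then have H: "\<chi> \<in> H1 G" and eq: "\<And>g. g \<in> carrier G \<Longrightarrow> \<chi> g = \<chi> \<one>"
    unfolding equalizer_def by fast+
  have "\<chi> g = 0" for g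
    using eq[of g] H1_one[OF H] H by (cases "g \<in> carrier G") (simp_all add: H1_iff)
  then show "\<chi> \<in> {0}" by (simp add: fun_eq_iff)
qed (simp add: equalizer_def H1_iff)

theorem proposition11p1:
  fixes G :: "'a monoid" and S :: "'a set"
  assumes "group G"
    and "finite S" and "S \<subseteq> carrier G" and "generate G S = carrier G"
    and "one_formal G"
  shows "(\<exists>\<L>. finite \<L> \<and> (\<forall>L\<in>\<L>. rational_subspace G L) \<and> resonance1 G = \<Union>\<L>) \<and>
    BNS G S \<subseteq> H1 G - resonance1 G"
proof
  interpret group G by fact
  note S = assms(2-4)
  note iff = resonance1_iff_exp_cocycle[OF assms(5) S(2,3)]
  let ?C = "{v \<in> H1 G. \<forall>s\<in>S. \<exists>c. exp_cocycle G v c \<and> (\<exists>g\<in>carrier G. c g \<noteq> 0) \<and> c s = 0}"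
  have sub: "resonance1 G \<subseteq> H1 G" unfolding resonance1_def by (rule Collect_restrict)
  show "\<exists>\<L>. finite \<L> \<and> (\<forall>L\<in>\<L>. rational_subspace G L) \<and> resonance1 G = \<Union>\<L>"
  proof (cases "H1 G = {0}")
    \<comment> \<open>Without nonzero characters not even 0 is resonant, and the union is
      empty.\<close>
    case True
    then have "0 \<notin> resonance1 G" by (simp add: zero_in_resonance1_iff)
    moreover have "resonance1 G = {} \<or> resonance1 G = {0}"
      using sub True by (intro subset_singletonD) simp
    ultimately have "resonance1 G = {}" by auto
    then show ?thesis by (intro exI[of _ "{}"]) simp
  next
    case False
    obtain \<P> where \<P>: "finite \<P>" "?C = (\<Union>P\<in>\<P>. equalizer G P)"
      using arrangement_cocycle_locus[OF S] unfolding arrangement_def by (elim exE conjE)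
    let ?Z = "carrier G \<times> carrier G"
    \<comment> \<open>The criterion speaks of nonzero characters; 0 is resonant here and joins as a
      subspace of its own, the equalizer of all pairs.\<close>
    have "resonance1 G = insert 0 ?C"
    proof (rule Set.set_eqI)
      fix v
      show "v \<in> resonance1 G \<longleftrightarrow> v \<in> insert 0 ?C"
      proof (cases "v = 0")
        case True
        then show ?thesis using False by (simp add: zero_in_resonance1_iff)
      next
        case nz: False
        show ?thesis
        proof (cases "v \<in> H1 G")
          case True
          then show ?thesis using nz iff[OF True nz] by simp
        next
          case False
          then show ?thesis using nz sub by auto
        qed
      qed
    qed
    also have "\<dots> = \<Union>(equalizer G ` insert ?Z \<P>)"
      unfolding \<P>(2) by (simp add: equalizer_carrier)
    finally have "resonance1 G = \<Union>(equalizer G ` insert ?Z \<P>)" .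
    moreover have "finite (equalizer G ` insert ?Z \<P>)" using \<P>(1) by simp
    moreover have "\<forall>L\<in>equalizer G ` insert ?Z \<P>. rational_subspace G L"
      using rational_subspace_equalizer[OF S] by blast
    ultimately show ?thesis by (intro exI conjI)
  qed
  show "BNS G S \<subseteq> H1 G - resonance1 G"
  proof
    fix v assume v: "v \<in> BNS G S"
    then have H: "v \<in> H1 G" "v \<noteq> 0" by (auto simp: BNS_def)
    have "v \<notin> resonance1 G"
    proof
      assume R: "v \<in> resonance1 G"
      obtain g where "v g \<noteq> 0" using H(2) by (auto simp: fun_eq_iff)
      moreover from this have "g \<in> carrier G" using H(1) by (auto simp: H1_iff)
      ultimately obtain s where s: "s \<in> S" "v s \<noteq> 0"
        using H1_eq_0[OF H(1) S(2), of g] S(3) by blast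
      obtain c g where "exp_cocycle G v c" "g \<in> carrier G" "c g \<noteq> 0" "c s = 0"
        using bspec[OF iffD1[OF iff[OF H] R] s(1)] by blast
      then show False using BNS_exp_cocycle_zero[OF v S _ s] by simp
    qed
    then show "v \<in> H1 G - resonance1 G" using H by blast
  qed
qed

end
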